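(* Let $C$ be a generic tropical curve of genus $3$ of type $K_4$, i.e. $C$ is given by the complete graph $K_4$ on four vertices with edge lengths $(a,b,c,d,e,f)\in\mathbb{R}_{>0}^6$ that are generic. Then the cycle $W_1$ (the Abel–Jacobi image of $C$) is not algebraically equivalent to $W_1^-:=(-1)_*W_1$ in the tropical Jacobian $J(C)$.
   Context: **Generic.** "Generic" edge lengths means: outside a countable union of proper real algebraic subsets (zero sets of nonzero polynomials) of the space of edge lengths. **Tropical curves.** A metric graph is a connected finite graph $\Gamma$, with set of 1-valent vertices $\mathcal V_1(\Gamma)$, such that $\Gamma\setminus \mathcal V_1(\Gamma)$ carries a complete metric structure and $\Gamma$ is its compactification (so all leaf edges have infinite length, all other edges finite positive length). A tropical curve is an equivalence class of metric graphs modulo inserting/removing 2-valent vertices in the interior of edges; its genus is $b_1(\Gamma)$. **Jacobian.** Let $C$ be a tropical curve of genus $g$ (infinite leaves may be removed without affecting the constructions). Let $\ell_\epsilon$ be the length of an edge $\epsilon$. $\Omega_{\mathbb Z}(C)\cong\mathbb Z^g$ is the group of integral 1-forms: assignments of an integer $\omega(\epsilon)$ to each oriented edge, changing sign when the orientation is reversed, with zero sum over the outgoing edges at each vertex. Put $\int_\epsilon\omega=\ell_\epsilon\,\omega(\epsilon)$ (and proportionally for segments of edges). Let $\Gamma_2=\mathrm{Hom}(\Omega_{\mathbb Z}(C),\mathbb Z)$, $\Omega(C)=\Omega_{\mathbb Z}(C)\otimes\mathbb R$, $V=\Omega(C)^*=\Gamma_2\otimes\mathbb R$. The group $\Gamma_1=H_1(C,\mathbb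 Z)$ is embedded in $V$ as a lattice by integration. The Jacobian is the real torus $J(C)=V/\Gamma_1$, with tropical (integral affine) structure given by the lattice $\Gamma_2\subset V$. **Abel–Jacobi image.** Fix $p_0\in C$. Let $\mu: C\to J(C)$ send $p$ to the class of the functional $\omega\mapsto\int_{p_0}^{p}\omega$ (integration along any path). $W_1=\mu(C)$, a 1-cycle in $J(C)$ with weight one on each edge. The map $(-1):J(C)\to J(C)$ is $x\mapsto -x$ and $(-1)_*$ is the push-forward of cycles (weights preserved). Changing $p_0$ translates the cycles, which does not change their algebraic equivalence class. **Algebraic cycles.** An algebraic $k$-cycle in $J=J(C)$ is a finite weighted (integer weights) polyhedral complex of pure dimension $k$ in $J$, with $\Gamma_2$-rational slopes, balanced: at each $(k-1)$-dimensional cell $\rho$, $\sum_{\tau\supset\rho} w_\tau v_{\tau/\rho}$ lies in the linear span of $\rho$, where $\tau$ runs over adjacent $k$-cells, $w_\tau$ is the weight and $v_{\tau/\rho}$ is an integral vector generating, modulo the lattice of $\rho$, the lattice of $\tau$ in the direction pointing into $\tau$. Cycles are taken up to subdivision and added weight-wise. For a tropical curve $S$, algebraic cycles in $J\times S$ are defined the same way, where the integral tangent lattice at a point over the interior of an edge of $S$ is $\Gamma_2\oplus\mathbb Z$ (with $\mathbb{Z}$ generated by the unit tangent vector of the edge), and over a vertex $s$ of $S$ of valence $n\ge 2$ it is $\Gamma_2\oplus\mathbb Z^n/\mathbb Z(1,\dots,1)$, the unit outgoing vectors of the $n$ edges being the images of the standard basis vectors (so they sum to zero). Over a neighbourhood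 of an infinite (1-valent) point of $S$ a cycle is a product of a cycle in $J$ with the neighbourhood, and no cell lies entirely over the infinite point. **Intersection with a fibre.** For an algebraic $(k+1)$-cycle $W\subset J\times S$ and a point $s\in S$, $W\cap(J\times s)$ denotes the tropical (stable) intersection. If $s$ is an interior point of an edge and is not the image of any cell of $W$ contracted by the projection $\pi':J\times S\to S$, it is the set-theoretic fibre, where the cell $\tau\cap(J\times s)$ of a $(k+1)$-cell $\tau$ has weight $w_\tau m_\tau$, $m_\tau$ being the index in $\mathbb Z$ of the image of the lattice of $\tau$ under the differential of $\pi'$. For arbitrary $s$ it is the limit of the cycles $W\cap(J\times s')$ as $s'\to s$ along any edge adjacent to $s$ (by balancing it does not depend on the edge). **Algebraic equivalence.** Two $k$-cycles $Z_1,Z_2$ in $J$ are algebraically equivalent if there are a tropical curve $S$, two points $s_1,s_2\in S$ and an algebraic cycle $W\subset J\times S$ such that $\pi_*[W\cap(J\times s_1)-W\cap(J\times s_2)]=Z_1-Z_2$, where $\pi:J\times S\to J$ is the projection. *)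

theory Defs
  imports "HOL-Analysis.Analysis"
begin

section \<open>Metric graphs\<close>

text \<open>
  A tropical curve is given by one of its metric graph models. Edges carry an auxiliary
  orientation; loops and multiple edges are allowed. A pair \<open>(e, b)\<close> stands at the same time for
  an end of the edge \<open>e\<close> (\<open>b = False\<close>: tail, \<open>b = True\<close>: head) and for the edge \<open>e\<close> oriented so
  that it leaves that end. A point in the interior of \<open>e\<close> is given by its distance from the tail.
\<close>

record ('v, 'e) mgraph =
  verts :: "'v set"
  edges :: "'e set"
  tail :: "'e \<Rightarrow> 'v"
  head :: "'e \<Rightarrow> 'v"
  len :: "'e \<Rightarrow> ereal"

datatype ('v, 'e) point = VPoint 'v | EPoint 'e real

definition source :: "('v, 'e) mgraph \<Rightarrow> 'e \<times> bool \<Rightarrow> 'v" where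
  "source G h = (if snd h then head G (fst h) else tail G (fst h))"

definition target :: "('v, 'e) mgraph \<Rightarrow> 'e \<times> bool \<Rightarrow> 'v" where
  "target G h = source G (fst h, \<not> snd h)"

definition end_pos :: "('v, 'e) mgraph \<Rightarrow> 'e \<times> bool \<Rightarrow> ereal" where
  "end_pos G h = (if snd h then len G (fst h) else 0)"

definition half_edges :: "('v, 'e) mgraph \<Rightarrow> 'v \<Rightarrow> ('e \<times> bool) set" where
  "half_edges G v = {h. fst h \<in> edges G \<and> source G h = v}"

definition valence :: "('v, 'e) mgraph \<Rightarrow> 'v \<Rightarrow> nat" where
  "valence G v = card (half_edges G v)"

fun walk :: "('v, 'e) mgraph \<Rightarrow> 'v \<Rightarrow> ('e \<times> bool) list \<Rightarrow> 'v \<Rightarrow> bool" where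
  "walk G u [] v \<longleftrightarrow> u = v"
| "walk G u (h # hs) v \<longleftrightarrow> fst h \<in> edges G \<and> source G h = u \<and> walk G (target G h) hs v"

text \<open>
  Exactly the leaf edges are infinite. An infinite edge is oriented towards its infinite
  (1-valent) end, so that it is parametrised by \<open>[0, \<infinity>]\<close>; an edge with two infinite ends has to be
  subdivided by a 2-valent vertex, which does not change the tropical curve.
\<close>

definition metric_graph :: "('v, 'e) mgraph \<Rightarrow> bool" where
  "metric_graph G \<longleftrightarrow>
     finite (verts G) \<and> finite (edges G) \<and> edges G \<noteq> {} \<and>
     (\<forall>e\<in>edges G. tail G e \<in> verts G \<and> head G e \<in> verts G \<and> 0 < len G e \<and>
        valence G (tail G e) \<noteq> 1 \<and> (valence G (head G e) = 1 \<longleftrightarrow> len G e = \<infinity>)) \<and>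
     (\<forall>u\<in>verts G. \<forall>v\<in>verts G. \<exists>hs. walk G u hs v)"

definition points :: "('v, 'e) mgraph \<Rightarrow> ('v, 'e) point set" where
  "points G = VPoint ` verts G \<union> {EPoint e t |e t. e \<in> edges G \<and> 0 < t \<and> ereal t < len G e}"


section \<open>The Jacobian and the Abel--Jacobi image\<close>

text \<open>
  The value of a form on \<open>e\<close> oriented from tail to head is stored. The simplicial 1-cycles, that
  is, the elements of \<open>H\<^sub>1(C, \<int>)\<close>, satisfy the very same equations.
\<close>

definition integral_forms :: "('v, 'e) mgraph \<Rightarrow> ('e \<Rightarrow> int) set" where
  "integral_forms G =
     {\<omega>. (\<forall>e. e \<notin> edges G \<longrightarrow> \<omega> e = 0) \<and>
         (\<forall>v\<in>verts G. (\<Sum>h\<in>half_edges G v. if snd h then - \<omega> (fst h) else \<omega> (fst h)) = 0)}"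

text \<open>
  A basis \<open>\<omega>\<close> of the integral forms identifies the dual \<open>V\<close> of the space of real forms with
  \<open>real ^ 'g\<close>, a functional being given by its values on the basis. The lattice \<open>\<Gamma>\<^sub>2\<close> becomes the
  lattice of integer vectors, and \<open>\<Gamma>\<^sub>1\<close> the lattice of periods. Subsets of the Jacobian are
  described by their preimages in \<open>V\<close>.
\<close>

definition forms_basis :: "('v, 'e) mgraph \<Rightarrow> ('g::finite \<Rightarrow> 'e \<Rightarrow> int) \<Rightarrow> bool" where
  "forms_basis G \<omega> \<longleftrightarrow>
     (\<forall>i. \<omega> i \<in> integral_forms G) \<and>
     (\<forall>\<eta>\<in>integral_forms G. \<exists>!c :: 'g \<Rightarrow> int. \<forall>e. \<eta> e = (\<Sum>i\<in>UNIV. c i * \<omega> i e))"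

definition int_vectors :: "(real ^ 'g) set" where
  "int_vectors = {x. \<forall>i. x $ i \<in> \<int>}"

definition edge_vec :: "('g::finite \<Rightarrow> 'e \<Rightarrow> int) \<Rightarrow> 'e \<Rightarrow> real ^ 'g" where
  "edge_vec \<omega> e = (\<chi> i. of_int (\<omega> i e))"

definition edge_integral ::
    "('v, 'e) mgraph \<Rightarrow> ('g::finite \<Rightarrow> 'e \<Rightarrow> int) \<Rightarrow> 'e \<Rightarrow> real ^ 'g" where
  "edge_integral G \<omega> e = real_of_ereal (len G e) *\<^sub>R edge_vec \<omega> e"

definition period_lattice :: "('v, 'e) mgraph \<Rightarrow> ('g::finite \<Rightarrow> 'e \<Rightarrow> int) \<Rightarrow> (real ^ 'g) set" where
  "period_lattice G \<omega> =
     (\<lambda>c. \<Sum>e\<in>edges G. of_int (c e) *\<^sub>R edge_integral G \<omega> e) ` integral_forms G"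

definition walk_integral ::
    "('v, 'e) mgraph \<Rightarrow> ('g::finite \<Rightarrow> 'e \<Rightarrow> int) \<Rightarrow> ('e \<times> bool) list \<Rightarrow> real ^ 'g" where
  "walk_integral G \<omega> hs =
     (\<Sum>h\<leftarrow>hs. if snd h then - edge_integral G \<omega> (fst h) else edge_integral G \<omega> (fst h))"

text \<open>
  The integrals along all paths from \<open>p\<^sub>0\<close> to the vertex \<open>v\<close>, i.e. the preimage in \<open>V\<close> of the
  point \<open>\<mu>(v)\<close>. A path starting in the interior of an edge may first go to the tail.
\<close>

fun vertex_lifts ::
    "('v, 'e) mgraph \<Rightarrow> ('g::finite \<Rightarrow> 'e \<Rightarrow> int) \<Rightarrow> ('v, 'e) point \<Rightarrow> 'v \<Rightarrow> (real ^ 'g) set" where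
  "vertex_lifts G \<omega> (VPoint u) v = {walk_integral G \<omega> hs |hs. walk G u hs v}"
| "vertex_lifts G \<omega> (EPoint e t) v =
     {walk_integral G \<omega> hs - t *\<^sub>R edge_vec \<omega> e |hs. walk G (tail G e) hs v}"

record 'a wcomplex =
  cells :: "'a set set"
  weight :: "'a set \<Rightarrow> int"

definition abel_jacobi_cycle ::
    "('v, 'e) mgraph \<Rightarrow> ('g::finite \<Rightarrow> 'e \<Rightarrow> int) \<Rightarrow> ('v, 'e) point \<Rightarrow> (real ^ 'g) wcomplex" where
  "abel_jacobi_cycle G \<omega> p\<^sub>0 =
     \<lparr>cells = {{x} |x v. v \<in> verts G \<and> x \<in> vertex_lifts G \<omega> p\<^sub>0 v} \<union>
        {closed_segment x (x + edge_integral G \<omega> e) |x e.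
           e \<in> edges G \<and> x \<in> vertex_lifts G \<omega> p\<^sub>0 (tail G e)},
      weight = (\<lambda>_. 1)\<rparr>"

definition neg_cycle :: "'a::ab_group_add wcomplex \<Rightarrow> 'a wcomplex" where
  "neg_cycle Z = \<lparr>cells = (`) uminus ` cells Z, weight = (\<lambda>P. weight Z (uminus ` P))\<rparr>"


section \<open>Cycles in a torus up to subdivision\<close>

text \<open>
  A cycle in \<open>V / \<Gamma>\<close> is described by the \<open>\<Gamma>\<close>-periodic complex of all lifts of its cells.
  Up to subdivision a \<open>k\<close>-cycle is determined by its weight function, which is considered away
  from the image of a finite union of polytopes of dimension less than \<open>k\<close>; addition of cycles
  is addition of weight functions.
\<close>

definition weight_fun :: "nat \<Rightarrow> 'a::euclidean_space wcomplex \<Rightarrow> 'a \<Rightarrow> int" where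
  "weight_fun k Z x = (\<Sum>P | P \<in> cells Z \<and> aff_dim P = int k \<and> x \<in> P. weight Z P)"

definition cycle_eq :: "'a::euclidean_space set \<Rightarrow> nat \<Rightarrow> ('a \<Rightarrow> int) \<Rightarrow> ('a \<Rightarrow> int) \<Rightarrow> bool" where
  "cycle_eq \<Gamma> k f g \<longleftrightarrow>
     (\<exists>N. finite N \<and> (\<forall>Q\<in>N. polytope Q \<and> aff_dim Q < int k) \<and>
        (\<forall>x. (\<forall>Q\<in>N. \<forall>\<gamma>\<in>\<Gamma>. x \<notin> (+) \<gamma> ` Q) \<longrightarrow> f x = g x))"


section \<open>Algebraic cycles in the product of a torus and a tropical curve\<close>

definition direction :: "'a::real_vector set \<Rightarrow> 'a set" where
  "direction P = span {x - y |x y. x \<in> P \<and> y \<in> P}"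

definition cell_lattice :: "'a::real_vector set \<Rightarrow> 'a set \<Rightarrow> 'a set" where
  "cell_lattice L P = direction P \<inter> L"

definition rational_slope :: "'a::real_vector set \<Rightarrow> 'a set \<Rightarrow> bool" where
  "rational_slope L P \<longleftrightarrow> span (cell_lattice L P) = direction P"

definition primitive_normal :: "'a::real_vector set \<Rightarrow> 'a set \<Rightarrow> 'a set \<Rightarrow> 'a \<Rightarrow> bool" where
  "primitive_normal L \<rho> \<tau> v \<longleftrightarrow>
     v \<in> cell_lattice L \<tau> \<and>
     (\<forall>u\<in>cell_lattice L \<tau>. \<exists>n::int. u - of_int n *\<^sub>R v \<in> cell_lattice L \<rho>) \<and>
     (\<exists>x\<in>\<rho>. \<exists>\<epsilon>>0. x + \<epsilon> *\<^sub>R v \<in> \<tau>)"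

text \<open>
  A complex in \<open>V / \<Gamma> \<times> S\<close>. The cells over an edge \<open>e\<close> are polyhedra in \<open>V \<times> [0, len e]\<close> that do
  not lie over an end of \<open>e\<close>; the cells over a vertex are polytopes in \<open>V\<close>. Again all lifts to
  \<open>V \<times> S\<close> of the cells are recorded.
\<close>

record ('v, 'e, 'a) prod_complex =
  vcells :: "'v \<Rightarrow> 'a set set"
  ecells :: "'e \<Rightarrow> ('a \<times> real) set set"
  vweight :: "'v \<Rightarrow> 'a set \<Rightarrow> int"
  eweight :: "'e \<Rightarrow> ('a \<times> real) set \<Rightarrow> int"

abbreviation edge_lattice :: "((real ^ 'g) \<times> real) set" where
  "edge_lattice \<equiv> int_vectors \<times> \<int>"

definition over_end :: "('v, 'e) mgraph \<Rightarrow> 'e \<times> bool \<Rightarrow> ('a \<times> real) set \<Rightarrow> bool" where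
  "over_end S h P \<longleftrightarrow> (\<forall>p\<in>P. ereal (snd p) = end_pos S h)"

definition periodic_finite :: "'a::ab_group_add set \<Rightarrow> 'a set set \<Rightarrow> ('a set \<Rightarrow> int) \<Rightarrow> bool" where
  "periodic_finite \<Gamma> X w \<longleftrightarrow>
     (\<forall>P\<in>X. \<forall>\<gamma>\<in>\<Gamma>. (+) \<gamma> ` P \<in> X \<and> w ((+) \<gamma> ` P) = w P) \<and>
     (\<exists>F. finite F \<and> F \<subseteq> X \<and> (\<forall>P\<in>X. \<exists>Q\<in>F. \<exists>\<gamma>\<in>\<Gamma>. P = (+) \<gamma> ` Q))"

text \<open>
  The existence of \<open>T\<close> and \<open>Q\<close> below expresses that a cell over an infinite edge is a product
  near the infinite point.
\<close>

definition edge_cell :: "('v, 'e) mgraph \<Rightarrow> 'e \<Rightarrow> ((real ^ 'g) \<times> real) set \<Rightarrow> bool" where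
  "edge_cell S e P \<longleftrightarrow>
     P \<noteq> {} \<and> polyhedron P \<and> bounded (fst ` P) \<and> rational_slope edge_lattice P \<and>
     (\<forall>p\<in>P. 0 \<le> snd p \<and> ereal (snd p) \<le> len S e) \<and> (\<forall>b. \<not> over_end S (e, b) P) \<and>
     (len S e = \<infinity> \<longrightarrow> (\<exists>T Q. P \<inter> UNIV \<times> {T..} = Q \<times> {T..}))"

definition is_prod_complex ::
    "(real ^ 'g) set \<Rightarrow> ('v, 'e) mgraph \<Rightarrow> nat \<Rightarrow> ('v, 'e, real ^ 'g) prod_complex \<Rightarrow> bool" where
  "is_prod_complex \<Gamma> S d W \<longleftrightarrow>
     (\<forall>v\<in>verts S.
        (valence S v = 1 \<longrightarrow> vcells W v = {}) \<and>
        periodic_finite \<Gamma> (vcells W v) (vweight W v) \<and>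
        (\<forall>P\<in>vcells W v.
           P \<noteq> {} \<and> polytope P \<and> rational_slope int_vectors P \<and>
           (\<forall>F. F face_of P \<and> F \<noteq> {} \<longrightarrow> F \<in> vcells W v) \<and>
           (\<forall>P'\<in>vcells W v. P \<inter> P' face_of P) \<and>
           ((\<exists>P'\<in>vcells W v. P \<subseteq> P' \<and> aff_dim P' = int d) \<or>
            (\<exists>h\<in>half_edges S v. \<exists>P'\<in>ecells W (fst h).
               P \<times> {real_of_ereal (end_pos S h)} \<subseteq> P' \<and> aff_dim P' = int d)))) \<and>
     (\<forall>e\<in>edges S.
        periodic_finite (\<Gamma> \<times> {0}) (ecells W e) (eweight W e) \<and>
        (\<forall>P\<in>ecells W e.
           edge_cell S e P \<and>
           (\<forall>F. F face_of P \<and> F \<noteq> {} \<longrightarrow>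
              (\<forall>b. over_end S (e, b) F \<longrightarrow> fst ` F \<in> vcells W (source S (e, b))) \<and>
              ((\<forall>b. \<not> over_end S (e, b) F) \<longrightarrow> F \<in> ecells W e)) \<and>
           (\<forall>P'\<in>ecells W e. P \<inter> P' face_of P) \<and>
           (\<exists>P'\<in>ecells W e. P \<subseteq> P' \<and> aff_dim P' = int d)))"

definition balanced_at_edge_cell ::
    "nat \<Rightarrow> ('v, 'e, real ^ 'g) prod_complex \<Rightarrow> 'e \<Rightarrow> ((real ^ 'g) \<times> real) set \<Rightarrow> bool" where
  "balanced_at_edge_cell d W e \<rho> \<longleftrightarrow>
     (let star = {\<tau> \<in> ecells W e. aff_dim \<tau> = int d \<and> \<rho> \<subseteq> \<tau>} in
      \<exists>n. (\<forall>\<tau>\<in>star. primitive_normal edge_lattice \<rho> \<tau> (n \<tau>)) \<and>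
          (\<Sum>\<tau>\<in>star. of_int (eweight W e \<tau>) *\<^sub>R n \<tau>) \<in> direction \<rho>)"

text \<open>
  At a vertex with half-edges \<open>h\<^sub>1, \<dots>, h\<^sub>n\<close> the weighted sum of the normal vectors lives in
  \<open>V \<times> \<real>\<^sup>n / \<real>(1, \<dots>, 1)\<close>: it lies in the direction of \<open>\<rho>\<close> iff its component in \<open>V\<close> does and all
  its components along the outgoing half-edges have the same value \<open>c\<close>.
\<close>

definition balanced_at_vertex_cell ::
    "('v, 'e) mgraph \<Rightarrow> nat \<Rightarrow> ('v, 'e, real ^ 'g) prod_complex \<Rightarrow> 'v \<Rightarrow> (real ^ 'g) set \<Rightarrow> bool"
  where
  "balanced_at_vertex_cell S d W v \<rho> \<longleftrightarrow>
     (let vstar = {\<tau> \<in> vcells W v. aff_dim \<tau> = int d \<and> \<rho> \<subseteq> \<tau>};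
          lift = (\<lambda>h. \<rho> \<times> {real_of_ereal (end_pos S h)});
          estar = (\<lambda>h. {\<tau> \<in> ecells W (fst h). aff_dim \<tau> = int d \<and> lift h \<subseteq> \<tau>})
      in \<exists>m n c.
        (\<forall>\<tau>\<in>vstar. primitive_normal int_vectors \<rho> \<tau> (m \<tau>)) \<and>
        (\<forall>h\<in>half_edges S v. \<forall>\<tau>\<in>estar h. primitive_normal edge_lattice (lift h) \<tau> (n h \<tau>)) \<and>
        (\<Sum>\<tau>\<in>vstar. of_int (vweight W v \<tau>) *\<^sub>R m \<tau>) +
          (\<Sum>h\<in>half_edges S v. \<Sum>\<tau>\<in>estar h. of_int (eweight W (fst h) \<tau>) *\<^sub>R fst (n h \<tau>))
          \<in> direction \<rho> \<and>
        (\<forall>h\<in>half_edges S v.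
          (\<Sum>\<tau>\<in>estar h. of_int (eweight W (fst h) \<tau>) *
             (if snd h then - snd (n h \<tau>) else snd (n h \<tau>))) = c))"

definition algebraic_cycle ::
    "(real ^ 'g) set \<Rightarrow> ('v, 'e) mgraph \<Rightarrow> nat \<Rightarrow> ('v, 'e, real ^ 'g) prod_complex \<Rightarrow> bool" where
  "algebraic_cycle \<Gamma> S d W \<longleftrightarrow>
     is_prod_complex \<Gamma> S d W \<and>
     (\<forall>e\<in>edges S. \<forall>\<rho>\<in>ecells W e. aff_dim \<rho> = int d - 1 \<longrightarrow> balanced_at_edge_cell d W e \<rho>) \<and>
     (\<forall>v\<in>verts S. \<forall>\<rho>\<in>vcells W v. aff_dim \<rho> = int d - 1 \<longrightarrow> balanced_at_vertex_cell S d W v \<rho>)"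


section \<open>Intersection with a fibre and algebraic equivalence\<close>

text \<open>The image of the lattice of the cell in \<open>\<int>\<close> is generated by, and has index, this number.\<close>

definition fibre_index :: "((real ^ 'g) \<times> real) set \<Rightarrow> int" where
  "fibre_index P = Gcd {n. \<exists>u\<in>cell_lattice edge_lattice P. snd u = of_int n}"

definition slice :: "('a \<times> real) set \<Rightarrow> real \<Rightarrow> 'a set" where
  "slice P t = {x. (x, t) \<in> P}"

definition set_limit :: "real filter \<Rightarrow> (real \<Rightarrow> 'a::metric_space set) \<Rightarrow> 'a set" where
  "set_limit D A = {x. \<forall>\<epsilon>>0. eventually (\<lambda>t. \<exists>y\<in>A t. dist y x < \<epsilon>) D}"

text \<open>The ways to approach a point of \<open>S\<close> along an adjacent edge.\<close>

fun approaches :: "('v, 'e) mgraph \<Rightarrow> ('v, 'e) point \<Rightarrow> ('e \<times> real filter) set" where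
  "approaches S (VPoint v) =
     (\<lambda>h. (fst h,
        if \<not> snd h then at_right 0
        else if len S (fst h) = \<infinity> then at_top
        else at_left (real_of_ereal (len S (fst h))))) ` half_edges S v"
| "approaches S (EPoint e t) = {(e, at_left t), (e, at_right t)}"

text \<open>
  Weight functions of the intersection of a \<open>(k+1)\<close>-cycle with the fibre over a point. In the
  second rule the limit of a cycle is the weighted sum of the limits of its cells; cells whose
  limit has dimension less than \<open>k\<close> do not matter for \<^const>\<open>cycle_eq\<close>. Contracted cells have
  empty slices over nearby points and hence empty limits.
\<close>

inductive is_fibre ::
    "('v, 'e) mgraph \<Rightarrow> nat \<Rightarrow> ('v, 'e, real ^ 'g) prod_complex \<Rightarrow>
     ('v, 'e) point \<Rightarrow> (real ^ 'g \<Rightarrow> int) \<Rightarrow> bool"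
  for S k W where
  transversal: "is_fibre S k W (EPoint e t)
      (\<lambda>x. \<Sum>\<tau> | \<tau> \<in> ecells W e \<and> aff_dim \<tau> = int (k + 1) \<and> x \<in> slice \<tau> t.
             eweight W e \<tau> * fibre_index \<tau>)"
    if "\<forall>\<tau>\<in>ecells W e. snd ` \<tau> \<noteq> {t}"
| limit: "is_fibre S k W s
      (\<lambda>x. \<Sum>\<tau> | \<tau> \<in> ecells W e \<and> aff_dim \<tau> = int (k + 1) \<and> x \<in> set_limit D (slice \<tau>).
             eweight W e \<tau> * fibre_index \<tau>)"
    if "(e, D) \<in> approaches S s"

text \<open>Every finite graph is isomorphic to one whose vertices and edges are natural numbers.\<close>

definition algebraically_equivalent ::
    "(real ^ 'g) set \<Rightarrow> nat \<Rightarrow> (real ^ 'g) wcomplex \<Rightarrow> (real ^ 'g) wcomplex \<Rightarrow> bool" where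
  "algebraically_equivalent \<Gamma> k Z\<^sub>1 Z\<^sub>2 \<longleftrightarrow>
     (\<exists>(S :: (nat, nat) mgraph) s\<^sub>1 s\<^sub>2 W f\<^sub>1 f\<^sub>2.
        metric_graph S \<and> s\<^sub>1 \<in> points S \<and> s\<^sub>2 \<in> points S \<and>
        algebraic_cycle \<Gamma> S (k + 1) W \<and>
        is_fibre S k W s\<^sub>1 f\<^sub>1 \<and> is_fibre S k W s\<^sub>2 f\<^sub>2 \<and>
        cycle_eq \<Gamma> k (\<lambda>x. f\<^sub>1 x - f\<^sub>2 x) (\<lambda>x. weight_fun k Z\<^sub>1 x - weight_fun k Z\<^sub>2 x))"


section \<open>Generic curves of type \<open>K\<^sub>4\<close>\<close>

definition K4_len :: "real ^ 6 \<Rightarrow> nat \<times> nat \<Rightarrow> real" where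
  "K4_len l e =
     (if e = (0, 1) then l $ 1 else if e = (0, 2) then l $ 2 else if e = (0, 3) then l $ 3
      else if e = (1, 2) then l $ 4 else if e = (1, 3) then l $ 5 else l $ 6)"

definition K4 :: "real ^ 6 \<Rightarrow> (nat, nat \<times> nat) mgraph" where
  "K4 l = \<lparr>verts = {..<4}, edges = {(i, j). i < j \<and> j < 4}, tail = fst, head = snd,
           len = (\<lambda>e. ereal (K4_len l e))\<rparr>"

definition generic_lengths :: "(real ^ 'n \<Rightarrow> bool) \<Rightarrow> bool" where
  "generic_lengths Q \<longleftrightarrow>
     (\<exists>\<P>. countable \<P> \<and> (\<forall>p\<in>\<P>. real_polynomial_function p \<and> p \<noteq> (\<lambda>_. 0)) \<and>
        (\<forall>l. (\<forall>i. 0 < l $ i) \<and> (\<forall>p\<in>\<P>. p l \<noteq> 0) \<longrightarrow> Q l))"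

end

theory Submission
  imports Defs
begin

text \<open>
  The obstruction is a tropical Ceresa invariant. Let \<open>\<Omega>\<close> be an alternating 3-form on \<open>V\<close> whose
  values \<open>\<Omega> \<gamma> \<gamma>' v\<close> on two periods and an integral vector lie in a group \<open>M\<close> of real numbers, and
  let \<open>r\<close> be a \<open>\<Gamma>\<close>-invariant function with \<open>r x - x \<in> \<Gamma>\<close>. A segment from \<open>p\<close> to \<open>q\<close> with
  primitive direction \<open>v\<close> gets the value \<open>\<Omega> (r p - r q) p v\<close>. Modulo \<open>M\<close> this is \<open>\<Gamma>\<close>-invariant and
  of the form \<open>K v p - K v q\<close>, so it extends to 1-cycles. For a family of 1-cycles over an edge, the
  change of the value between two fibres is a sum, over the 1-cells \<open>\<rho>\<close> transversal to the fibres,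
  of a linear functional depending only on \<open>\<rho>\<close> applied to the directions of the adjacent 2-cells,
  and it vanishes by balancing; balancing along the cells contracted by the projection shows that
  the value does not change at the vertices and critical levels either. So algebraically equivalent
  cycles have the same value modulo \<open>M\<close>.

  For \<open>K\<^sub>4\<close> take the determinant for \<open>\<Omega>\<close>, so that \<open>M\<close> is spanned by the \<open>2 \<times> 2\<close> minors of the period
  matrix. The value of \<open>W\<^sub>1\<close> is \<open>\<tau> = l\<^sub>1 l\<^sub>2 + l\<^sub>1 l\<^sub>3 + l\<^sub>2 l\<^sub>3\<close>, the lengths being those of the edges at one
  vertex, and \<open>\<Omega>\<close> being odd, that of \<open>W\<^sub>1\<^sup>-\<close> is \<open>- \<tau>\<close>. No integer combination of the
  minors is identically \<open>2 \<tau>\<close>, so \<open>2 \<tau> \<notin> M\<close> for generic lengths.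
\<close>

section \<open>Transversals\<close>

text \<open>On a segment from p to q in direction v the vector p - q is a multiple of v, so
  \<open>\<Omega> (r p - r q) p v\<close> only sees how the lattice shift r x - x changes between
  the ends. Hence \<open>r\<close> may be any choice of representatives, however discontinuous, and
  only endpoints matter. Two obstacles shape the proof. A cycle is known only through its weight
  function away from a thin set, so the value has to be recovered from germs: at every point and in
  every direction the weight of the segments leaving the point is read off at nearby points. And all
  complexes are infinite periodic sets of lifts, so the double count of sides in 2-cells takes place
  on orbits, once with representatives of the 2-cells and once with representatives of the sides.
  The functional attached to a 1-cell, called \<open>J\<close> below, comes from writing the change
  of the value of a moving segment as a difference of two terms, one for the path of each end; what
  is left over is a sum of values of \<Omega> on two periods and an integral vector.\<close>

definition transversal :: "('b \<Rightarrow> 'b \<Rightarrow> bool) \<Rightarrow> 'b set \<Rightarrow> 'b set \<Rightarrow> bool" where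
  "transversal E X R \<longleftrightarrow> R \<subseteq> X \<and> (\<forall>x\<in>X. \<exists>!r. r \<in> R \<and> E x r)"

lemma transversal_subset: "transversal E X R \<Longrightarrow> R \<subseteq> X"
  unfolding transversal_def by (elim conjE)

lemma transversal_ex1: "transversal E X R \<Longrightarrow> x \<in> X \<Longrightarrow> \<exists>!r. r \<in> R \<and> E x r"
  unfolding transversal_def by (elim conjE bspec)

lemma ex1_unique: "\<exists>!x. P x \<Longrightarrow> P x \<Longrightarrow> P y \<Longrightarrow> x = y"
  by blast

lemma transversal_bij:
  assumes E: "equivp E" and R: "transversal E X R" and R': "transversal E X R'"
  obtains f where "bij_betw f R R'" "\<And>x. x \<in> R \<Longrightarrow> E x (f x)"
proof -
  define f where "f x = (THE r. r \<in> R' \<and> E x r)" for x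
  define h where "h x = (THE r. r \<in> R \<and> E x r)" for x
  have f: "f x \<in> R' \<and> E x (f x)" "\<And>y. y \<in> R' \<Longrightarrow> E x y \<Longrightarrow> y = f x" if "x \<in> X" for x
  proof -
    have ex: "\<exists>!r. r \<in> R' \<and> E x r" by (rule transversal_ex1[OF R' that])
    show "f x \<in> R' \<and> E x (f x)" unfolding f_def by (rule theI'[OF ex])
    then show "\<And>y. y \<in> R' \<Longrightarrow> E x y \<Longrightarrow> y = f x" using ex by blast
  qed
  have h: "h x \<in> R \<and> E x (h x)" "\<And>y. y \<in> R \<Longrightarrow> E x y \<Longrightarrow> y = h x" if "x \<in> X" for x
  proof -
    have ex: "\<exists>!r. r \<in> R \<and> E x r" by (rule transversal_ex1[OF R that])
    show "h x \<in> R \<and> E x (h x)" unfolding h_def by (rule theI'[OF ex])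
    then show "\<And>y. y \<in> R \<Longrightarrow> E x y \<Longrightarrow> y = h x" using ex by blast
  qed
  note sub = transversal_subset[OF R] transversal_subset[OF R']
  have "bij_betw f R R'"
  proof (rule bij_betw_byWitness[where f' = h])
    show "\<forall>a\<in>R. h (f a) = a" using f h sub equivp_symp[OF E] by (metis subsetD)
    show "\<forall>a\<in>R'. f (h a) = a" using f h sub equivp_symp[OF E] by (metis subsetD)
    show "f ` R \<subseteq> R'" "h ` R' \<subseteq> R" using f h sub by blast+
  qed
  then show thesis using that f sub by blast
qed

lemma transversal_finite:
  assumes "equivp E" "transversal E X R" "transversal E X R'" "finite R"
  shows "finite R'"
  using transversal_bij[OF assms(1-3)] assms(4) bij_betw_finite by metis

text \<open>The tool for double counting over orbits: an invariant summand has the same total over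
  any system of representatives, so flags can be listed by their 2-cells or by their
  1-cells.\<close>

lemma sum_transversal:
  assumes "equivp E" "transversal E X R" "transversal E X R'"
    and "\<And>x y. x \<in> X \<Longrightarrow> y \<in> X \<Longrightarrow> E x y \<Longrightarrow> g x = g y"
  shows "sum g R = sum g R'"
proof -
  obtain f where f: "bij_betw f R R'" "\<And>x. x \<in> R \<Longrightarrow> E x (f x)"
    using transversal_bij[OF assms(1-3)] by metis
  have "sum g R' = (\<Sum>x\<in>R. g (f x))"
    by (rule sum.reindex_bij_betw[OF f(1), symmetric])
  also have "\<dots> = sum g R"
  proof (rule sum.cong)
    fix x assume x: "x \<in> R"
    then have "f x \<in> R'" using f(1) bij_betwE by blast
    then have "x \<in> X" "f x \<in> X" using transversal_subset assms(2,3) x by blast+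
    then show "g (f x) = g x" using f(2)[OF x] assms(4)[of x "f x"] by simp
  qed simp
  finally show ?thesis ..
qed

section \<open>Subgroups and orbits of sets under translation\<close>

definition add_subgroup :: "'a::ab_group_add set \<Rightarrow> bool" where
  "add_subgroup G \<longleftrightarrow> 0 \<in> G \<and> (\<forall>x\<in>G. \<forall>y\<in>G. x - y \<in> G)"

lemma add_subgroupD:
  assumes "add_subgroup G"
  shows "0 \<in> G" "x \<in> G \<Longrightarrow> y \<in> G \<Longrightarrow> x - y \<in> G" "x \<in> G \<Longrightarrow> - x \<in> G"
    "x \<in> G \<Longrightarrow> y \<in> G \<Longrightarrow> x + y \<in> G"
proof -
  show 0: "0 \<in> G" and d: "\<And>x y. x \<in> G \<Longrightarrow> y \<in> G \<Longrightarrow> x - y \<in> G"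
    using assms by (auto simp: add_subgroup_def)
  show m: "\<And>x. x \<in> G \<Longrightarrow> - x \<in> G" using d[OF 0] by simp
  show "x \<in> G \<Longrightarrow> y \<in> G \<Longrightarrow> x + y \<in> G" using d[OF _ m, of x y] by simp
qed

lemma add_subgroup_sum:
  assumes "add_subgroup G" "\<And>i. i \<in> I \<Longrightarrow> f i \<in> G"
  shows "sum f I \<in> G"
  using assms(2)
  by (induction I rule: infinite_finite_induct) (auto intro: add_subgroupD[OF assms(1)])

lemma add_subgroup_of_int_mult:
  fixes x :: "'a::ring_1"
  assumes "add_subgroup G" "x \<in> G"
  shows "of_int n * x \<in> G"
proof (induction n rule: int_induct[where k = 0])
  case base
  then show ?case using add_subgroupD[OF assms(1)] by simp
next
  case (step1 i)
  then show ?case using add_subgroupD(4)[OF assms(1) assms(2), of "of_int i * x"]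
    by (simp add: algebra_simps)
next
  case (step2 i)
  then show ?case using add_subgroupD(2)[OF assms(1) _ assms(2)] by (simp add: algebra_simps)
qed

lemma add_subgroup_times_zero: "add_subgroup G \<Longrightarrow> add_subgroup (G \<times> {0})"
  by (auto simp: add_subgroup_def zero_prod_def)

definition translates :: "'a::ab_group_add set \<Rightarrow> 'a set \<Rightarrow> 'a set \<Rightarrow> bool" where
  "translates G P Q \<longleftrightarrow> (\<exists>\<gamma>\<in>G. Q = (+) \<gamma> ` P)"

lemma translate_translate: "(+) a ` (+) b ` P = (+) (a + b) ` (P :: 'a::ab_group_add set)"
  by (auto simp: image_image add.assoc)

lemma translate_uminus: "(+) (- a) ` (+) a ` P = (P :: 'a::ab_group_add set)"
  unfolding translate_translate by simp

lemma equivp_translates: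
  assumes "add_subgroup G"
  shows "equivp (translates G)"
proof (rule equivpI)
  show "reflp (translates G)"
    using add_subgroupD(1)[OF assms] by (auto simp: reflp_def translates_def intro!: bexI[of _ 0])
  show "symp (translates G)"
  proof (rule sympI)
    fix P Q assume "translates G P Q"
    then obtain a where "a \<in> G" "Q = (+) a ` P" by (auto simp: translates_def)
    then have "P = (+) (- a) ` Q" "- a \<in> G"
      using add_subgroupD[OF assms] translate_uminus[of a P] by auto
    then show "translates G Q P" unfolding translates_def by blast
  qed
  show "transp (translates G)"
  proof (rule transpI)
    fix P Q R assume "translates G P Q" "translates G Q R"
    then obtain a b where "a \<in> G" "Q = (+) a ` P" "b \<in> G" "R = (+) b ` Q"
      by (auto simp: translates_def)
    then have "R = (+) (b + a) ` P" "b + a \<in> G"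
      using add_subgroupD[OF assms] by (simp_all add: translate_translate)
    then show "translates G P R" by (auto simp: translates_def)
  qed
qed

lemma exists_transversal:
  assumes E: "equivp E" and F: "finite F" "F \<subseteq> X" "\<And>P. P \<in> X \<Longrightarrow> \<exists>Q\<in>F. E P Q"
    and Y: "Y \<subseteq> X" "\<And>P Q. P \<in> Y \<Longrightarrow> Q \<in> X \<Longrightarrow> E P Q \<Longrightarrow> Q \<in> Y"
  obtains R where "finite R" "transversal E Y R"
proof -
  define rep where "rep P = (SOME Q. Q \<in> F \<and> E P Q)" for P
  have rep: "rep P \<in> F \<and> E P (rep P)" if "P \<in> X" for P
    unfolding rep_def by (rule someI_ex) (use F(3)[OF that] in \<open>simp only: bex_simps Bex_def\<close>)
  \<comment> \<open>\<open>E P\<close> and \<open>E Q\<close> are the same predicate, so the choice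
    made by SOME depends only on the class.\<close>
  have rep_eq: "rep P = rep Q" if "E P Q" for P Q
  proof -
    have "E P = E Q" using that E by (simp add: equivp_def)
    then show ?thesis by (simp add: rep_def)
  qed
  have Yrep: "rep P \<in> Y" "E P (rep P)" if "P \<in> Y" for P
  proof -
    have *: "rep P \<in> F" "E P (rep P)" using rep[OF subsetD[OF Y(1) that]] by simp_all
    show "rep P \<in> Y" by (rule Y(2)[OF that subsetD[OF F(2) *(1)] *(2)])
    show "E P (rep P)" by (rule *)
  qed
  have "finite (rep ` Y)"
    by (rule finite_subset[OF _ F(1)]) (use rep Y in blast)
  moreover have "transversal E Y (rep ` Y)"
    unfolding transversal_def
  proof (intro conjI ballI)
    show "rep ` Y \<subseteq> Y" using Yrep by blast
    fix P assume P: "P \<in> Y"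
    show "\<exists>!q. q \<in> rep ` Y \<and> E P q"
    proof (rule ex1I[of _ "rep P"])
      show "rep P \<in> rep ` Y \<and> E P (rep P)" using P Yrep by blast
      fix q assume q: "q \<in> rep ` Y \<and> E P q"
      then obtain Q where Q: "Q \<in> Y" "q = rep Q" by blast
      have "rep P = rep q" using rep_eq q by blast
      also have "\<dots> = rep Q" using rep_eq[OF Yrep(2)[OF Q(1)]] Q by simp
      finally show "q = rep P" using Q by simp
    qed
  qed
  ultimately show thesis by (rule that)
qed

lemma periodic_finite_transversal:
  assumes G: "add_subgroup G" and pf: "periodic_finite G X w"
    and Y: "Y \<subseteq> X" "\<And>P \<gamma>. P \<in> Y \<Longrightarrow> \<gamma> \<in> G \<Longrightarrow> (+) \<gamma> ` P \<in> Y"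
  obtains R where "finite R" "transversal (translates G) Y R"
proof -
  obtain F where F: "finite F" "F \<subseteq> X" "\<forall>P\<in>X. \<exists>Q\<in>F. \<exists>\<gamma>\<in>G. P = (+) \<gamma> ` Q"
    using pf by (auto simp: periodic_finite_def)
  note E = equivp_translates[OF G]
  have 1: "\<exists>Q\<in>F. translates G P Q" if "P \<in> X" for P
  proof -
    have "\<exists>Q\<in>F. translates G Q P" using bspec[OF F(3) that] by (simp only: translates_def)
    then obtain Q where Q: "Q \<in> F" "translates G Q P" by (elim bexE)
    show ?thesis using Q(1) equivp_symp[OF E Q(2)] by (rule rev_bexI)
  qed
  have 2: "Q \<in> Y" if PQ: "P \<in> Y" "translates G P Q" for P Q
  proof -
    obtain \<gamma> where "\<gamma> \<in> G" "Q = (+) \<gamma> ` P" using PQ(2) unfolding translates_def by (elim bexE)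
    then show ?thesis using Y(2)[OF PQ(1)] by simp
  qed
  obtain R where "finite R" "transversal (translates G) Y R"
    by (rule exists_transversal[OF E F(1,2) 1 Y(1) 2])
  then show thesis by (rule that)
qed

text \<open>A sum over all lifts with a property becomes a sum over representatives, weighted by the
  number of translates having it. Freeness of the action ensures that no lift is counted
  twice.\<close>

lemma sum_orbits:
  fixes g :: "'a::ab_group_add set \<Rightarrow> int"
  assumes G: "add_subgroup G" and R: "finite R" "transversal (translates G) X R"
    and X: "\<And>P \<gamma>. P \<in> X \<Longrightarrow> \<gamma> \<in> G \<Longrightarrow> (+) \<gamma> ` P \<in> X"
    and free: "\<And>P \<gamma>. P \<in> X \<Longrightarrow> \<gamma> \<in> G \<Longrightarrow> (+) \<gamma> ` P = P \<Longrightarrow> \<gamma> = 0"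
    and g: "\<And>P \<gamma>. P \<in> X \<Longrightarrow> \<gamma> \<in> G \<Longrightarrow> g ((+) \<gamma> ` P) = g P"
    and fin: "\<And>P. P \<in> R \<Longrightarrow> finite {\<gamma>\<in>G. Q ((+) \<gamma> ` P)}"
  shows "(\<Sum>P | P \<in> X \<and> Q P. g P) = (\<Sum>P\<in>R. g P * int (card {\<gamma>\<in>G. Q ((+) \<gamma> ` P)}))"
proof -
  define A where "A = (SIGMA P:R. {\<gamma>\<in>G. Q ((+) \<gamma> ` P)})"
  note RX = transversal_subset[OF R(2)]
  note E = equivp_translates[OF G]
  have un: "P = P'" if P: "P \<in> R" "P' \<in> R" "translates G P P'" for P P'
  proof -
    have "\<exists>!r. r \<in> R \<and> translates G P r"
      by (rule transversal_ex1[OF R(2) subsetD[OF RX P(1)]])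
    moreover have "P \<in> R \<and> translates G P P" "P' \<in> R \<and> translates G P P'"
      using P equivp_reflp[OF E, of P] by simp_all
    ultimately show ?thesis by (rule ex1_unique)
  qed
  have inj: "inj_on (\<lambda>(P, \<gamma>). (+) \<gamma> ` P) A"
  proof (rule inj_onI, clarsimp simp: A_def)
    fix P a P' b
    assume h: "P \<in> R" "a \<in> G" "P' \<in> R" "b \<in> G" "(+) a ` P = (+) b ` P'"
    have eq: "(+) (a - b) ` P = P'"
    proof -
      have "(+) (- b) ` (+) a ` P = (+) (- b) ` (+) b ` P'" using h by simp
      then show ?thesis unfolding translate_uminus translate_translate by simp
    qed
    have ab: "a - b \<in> G" using h add_subgroupD[OF G] by blast
    have "P = P'" using un[of P P'] h(1,3) eq ab by (auto simp: translates_def)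
    moreover from this have "a - b = 0" using free[of P "a - b"] ab eq h RX by auto
    ultimately show "P = P' \<and> a = b" by simp
  qed
  have img: "(\<lambda>(P, \<gamma>). (+) \<gamma> ` P) ` A = {P. P \<in> X \<and> Q P}"
  proof (intro equalityI subsetI)
    fix P assume "P \<in> (\<lambda>(P, \<gamma>). (+) \<gamma> ` P) ` A"
    then show "P \<in> {P. P \<in> X \<and> Q P}" using X RX by (auto simp: A_def)
  next
    fix P assume P: "P \<in> {P. P \<in> X \<and> Q P}"
    then have "P \<in> X" by simp
    then obtain r where r: "r \<in> R" "translates G P r" using transversal_ex1[OF R(2), of P] by metis
    obtain a where a: "a \<in> G" "P = (+) a ` r"
      using equivp_symp[OF E r(2)] unfolding translates_def by (elim bexE)
    show "P \<in> (\<lambda>(P, \<gamma>). (+) \<gamma> ` P) ` A"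
      by (rule image_eqI[of _ _ "(r, a)"]) (use a r P in \<open>auto simp: A_def\<close>)
  qed
  have "(\<Sum>P | P \<in> X \<and> Q P. g P) = (\<Sum>(P, \<gamma>)\<in>A. g ((+) \<gamma> ` P))"
    unfolding img[symmetric] by (subst sum.reindex[OF inj]) (simp add: case_prod_unfold o_def)
  also have "\<dots> = (\<Sum>(P, \<gamma>)\<in>A. g P)"
    by (rule sum.cong) (use g RX in \<open>auto simp: A_def\<close>)
  also have "\<dots> = (\<Sum>P\<in>R. \<Sum>\<gamma>\<in>{\<gamma>\<in>G. Q ((+) \<gamma> ` P)}. g P)"
    unfolding A_def by (rule sum.Sigma[symmetric]) (use R fin in auto)
  finally show ?thesis by (simp add: mult.commute)
qed

text \<open>Iterating a nonzero translation leaves every bounded set. Lattices therefore act freely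
  on cells.\<close>

lemma bounded_translate_fixed:
  fixes P :: "'a::real_normed_vector set"
  assumes "bounded P" "P \<noteq> {}" "(+) \<gamma> ` P = P"
  shows "\<gamma> = 0"
proof (rule ccontr)
  assume \<gamma>: "\<gamma> \<noteq> 0"
  obtain x where x: "x \<in> P" using assms by blast
  have mem: "x + real n *\<^sub>R \<gamma> \<in> P" for n
  proof (induction n)
    case (Suc n)
    then have "\<gamma> + (x + real n *\<^sub>R \<gamma>) \<in> (+) \<gamma> ` P" by blast
    then show ?case using assms(3) by (simp add: algebra_simps)
  qed (use x in simp)
  obtain B where B: "\<And>y. y \<in> P \<Longrightarrow> norm y \<le> B" using assms(1) bounded_iff by metis
  obtain n :: nat where n: "real n * norm \<gamma> > B + norm x"
    using reals_Archimedean3[of "norm \<gamma>"] \<gamma> by auto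
  have "real n * norm \<gamma> = norm ((x + real n *\<^sub>R \<gamma>) - x)" by simp
  also have "\<dots> \<le> norm (x + real n *\<^sub>R \<gamma>) + norm x" by (rule norm_triangle_ineq4)
  also have "\<dots> \<le> B + norm x" using B[OF mem] by simp
  finally show False using n by simp
qed

section \<open>Primitive integer vectors\<close>

lemma int_subgroup_cyclic:
  fixes S :: "int set"
  assumes S: "add_subgroup S"
  obtains d where "S = range ((*) d)" "0 \<le> d"
proof (cases "S = {0}")
  case True
  then show thesis by (intro that[of 0]) auto
next
  case False
  then obtain a where a: "a \<in> S" "a \<noteq> 0" using add_subgroupD(1)[OF S] by blast
  then have "\<bar>a\<bar> \<in> S" "\<bar>a\<bar> > 0" using add_subgroupD(3)[OF S] by (auto simp: abs_if)
  then have ex: "\<exists>n::nat. 0 < n \<and> int n \<in> S" by (intro exI[of _ "nat \<bar>a\<bar>"]) auto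
  define n where "n = (LEAST n::nat. 0 < n \<and> int n \<in> S)"
  have n: "0 < n" "int n \<in> S" using LeastI_ex[OF ex] by (auto simp: n_def)
  have mult: "int n * k \<in> S" for k
    using add_subgroup_of_int_mult[OF S n(2), of k] by (simp add: mult.commute)
  have "S = range ((*) (int n))"
  proof (intro equalityI subsetI)
    fix x assume x: "x \<in> S"
    have "x mod int n = x - int n * (x div int n)" by (simp add: minus_mult_div_eq_mod)
    then have "x mod int n \<in> S" using add_subgroupD(2)[OF S x mult] by simp
    moreover have "0 \<le> x mod int n" "x mod int n < int n" using n by simp_all
    ultimately have "x mod int n = 0"
      using not_less_Least[of "nat (x mod int n)" "\<lambda>n. 0 < n \<and> int n \<in> S"] n_def
      by (metis int_nat_eq linorder_not_less nat_0_iff nat_less_iff neq0_conv order_antisym)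
    then show "x \<in> range ((*) (int n))" by (metis mult_div_mod_eq add.right_neutral rangeI)
  qed (use mult in auto)
  then show thesis using that[of "int n"] by simp
qed

text \<open>Multiplication by \<open>a\<close> maps S into the integers, where subgroups are cyclic.
  A generator may be negated, so it can be taken nonnegative.\<close>

lemma real_subgroup_cyclic:
  fixes S :: "real set"
  assumes S: "add_subgroup S" and a: "a \<noteq> 0" "\<And>c. c \<in> S \<Longrightarrow> a * c \<in> \<int>"
  obtains g where "S = range (\<lambda>n::int. of_int n * g)" "0 \<le> g"
proof -
  define T where "T = {n::int. of_int n / a \<in> S}"
  have "add_subgroup T"
    using add_subgroupD[OF S] by (auto simp: T_def add_subgroup_def diff_divide_distrib)
  then obtain d where d: "T = range ((*) d)" using int_subgroup_cyclic by metis
  have "S = range (\<lambda>n::int. of_int n * (of_int d / a))"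
  proof (intro equalityI subsetI)
    fix c assume c: "c \<in> S"
    then obtain n where n: "a * c = of_int n" using a(2) Ints_cases by metis
    then have cn: "c = of_int n / a" using a(1) by (simp add: field_simps)
    then have "n \<in> T" using c by (simp add: T_def)
    then obtain k where "n = d * k" using d by auto
    then show "c \<in> range (\<lambda>n::int. of_int n * (of_int d / a))" using cn by (intro image_eqI[of _ _ k]) auto
  next
    fix c assume "c \<in> range (\<lambda>n::int. of_int n * (of_int d / a))"
    then obtain k where c: "c = of_int k * (of_int d / a)" by auto
    have "d * k \<in> T" using d by blast
    then show "c \<in> S" using c by (simp add: T_def mult.commute)
  qed
  also have "\<dots> = range (\<lambda>n::int. of_int n * \<bar>of_int d / a\<bar>)" (is "?A = ?B")
  proof (cases "0 \<le> of_int d / a")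
    case False
    have "range (uminus :: int \<Rightarrow> int) = UNIV" by (rule surjI[of _ uminus]) simp
    then have "?A = (\<lambda>n::int. of_int n * (of_int d / a)) ` range uminus" by simp
    also have "\<dots> = ?B" unfolding image_image using False by (simp add: abs_if)
    finally show ?thesis .
  qed (simp only: abs_of_nonneg)
  finally show thesis by (rule that) simp
qed

text \<open>\<open>c\<close> ranges over all reals: the integral points on the line of v are exactly
  the integer multiples of v.\<close>

definition primitive_vec :: "real ^ 'g \<Rightarrow> bool" where
  "primitive_vec v \<longleftrightarrow> v \<in> int_vectors \<and> v \<noteq> 0 \<and> (\<forall>c. c *\<^sub>R v \<in> int_vectors \<longrightarrow> c \<in> \<int>)"

lemma add_subgroup_int_vectors: "add_subgroup int_vectors"
  by (auto simp: add_subgroup_def int_vectors_def)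

lemma int_vectors_of_int_scale: "x \<in> int_vectors \<Longrightarrow> of_int n *\<^sub>R x \<in> int_vectors"
  by (auto simp: int_vectors_def)

text \<open>The reals c for which c x is integral form a group, cyclic because a nonzero coordinate
  of x maps it into the integers. Its positive generator scales x to a primitive vector.\<close>

lemma exists_primitive_vec:
  assumes x: "x \<in> int_vectors" "x \<noteq> 0"
  obtains v c where "primitive_vec v" "0 < c" "x = c *\<^sub>R v"
proof -
  obtain i where i: "x $ i \<noteq> 0" using x(2) by (auto simp: vec_eq_iff)
  define S where "S = {c. c *\<^sub>R x \<in> int_vectors}"
  have S: "add_subgroup S"
    using add_subgroupD[OF add_subgroup_int_vectors] by (auto simp: S_def add_subgroup_def scaleR_diff_left)
  have "x $ i * c \<in> \<int>" if "c \<in> S" for c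
    using that by (auto simp: S_def int_vectors_def mult.commute)
  then obtain g where g: "S = range (\<lambda>n::int. of_int n * g)" "0 \<le> g"
    using real_subgroup_cyclic[OF S i] by metis
  have "1 \<in> S" using x by (simp add: S_def)
  then obtain n :: int where n: "1 = of_int n * g" using g by auto
  then have g0: "0 < g" using g(2) by (metis mult_zero_right order_le_less zero_neq_one)
  have gS: "g \<in> S" unfolding g(1) by (rule range_eqI[of _ _ 1]) simp
  have "primitive_vec (g *\<^sub>R x)"
    unfolding primitive_vec_def
  proof (intro conjI allI impI)
    show "g *\<^sub>R x \<in> int_vectors" using gS by (simp add: S_def)
    show "g *\<^sub>R x \<noteq> 0" using g0 x by simp
    fix c assume "c *\<^sub>R g *\<^sub>R x \<in> int_vectors"
    then have "c * g \<in> S" by (simp add: S_def)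
    then obtain m :: int where "c * g = of_int m * g" using g(1) by auto
    then show "c \<in> \<int>" using g0 by simp
  qed
  moreover have "x = (1 / g) *\<^sub>R (g *\<^sub>R x)" using g0 by simp
  ultimately show thesis using that[of "g *\<^sub>R x" "1 / g"] g0 by simp
qed

lemma primitive_vec_minus [simp]: "primitive_vec (- v) \<longleftrightarrow> primitive_vec v"
proof -
  have "primitive_vec (- v)" if "primitive_vec v" for v :: "real ^ 'g"
    unfolding primitive_vec_def
  proof (intro conjI allI impI)
    show "- v \<in> int_vectors" "- v \<noteq> 0"
      using that add_subgroupD(3)[OF add_subgroup_int_vectors] by (auto simp: primitive_vec_def)
    fix c assume "c *\<^sub>R - v \<in> int_vectors"
    then have "(- c) *\<^sub>R v \<in> int_vectors" by simp
    then have "- c \<in> \<int>" using that unfolding primitive_vec_def by blast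
    then show "c \<in> \<int>" by simp
  qed
  from this[of v] this[of "- v"] show ?thesis by auto
qed

text \<open>The ratio of the two vectors and its inverse are both integers, so it is 1 or
  -1.\<close>

lemma primitive_vec_parallel:
  assumes "primitive_vec v" "primitive_vec w" "a *\<^sub>R v = b *\<^sub>R w" "a \<noteq> 0 \<or> b \<noteq> 0"
  shows "v = w \<or> v = - w"
proof -
  have ab: "a \<noteq> 0" "b \<noteq> 0" using assms by (auto simp: primitive_vec_def)
  define c where "c = b / a"
  have "v = (1 / a) *\<^sub>R (a *\<^sub>R v)" "w = (1 / b) *\<^sub>R (b *\<^sub>R w)" using ab by simp_all
  then have v: "v = c *\<^sub>R w" and w: "w = (1 / c) *\<^sub>R v"
    using ab assms(3) by (simp_all add: c_def)
  have "c \<noteq> 0" using ab by (simp add: c_def)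
  have "c \<in> \<int>" "1 / c \<in> \<int>"
    using assms(1,2) v w unfolding primitive_vec_def by metis+
  then obtain m n :: int where "c = of_int m" "1 / c = of_int n" by (metis Ints_cases)
  then have "of_int (m * n) = (1::real)" using \<open>c \<noteq> 0\<close> by (simp add: field_simps)
  then have "m * n = 1" by (metis of_int_eq_1_iff)
  then have "m = 1 \<or> m = -1" using zmult_eq_1_iff[of m n] by blast
  then show ?thesis using v \<open>c = of_int m\<close> by fastforce
qed

section \<open>The invariant of a rational segment\<close>

text \<open>The points of the segment from which one can still move in direction v inside it;
  therefore the far end is left out.\<close>

definition half_open_segment :: "'a::real_vector \<Rightarrow> 'a \<Rightarrow> real \<Rightarrow> 'a set" where
  "half_open_segment p v l = {p + s *\<^sub>R v |s. 0 \<le> s \<and> s < l}"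

lemma closed_segment_param:
  fixes p v :: "'a::real_vector"
  assumes "0 \<le> l"
  shows "closed_segment p (p + l *\<^sub>R v) = {p + s *\<^sub>R v |s. 0 \<le> s \<and> s \<le> l}"
proof (cases "l = 0")
  case True
  then have "{p + s *\<^sub>R v |s. 0 \<le> s \<and> s \<le> l} = {p}" by force
  then show ?thesis using True by simp
next
  case False
  then have l: "0 < l" using assms by simp
  show ?thesis
  proof (intro equalityI subsetI)
    fix x assume "x \<in> closed_segment p (p + l *\<^sub>R v)"
    then obtain u where "0 \<le> u" "u \<le> 1" "x = (1 - u) *\<^sub>R p + u *\<^sub>R (p + l *\<^sub>R v)"
      by (auto simp: closed_segment_def)
    then have "x = p + (u * l) *\<^sub>R v" "0 \<le> u * l" "u * l \<le> l"
      using l by (auto simp: algebra_simps mult_left_le)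
    then show "x \<in> {p + s *\<^sub>R v |s. 0 \<le> s \<and> s \<le> l}" by blast
  next
    fix x assume "x \<in> {p + s *\<^sub>R v |s. 0 \<le> s \<and> s \<le> l}"
    then obtain s where "0 \<le> s" "s \<le> l" "x = p + s *\<^sub>R v" by blast
    then have "x = (1 - s / l) *\<^sub>R p + (s / l) *\<^sub>R (p + l *\<^sub>R v)" "0 \<le> s / l" "s / l \<le> 1"
      using l by (auto simp: algebra_simps)
    then show "x \<in> closed_segment p (p + l *\<^sub>R v)" unfolding closed_segment_def by blast
  qed
qed

lemma eventually_notin_finite:
  fixes A :: "real set"
  assumes "finite A"
  shows "eventually (\<lambda>x. x \<notin> A) (at a within S)"
proof -
  have "open (- (A - {a}))" by (rule open_Compl[OF finite_imp_closed]) (use assms in simp)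
  then have "eventually (\<lambda>x. x \<in> - (A - {a})) (nhds a)"
    by (rule eventually_nhds_in_open) simp
  then show ?thesis
    by (auto simp: eventually_at_filter elim: eventually_mono)
qed

text \<open>If v is neither u nor -u, the line through y in direction u meets the segment at most
  once, which small \<epsilon> avoids. If v = u, it runs along the segment for a while exactly if it
  starts in the half-open segment. For v = -u the other end would have to be left out.\<close>

lemma eventually_mem_closed_segment:
  fixes p y :: "real ^ 'g"
  assumes u: "primitive_vec u" and v: "primitive_vec v" and uv: "v \<noteq> - u" and l: "0 \<le> l"
  shows "eventually (\<lambda>\<epsilon>. y + \<epsilon> *\<^sub>R u \<in> closed_segment p (p + l *\<^sub>R v) \<longleftrightarrow>
    v = u \<and> y \<in> half_open_segment p v l) (at_right 0)"
proof (cases "v = u")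
  case False
  let ?A = "{\<epsilon>. y + \<epsilon> *\<^sub>R u \<in> closed_segment p (p + l *\<^sub>R v)}"
  have "\<epsilon> = \<epsilon>'" if mem: "\<epsilon> \<in> ?A" "\<epsilon>' \<in> ?A" for \<epsilon> \<epsilon>'
  proof (rule ccontr)
    assume ne: "\<epsilon> \<noteq> \<epsilon>'"
    obtain s s' where ss: "y + \<epsilon> *\<^sub>R u = p + s *\<^sub>R v" "y + \<epsilon>' *\<^sub>R u = p + s' *\<^sub>R v"
      using mem unfolding closed_segment_param[OF l] by blast
    have "(\<epsilon> - \<epsilon>') *\<^sub>R u = (y + \<epsilon> *\<^sub>R u) - (y + \<epsilon>' *\<^sub>R u)" by (simp add: scaleR_diff_left)
    also have "\<dots> = (s - s') *\<^sub>R v" unfolding ss by (simp add: scaleR_diff_left)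
    finally have "(\<epsilon> - \<epsilon>') *\<^sub>R u = (s - s') *\<^sub>R v" .
    then have "u = v \<or> u = - v" using primitive_vec_parallel[OF u v] ne by simp
    then show False using False uv by auto
  qed
  then have "?A \<subseteq> {SOME \<epsilon>. \<epsilon> \<in> ?A}" by (auto intro: someI2)
  then have "finite ?A" by (rule finite_subset) simp
  from eventually_notin_finite[OF this, of 0 "{0<..}"] show ?thesis
    by (rule eventually_mono) (use False in auto)
next
  case True
  have u0: "u \<noteq> 0" using u by (simp add: primitive_vec_def)
  show ?thesis
  proof (cases "\<exists>s0. y = p + s0 *\<^sub>R u")
    case False
    have "y + \<epsilon> *\<^sub>R u \<notin> closed_segment p (p + l *\<^sub>R v)" for \<epsilon>
    proof
      assume "y + \<epsilon> *\<^sub>R u \<in> closed_segment p (p + l *\<^sub>R v)"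
      then obtain s where s: "y + \<epsilon> *\<^sub>R u = p + s *\<^sub>R u" using closed_segment_param[OF l, of p v] True by auto
      have "y = (y + \<epsilon> *\<^sub>R u) - \<epsilon> *\<^sub>R u" by simp
      then have "y = p + (s - \<epsilon>) *\<^sub>R u" unfolding s by (simp add: scaleR_diff_left)
      then show False using False by blast
    qed
    moreover have "y \<notin> half_open_segment p v l" using False True by (auto simp: half_open_segment_def)
    ultimately show ?thesis by simp
  next
    case yes: True
    then obtain s0 where y: "y = p + s0 *\<^sub>R u" by blast
    have mem: "y + \<epsilon> *\<^sub>R u \<in> closed_segment p (p + l *\<^sub>R v) \<longleftrightarrow> 0 \<le> s0 + \<epsilon> \<and> s0 + \<epsilon> \<le> l" for \<epsilon>
    proof -
      have "y + \<epsilon> *\<^sub>R u = p + (s0 + \<epsilon>) *\<^sub>R u" by (simp add: y algebra_simps)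
      then show ?thesis using closed_segment_param[OF l, of p v] True u0 by auto
    qed
    have ho: "y \<in> half_open_segment p v l \<longleftrightarrow> 0 \<le> s0 \<and> s0 < l"
      using True u0 by (auto simp: half_open_segment_def y)
    have ev: "eventually (\<lambda>\<epsilon>. 0 < \<epsilon> \<and> \<epsilon> < e) (at_right (0::real))" if "0 < e" for e
      using that by (auto simp: eventually_at_right_field)
    consider "s0 < 0" | "0 \<le> s0 \<and> s0 < l" | "l \<le> s0" by linarith
    then show ?thesis
    proof cases
      case 1
      then show ?thesis using ev[of "- s0"] unfolding mem ho by (auto elim!: eventually_mono)
    next
      case 2
      then show ?thesis using ev[of "l - s0"] True unfolding mem ho by (auto elim!: eventually_mono)
    next
      case 3
      then show ?thesis using ev[of 1] unfolding mem ho by (auto elim!: eventually_mono)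
    qed
  qed
qed

text \<open>\<open>r\<close> selects one point in each class modulo \<Gamma>, without any
  continuity. \<open>M\<close> collects the ambiguities that arise from changing lifts.\<close>

locale tropical_torus =
  fixes \<Gamma> :: "(real ^ 'g) set"
    and \<Omega> :: "real ^ 'g \<Rightarrow> real ^ 'g \<Rightarrow> real ^ 'g \<Rightarrow> real"
    and M :: "real set"
    and r :: "real ^ 'g \<Rightarrow> real ^ 'g"
  assumes \<Gamma>: "add_subgroup \<Gamma>"
    and discrete: "\<And>B. bounded B \<Longrightarrow> finite (\<Gamma> \<inter> B)"
    and \<Omega>_add: "\<And>x y u v. \<Omega> (x + y) u v = \<Omega> x u v + \<Omega> y u v"
    and \<Omega>_scale: "\<And>c x u v. \<Omega> (c *\<^sub>R x) u v = c * \<Omega> x u v"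
    and \<Omega>_swap: "\<And>x y z. \<Omega> x y z = - \<Omega> y x z" "\<And>x y z. \<Omega> x y z = - \<Omega> x z y"
    and M: "add_subgroup M"
    and period: "\<And>\<gamma> \<gamma>' v. \<gamma> \<in> \<Gamma> \<Longrightarrow> \<gamma>' \<in> \<Gamma> \<Longrightarrow> v \<in> int_vectors \<Longrightarrow> \<Omega> \<gamma> \<gamma>' v \<in> M"
    and r_inv: "\<And>x \<gamma>. \<gamma> \<in> \<Gamma> \<Longrightarrow> r (x + \<gamma>) = r x"
    and r_mem: "\<And>x. r x - x \<in> \<Gamma>"
begin

lemma \<Omega>_add2: "\<Omega> x (u + w) v = \<Omega> x u v + \<Omega> x w v"
  using \<Omega>_swap(1)[of x] \<Omega>_add by simp

lemma \<Omega>_add3: "\<Omega> x v (u + w) = \<Omega> x v u + \<Omega> x v w"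
  using \<Omega>_swap(2)[of x v] \<Omega>_add2 by simp

lemma \<Omega>_scale2: "\<Omega> x (c *\<^sub>R u) v = c * \<Omega> x u v"
  using \<Omega>_swap(1)[of x] \<Omega>_scale by simp

lemma \<Omega>_scale3: "\<Omega> x v (c *\<^sub>R u) = c * \<Omega> x v u"
  using \<Omega>_swap(2)[of x v] \<Omega>_scale2 by simp

lemma \<Omega>_minus: "\<Omega> (- x) u v = - \<Omega> x u v" "\<Omega> x (- u) v = - \<Omega> x u v" "\<Omega> x u (- v) = - \<Omega> x u v"
  using \<Omega>_scale[of "-1"] \<Omega>_scale2[of _ "-1"] \<Omega>_scale3[of _ _ "-1"] by simp_all

lemma \<Omega>_diff: "\<Omega> (x - y) u v = \<Omega> x u v - \<Omega> y u v" "\<Omega> u (x - y) v = \<Omega> u x v - \<Omega> u y v"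
    "\<Omega> u v (x - y) = \<Omega> u v x - \<Omega> u v y"
  using \<Omega>_add[of x "- y"] \<Omega>_add2[of _ x "- y"] \<Omega>_add3[of _ _ x "- y"] by (simp_all add: \<Omega>_minus)

lemma \<Omega>_same [simp]: "\<Omega> x x v = 0" "\<Omega> x v v = 0" "\<Omega> v x v = 0"
proof -
  show 1: "\<Omega> x x v = 0" "\<Omega> x v v = 0" for x v using \<Omega>_swap(1)[of x x v] \<Omega>_swap(2)[of x v v] by simp_all
  show "\<Omega> v x v = 0" using \<Omega>_swap(2)[of v x v] 1 by simp
qed

lemma \<Omega>_zero [simp]: "\<Omega> 0 u v = 0" "\<Omega> u 0 v = 0" "\<Omega> u v 0 = 0"
  using \<Omega>_scale[of 0 0 u v] \<Omega>_scale2[of u 0 0 v] \<Omega>_scale3[of u v 0 0] by simp_all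

lemmas \<Omega>_linear = \<Omega>_add \<Omega>_add2 \<Omega>_add3 \<Omega>_scale \<Omega>_scale2 \<Omega>_scale3 \<Omega>_minus \<Omega>_diff

lemma r_r [simp]: "r (r x) = r x"
  using r_inv[OF r_mem, of x x] by simp

lemma r_eq_iff: "r x = r y \<longleftrightarrow> x - y \<in> \<Gamma>"
proof
  assume "r x = r y"
  then have "x - y = (r y - y) - (r x - x)" by simp
  then show "x - y \<in> \<Gamma>" using add_subgroupD(2)[OF \<Gamma>] r_mem by metis
next
  assume "x - y \<in> \<Gamma>"
  then show "r x = r y" using r_inv[of "x - y" y] by simp
qed

definition line_class :: "real ^ 'g \<Rightarrow> real ^ 'g \<Rightarrow> (real ^ 'g) set" where
  "line_class v x = {y. \<exists>\<gamma>\<in>\<Gamma>. \<exists>s. y = x + \<gamma> + s *\<^sub>R v}"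

definition line_base :: "real ^ 'g \<Rightarrow> real ^ 'g \<Rightarrow> real ^ 'g" where
  "line_base v x = (SOME y. y \<in> line_class v x)"

text \<open>
  Replacing \<open>x\<close> by a point of \<open>x + \<Gamma> + \<real> v\<close> depending only on this set makes \<open>K v\<close> exactly
  \<open>\<Gamma>\<close>-invariant. Therefore the value of a family of segments is determined by its weight function.
\<close>

definition K :: "real ^ 'g \<Rightarrow> real ^ 'g \<Rightarrow> real" where
  "K v x = \<Omega> (r x) (line_base v x) v"

lemma line_class_eq: "line_class v (x + \<gamma> + s *\<^sub>R v) = line_class v x" if "\<gamma> \<in> \<Gamma>"
proof (intro equalityI subsetI)
  fix y assume "y \<in> line_class v (x + \<gamma> + s *\<^sub>R v)"
  then obtain \<gamma>' s' where "\<gamma>' \<in> \<Gamma>" "y = x + \<gamma> + s *\<^sub>R v + \<gamma>' + s' *\<^sub>R v"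
    by (auto simp: line_class_def)
  then have "y = x + (\<gamma> + \<gamma>') + (s + s') *\<^sub>R v" "\<gamma> + \<gamma>' \<in> \<Gamma>"
    using add_subgroupD(4)[OF \<Gamma>] that by (auto simp: algebra_simps)
  then show "y \<in> line_class v x" unfolding line_class_def by blast
next
  fix y assume "y \<in> line_class v x"
  then obtain \<gamma>' s' where "\<gamma>' \<in> \<Gamma>" "y = x + \<gamma>' + s' *\<^sub>R v" by (auto simp: line_class_def)
  then have "y = x + \<gamma> + s *\<^sub>R v + (\<gamma>' - \<gamma>) + (s' - s) *\<^sub>R v" "\<gamma>' - \<gamma> \<in> \<Gamma>"
    using add_subgroupD(2)[OF \<Gamma>] that by (auto simp: algebra_simps)
  then show "y \<in> line_class v (x + \<gamma> + s *\<^sub>R v)" unfolding line_class_def by blast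
qed

lemma line_class_minus: "line_class (- v) x = line_class v x"
proof -
  have "line_class (- v) x \<subseteq> line_class v x" for v
  proof
    fix y assume "y \<in> line_class (- v) x"
    then obtain \<gamma> s where "\<gamma> \<in> \<Gamma>" "y = x + \<gamma> + (- s) *\<^sub>R v" by (auto simp: line_class_def)
    then show "y \<in> line_class v x" unfolding line_class_def by blast
  qed
  from this[of v] this[of "- v"] show ?thesis by auto
qed

lemma line_base_mem: "line_base v x \<in> line_class v x"
proof -
  have "x + 0 + 0 *\<^sub>R v \<in> line_class v x"
    unfolding line_class_def using add_subgroupD(1)[OF \<Gamma>] by blast
  then show ?thesis unfolding line_base_def by (rule someI)
qed

lemma K_translate: "\<gamma> \<in> \<Gamma> \<Longrightarrow> K v (x + \<gamma>) = K v x"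
  using line_class_eq[of \<gamma> v x 0] by (simp add: K_def line_base_def r_inv)

lemma K_minus: "K (- v) x = - K v x"
  by (simp add: K_def line_base_def line_class_minus \<Omega>_minus)

lemma K_r: "K v (r x) = K v x"
  using K_translate[OF r_mem, of v x x] by simp

text \<open>Both ends lie on one line in direction v and share \<open>line_base\<close>. Replacing
  the base by p alters the second argument by a period and a multiple of v, while r p - r q is
  itself a period up to a multiple of v. Multiples of v die in \<Omega>, and a value on two periods
  remains.\<close>

lemma K_diff:
  assumes v: "v \<in> int_vectors"
  shows "K v p - K v (p + l *\<^sub>R v) - \<Omega> (r p - r (p + l *\<^sub>R v)) p v \<in> M"
proof -
  define q where "q = p + l *\<^sub>R v"
  have "line_base v q = line_base v p"
    using line_class_eq[OF add_subgroupD(1)[OF \<Gamma>], of v p l] by (simp add: line_base_def q_def)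
  then have *: "K v p - K v q = \<Omega> (r p - r q) (line_base v p) v" by (simp add: K_def \<Omega>_linear)
  obtain \<gamma> s where g: "\<gamma> \<in> \<Gamma>" "line_base v p = p + \<gamma> + s *\<^sub>R v"
    using line_base_mem[of v p] by (auto simp: line_class_def)
  define \<gamma>' where "\<gamma>' = (r p - p) - (r q - q)"
  have g': "\<gamma>' \<in> \<Gamma>" unfolding \<gamma>'_def by (intro add_subgroupD(2)[OF \<Gamma>] r_mem)
  have "r p - r q = \<gamma>' + (- l) *\<^sub>R v" by (simp add: \<gamma>'_def q_def)
  then have "K v p - K v q - \<Omega> (r p - r q) p v = \<Omega> \<gamma>' \<gamma> v"
    unfolding * g(2) by (simp add: \<Omega>_linear)
  then show ?thesis using period[OF g' g(1) v] by (simp add: q_def)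
qed

section \<open>Families of segments whose weight function vanishes\<close>

lemma finite_translates:
  assumes "bounded P"
  shows "finite {\<gamma>\<in>\<Gamma>. x - \<gamma> \<in> P}"
proof -
  have "{\<gamma>\<in>\<Gamma>. x - \<gamma> \<in> P} \<subseteq> \<Gamma> \<inter> (\<lambda>y. x - y) ` P"
    by (auto intro!: image_eqI[of _ _ "x - _"])
  moreover have "bounded ((\<lambda>y. x - y) ` P)"
    using bounded_translation[OF bounded_uminus[THEN iffD2, OF assms], of x] by (simp add: image_image)
  ultimately show ?thesis using discrete finite_subset by blast
qed

lemma bounded_half_open_segment: "0 \<le> l \<Longrightarrow> bounded (half_open_segment p v l)"
  for p v :: "real ^ 'g"
  by (rule bounded_subset[OF bounded_closed_segment[of p "p + l *\<^sub>R v"]])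
    (auto simp: closed_segment_param half_open_segment_def)

text \<open>Evaluating the weight function at x + \<epsilon> u for small \<epsilon> > 0 isolates the
  segments that leave x in direction u, since all others are missed. The exceptional points are
  missed as well, because their translates form a discrete set.\<close>

lemma germ_weights_vanish:
  fixes p v :: "'i \<Rightarrow> real ^ 'g"
  assumes I: "finite I" "\<And>i. i \<in> I \<Longrightarrow> primitive_vec (v i)" "\<And>i. i \<in> I \<Longrightarrow> 0 \<le> l i"
    and E: "finite E"
    and w: "\<And>x. (\<And>e. e \<in> E \<Longrightarrow> x - e \<notin> \<Gamma>) \<Longrightarrow>
      (\<Sum>i\<in>I. w i * int (card {\<gamma>\<in>\<Gamma>. x - \<gamma> \<in> closed_segment (p i) (p i + l i *\<^sub>R v i)})) = 0"
    and u: "primitive_vec u" "\<And>i. i \<in> I \<Longrightarrow> v i \<noteq> - u"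
  shows "(\<Sum>i | i \<in> I \<and> v i = u. w i * int (card {\<gamma>\<in>\<Gamma>. x - \<gamma> \<in> half_open_segment (p i) (v i) (l i)})) = 0"
proof -
  let ?P = "\<lambda>i. closed_segment (p i) (p i + l i *\<^sub>R v i)"
  let ?H = "\<lambda>i. half_open_segment (p i) (v i) (l i)"
  have u0: "u \<noteq> 0" using u by (simp add: primitive_vec_def)
  have "eventually (\<lambda>\<epsilon>::real. \<epsilon> < 1) (at_right 0)"
    by (auto simp: eventually_at_right_field intro: exI[of _ 1])
  moreover have "eventually (\<lambda>\<epsilon>::real. 0 < \<epsilon>) (at_right 0)"
    by (auto simp: eventually_at_right_field intro: exI[of _ 1])
  moreover have "eventually (\<lambda>\<epsilon>. \<forall>e\<in>E. \<epsilon> < 1 \<longrightarrow> 0 < \<epsilon> \<longrightarrow> x + \<epsilon> *\<^sub>R u - e \<notin> \<Gamma>) (at_right 0)"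
  proof (rule eventually_ball_finite[OF E], rule ballI)
    fix e assume "e \<in> E"
    define A where "A = {\<epsilon>. 0 < \<epsilon> \<and> \<epsilon> < 1 \<and> x + \<epsilon> *\<^sub>R u - e \<in> \<Gamma>}"
    have "(\<lambda>\<epsilon>. x + \<epsilon> *\<^sub>R u - e) ` A \<subseteq> \<Gamma> \<inter> closed_segment (x - e) (x - e + 1 *\<^sub>R u)"
      unfolding closed_segment_param[OF zero_le_one] A_def
      by (auto simp: algebra_simps intro!: exI)
    then have "finite ((\<lambda>\<epsilon>. x + \<epsilon> *\<^sub>R u - e) ` A)"
      using discrete[OF bounded_closed_segment] finite_subset by blast
    moreover have "inj_on (\<lambda>\<epsilon>. x + \<epsilon> *\<^sub>R u - e) A"
      using u0 by (auto simp: inj_on_def)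
    ultimately have "finite A" using finite_imageD by blast
    from eventually_notin_finite[OF this, of 0 "{0<..}"]
    show "eventually (\<lambda>\<epsilon>. \<epsilon> < 1 \<longrightarrow> 0 < \<epsilon> \<longrightarrow> x + \<epsilon> *\<^sub>R u - e \<notin> \<Gamma>) (at_right 0)"
      by (rule eventually_mono) (auto simp: A_def)
  qed
  moreover have "eventually (\<lambda>\<epsilon>. \<forall>i\<in>I. \<epsilon> < 1 \<longrightarrow> 0 < \<epsilon> \<longrightarrow>
      {\<gamma>\<in>\<Gamma>. x + \<epsilon> *\<^sub>R u - \<gamma> \<in> ?P i} = (if v i = u then {\<gamma>\<in>\<Gamma>. x - \<gamma> \<in> ?H i} else {})) (at_right 0)"
  proof (rule eventually_ball_finite[OF I(1)], rule ballI)
    fix i assume i: "i \<in> I"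
    \<comment> \<open>Only finitely many translates matter for any \<epsilon> between 0 and 1, so
      their individual thresholds have a common one.\<close>
    define G where "G = {\<gamma>\<in>\<Gamma>. \<exists>\<epsilon>. 0 \<le> \<epsilon> \<and> \<epsilon> \<le> 1 \<and> x + \<epsilon> *\<^sub>R u - \<gamma> \<in> ?P i}"
    have "G \<subseteq> \<Gamma> \<inter> {a - b |a b. a \<in> closed_segment x (x + 1 *\<^sub>R u) \<and> b \<in> ?P i}"
    proof
      fix \<gamma> assume "\<gamma> \<in> G"
      then obtain \<epsilon> where e: "\<gamma> \<in> \<Gamma>" "0 \<le> \<epsilon>" "\<epsilon> \<le> 1" "x + \<epsilon> *\<^sub>R u - \<gamma> \<in> ?P i" by (auto simp: G_def)
      have "x + \<epsilon> *\<^sub>R u \<in> closed_segment x (x + 1 *\<^sub>R u)"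
        unfolding closed_segment_param[OF zero_le_one] using e by blast
      moreover have "\<gamma> = (x + \<epsilon> *\<^sub>R u) - (x + \<epsilon> *\<^sub>R u - \<gamma>)" by simp
      ultimately show "\<gamma> \<in> \<Gamma> \<inter> {a - b |a b. a \<in> closed_segment x (x + 1 *\<^sub>R u) \<and> b \<in> ?P i}"
        using e by blast
    qed
    moreover have "bounded {a - b |a b. a \<in> closed_segment x (x + 1 *\<^sub>R u) \<and> b \<in> ?P i}"
      by (intro compact_imp_bounded compact_differences compact_segment)
    ultimately have finG: "finite G" using discrete finite_subset by blast
    have "eventually (\<lambda>\<epsilon>. \<forall>\<gamma>\<in>G. x - \<gamma> + \<epsilon> *\<^sub>R u \<in> ?P i \<longleftrightarrow> v i = u \<and> x - \<gamma> \<in> ?H i) (at_right 0)"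
      using eventually_mem_closed_segment[OF u(1) I(2)[OF i] u(2)[OF i] I(3)[OF i]]
      by (intro eventually_ball_finite[OF finG]) auto
    then show "eventually (\<lambda>\<epsilon>. \<epsilon> < 1 \<longrightarrow> 0 < \<epsilon> \<longrightarrow>
      {\<gamma>\<in>\<Gamma>. x + \<epsilon> *\<^sub>R u - \<gamma> \<in> ?P i} = (if v i = u then {\<gamma>\<in>\<Gamma>. x - \<gamma> \<in> ?H i} else {})) (at_right 0)"
    proof (rule eventually_mono, intro impI)
      fix \<epsilon> :: real
      assume *: "\<forall>\<gamma>\<in>G. x - \<gamma> + \<epsilon> *\<^sub>R u \<in> ?P i \<longleftrightarrow> v i = u \<and> x - \<gamma> \<in> ?H i" and e: "\<epsilon> < 1" "0 < \<epsilon>"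
      have H: "\<gamma> \<in> G" if "\<gamma> \<in> \<Gamma>" "x - \<gamma> \<in> ?H i" for \<gamma>
      proof -
        have "x + 0 *\<^sub>R u - \<gamma> \<in> ?P i"
          using that(2) unfolding closed_segment_param[OF I(3)[OF i]] half_open_segment_def by auto
        then show ?thesis using that(1) unfolding G_def by (auto intro: exI[of _ 0])
      qed
      have P: "\<gamma> \<in> G" if "\<gamma> \<in> \<Gamma>" "x + \<epsilon> *\<^sub>R u - \<gamma> \<in> ?P i" for \<gamma>
        using that e unfolding G_def by (auto intro: exI[of _ \<epsilon>])
      have eq: "x - \<gamma> + \<epsilon> *\<^sub>R u = x + \<epsilon> *\<^sub>R u - \<gamma>" for \<gamma> by simp
      show "{\<gamma>\<in>\<Gamma>. x + \<epsilon> *\<^sub>R u - \<gamma> \<in> ?P i} = (if v i = u then {\<gamma>\<in>\<Gamma>. x - \<gamma> \<in> ?H i} else {})"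
        using * H P unfolding eq by auto
    qed
  qed
  ultimately have "eventually (\<lambda>\<epsilon>. (\<forall>e\<in>E. x + \<epsilon> *\<^sub>R u - e \<notin> \<Gamma>) \<and> (\<forall>i\<in>I.
      {\<gamma>\<in>\<Gamma>. x + \<epsilon> *\<^sub>R u - \<gamma> \<in> ?P i} = (if v i = u then {\<gamma>\<in>\<Gamma>. x - \<gamma> \<in> ?H i} else {}))) (at_right 0)"
    by eventually_elim blast
  then obtain \<epsilon> where e: "\<forall>e\<in>E. x + \<epsilon> *\<^sub>R u - e \<notin> \<Gamma>" and
    eq: "\<And>i. i \<in> I \<Longrightarrow> {\<gamma>\<in>\<Gamma>. x + \<epsilon> *\<^sub>R u - \<gamma> \<in> ?P i} = (if v i = u then {\<gamma>\<in>\<Gamma>. x - \<gamma> \<in> ?H i} else {})"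
    using eventually_happens'[OF trivial_limit_at_right_real] by fast
  have "0 = (\<Sum>i\<in>I. w i * int (card {\<gamma>\<in>\<Gamma>. x + \<epsilon> *\<^sub>R u - \<gamma> \<in> ?P i}))"
    using w[of "x + \<epsilon> *\<^sub>R u"] e by simp
  also have "\<dots> = (\<Sum>i\<in>I. if v i = u then w i * int (card {\<gamma>\<in>\<Gamma>. x - \<gamma> \<in> ?H i}) else 0)"
    by (rule sum.cong) (auto simp: eq)
  also have "\<dots> = (\<Sum>i | i \<in> I \<and> v i = u. w i * int (card {\<gamma>\<in>\<Gamma>. x - \<gamma> \<in> ?H i}))"
    by (rule sum.inter_filter[OF I(1), symmetric])
  finally show ?thesis ..
qed

text \<open>The closed segment is a half-open one plus its missing end, in either orientation.
  Comparing the two counts of lifts of x leaves the two ends; x is the chosen point of its class, so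
  it belongs to the class of an end iff it is the \<open>r\<close>-image of that end.\<close>

lemma half_open_segment_count:
  assumes l: "0 \<le> l" and v: "v \<noteq> 0" and x: "r x = x"
  shows "int (card {\<gamma>\<in>\<Gamma>. x - \<gamma> \<in> half_open_segment p v l})
      - int (card {\<gamma>\<in>\<Gamma>. x - \<gamma> \<in> half_open_segment (p + l *\<^sub>R v) (- v) l})
    = of_bool (x = r p) - of_bool (x = r (p + l *\<^sub>R v))"
proof -
  define q where "q = p + l *\<^sub>R v"
  let ?C = "\<lambda>S. {\<gamma>\<in>\<Gamma>. x - \<gamma> \<in> S}"
  have one: "int (card (?C {a})) = of_bool (x = r a)" for a
  proof -
    have "?C {a} = (if x = r a then {x - a} else {})"
      using x r_eq_iff[of x a] by (auto simp: algebra_simps)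
    then show ?thesis by simp
  qed
  have H1: "half_open_segment p v l \<union> {q} = closed_segment p q" and d1: "q \<notin> half_open_segment p v l"
    unfolding q_def closed_segment_param[OF l] half_open_segment_def using v l by (force, auto)
  have H2: "half_open_segment q (- v) l \<union> {p} = closed_segment p q"
    and d2: "p \<notin> half_open_segment q (- v) l"
  proof -
    have "p = q + l *\<^sub>R (- v)" by (simp add: q_def)
    then have "closed_segment p q = closed_segment q (q + l *\<^sub>R (- v))" by (metis closed_segment_commute)
    then show "half_open_segment q (- v) l \<union> {p} = closed_segment p q"
      unfolding closed_segment_param[OF l] half_open_segment_def using l \<open>p = q + l *\<^sub>R (- v)\<close> by force
    show "p \<notin> half_open_segment q (- v) l"
      unfolding half_open_segment_def using v by (auto simp: q_def algebra_simps)
  qed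
  have split: "int (card (?C (A \<union> {a}))) = int (card (?C A)) + of_bool (x = r a)"
    if "a \<notin> A" "bounded A" for a A
  proof -
    have "?C (A \<union> {a}) = ?C A \<union> ?C {a}" by auto
    moreover have "card (?C A \<union> ?C {a}) = card (?C A) + card (?C {a})"
      using that finite_translates[of A x] finite_translates[of "{a}" x] by (intro card_Un_disjoint) auto
    ultimately show ?thesis using one by simp
  qed
  show ?thesis
    using split[OF d1 bounded_half_open_segment[OF l]] split[OF d2 bounded_half_open_segment[OF l]]
    unfolding H1 H2 unfolding q_def by linarith
qed

text \<open>Collect the sum by points x and directions u. The coefficient of K u x is the weight of
  the germs leaving x in direction u minus that of the germs in direction -u, and each of the two
  vanishes separately. Parallel segments must be oriented alike for this, which \<open>o\<close>
  ensures.\<close>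

lemma segment_weights_vanish_oriented:
  fixes p v :: "'i \<Rightarrow> real ^ 'g"
  assumes I: "finite I" "\<And>i. i \<in> I \<Longrightarrow> primitive_vec (v i)" "\<And>i. i \<in> I \<Longrightarrow> 0 \<le> l i"
    and E: "finite E"
    and w: "\<And>x. (\<And>e. e \<in> E \<Longrightarrow> x - e \<notin> \<Gamma>) \<Longrightarrow>
      (\<Sum>i\<in>I. w i * int (card {\<gamma>\<in>\<Gamma>. x - \<gamma> \<in> closed_segment (p i) (p i + l i *\<^sub>R v i)})) = 0"
    and o: "\<And>i j. i \<in> I \<Longrightarrow> j \<in> I \<Longrightarrow> v i \<noteq> - v j"
  shows "(\<Sum>i\<in>I. of_int (w i) * (K (v i) (p i) - K (v i) (p i + l i *\<^sub>R v i))) = 0"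
proof -
  define q where "q i = p i + l i *\<^sub>R v i" for i
  define X where "X = r ` (p ` I \<union> q ` I)"
  define N where "N i x = int (card {\<gamma>\<in>\<Gamma>. x - \<gamma> \<in> half_open_segment (p i) (v i) (l i)})
      - int (card {\<gamma>\<in>\<Gamma>. x - \<gamma> \<in> half_open_segment (q i) (- v i) (l i)})" for i x
  have finX: "finite X" using I by (simp add: X_def)
  have N: "N i x = of_bool (x = r (p i)) - of_bool (x = r (q i))" if "i \<in> I" "x \<in> X" for i x
    unfolding N_def q_def
    by (rule half_open_segment_count) (use that I in \<open>auto simp: X_def primitive_vec_def\<close>)
  have KN: "K (v i) (p i) - K (v i) (q i) = (\<Sum>x\<in>X. K (v i) x * of_int (N i x))" if i: "i \<in> I" for i
  proof -
    have "(\<Sum>x\<in>X. K (v i) x * of_int (N i x)) =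
      (\<Sum>x\<in>X. (if x = r (p i) then K (v i) x else 0) - (if x = r (q i) then K (v i) x else 0))"
      by (rule sum.cong) (use N i in auto)
    also have "\<dots> = K (v i) (r (p i)) - K (v i) (r (q i))"
      unfolding sum_subtractf using finX i by (simp add: X_def)
    finally show ?thesis by (simp add: K_r)
  qed
  have van: "(\<Sum>i | i \<in> I \<and> v i = u. of_int (w i) * real_of_int (N i x)) = 0" if "u \<in> v ` I" for u x
  proof -
    obtain j where j: "j \<in> I" "u = v j" using \<open>u \<in> v ` I\<close> by blast
    have 1: "(\<Sum>i | i \<in> I \<and> v i = u. w i * int (card {\<gamma>\<in>\<Gamma>. x - \<gamma> \<in> half_open_segment (p i) (v i) (l i)})) = 0"
      by (rule germ_weights_vanish[OF I E w]) (use o j I(2) in auto)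
    \<comment> \<open>Reversing every segment changes no closed segment, so the same lemma applies
      to the germs in direction -u.\<close>
    have seg: "closed_segment (q i) (q i + l i *\<^sub>R - v i) = closed_segment (p i) (p i + l i *\<^sub>R v i)" for i
      by (simp add: q_def closed_segment_commute)
    have 2: "(\<Sum>i | i \<in> I \<and> - v i = - u. w i * int (card {\<gamma>\<in>\<Gamma>. x - \<gamma> \<in> half_open_segment (q i) (- v i) (l i)})) = 0"
      by (rule germ_weights_vanish[OF I(1) _ I(3) E, where p = q and v = "\<lambda>i. - v i"], unfold seg)
        (use w o[OF j(1)] j(2) I(2)[OF j(1)] I(2) in \<open>simp_all, metis\<close>)
    have "(\<Sum>i | i \<in> I \<and> v i = u. w i * N i x) = 0"
      using 1 2 by (simp add: N_def right_diff_distrib sum_subtractf)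
    then have "real_of_int (\<Sum>i | i \<in> I \<and> v i = u. w i * N i x) = 0" by simp
    then show ?thesis by simp
  qed
  have "(\<Sum>i\<in>I. of_int (w i) * (K (v i) (p i) - K (v i) (q i)))
      = (\<Sum>i\<in>I. \<Sum>x\<in>X. of_int (w i) * (K (v i) x * of_int (N i x)))"
    by (simp add: KN sum_distrib_left)
  also have "\<dots> = (\<Sum>x\<in>X. \<Sum>i\<in>I. of_int (w i) * (K (v i) x * of_int (N i x)))"
    by (rule sum.swap)
  also have "\<dots> = (\<Sum>x\<in>X. \<Sum>u\<in>v ` I. \<Sum>i | i \<in> I \<and> v i = u. of_int (w i) * (K (v i) x * of_int (N i x)))"
    by (subst sum.group[OF I(1), of "v ` I" v, symmetric]) (use I in auto)
  also have "\<dots> = (\<Sum>x\<in>X. \<Sum>u\<in>v ` I. K u x * (\<Sum>i | i \<in> I \<and> v i = u. of_int (w i) * of_int (N i x)))"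
    by (intro sum.cong refl) (auto simp: sum_distrib_left mult_ac intro!: sum.cong)
  also have "\<dots> = 0" by (simp add: van)
  finally show ?thesis by (simp add: q_def)
qed

lemma segment_weights_vanish:
  fixes p v :: "'i \<Rightarrow> real ^ 'g"
  assumes I: "finite I" "\<And>i. i \<in> I \<Longrightarrow> primitive_vec (v i)" "\<And>i. i \<in> I \<Longrightarrow> 0 \<le> l i"
    and E: "finite E"
    and w: "\<And>x. (\<And>e. e \<in> E \<Longrightarrow> x - e \<notin> \<Gamma>) \<Longrightarrow>
      (\<Sum>i\<in>I. w i * int (card {\<gamma>\<in>\<Gamma>. x - \<gamma> \<in> closed_segment (p i) (p i + l i *\<^sub>R v i)})) = 0"
  shows "(\<Sum>i\<in>I. of_int (w i) * (K (v i) (p i) - K (v i) (p i + l i *\<^sub>R v i))) = 0"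
proof -
  \<comment> \<open>The choice is made from the unordered pair, so u and -u get the same
    orientation. K is odd in v, hence reversing a segment keeps its term.\<close>
  define c where "c u = (SOME u'. u' \<in> {u, - u})" for u :: "real ^ 'g"
  have c: "c u = u \<or> c u = - u" for u
    using someI[of "\<lambda>u'. u' \<in> {u, - u}" u] by (simp add: c_def)
  have c_minus: "c (- u) = c u" for u by (simp add: c_def insert_commute)
  define p' where "p' i = (if c (v i) = v i then p i else p i + l i *\<^sub>R v i)" for i
  define v' where "v' i = c (v i)" for i
  have seg: "closed_segment (p' i) (p' i + l i *\<^sub>R v' i) = closed_segment (p i) (p i + l i *\<^sub>R v i)" for i
    using c[of "v i"] by (auto simp: p'_def v'_def closed_segment_commute)
  have K: "K (v' i) (p' i) - K (v' i) (p' i + l i *\<^sub>R v' i) = K (v i) (p i) - K (v i) (p i + l i *\<^sub>R v i)" for i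
    using c[of "v i"] by (auto simp: p'_def v'_def K_minus)
  have o: "v' i \<noteq> - v' j" if "i \<in> I" "j \<in> I" for i j
  proof
    assume *: "v' i = - v' j"
    have "v i = v j \<or> v i = - v j" using c[of "v i"] c[of "v j"] * by (auto simp: v'_def)
    then have "v' i = v' j" using c_minus by (auto simp: v'_def)
    then have "2 *\<^sub>R v' i = 0" using * by (simp add: scaleR_2)
    then have "v' i = 0" by simp
    then show False using c[of "v i"] I(2)[OF that(1)] by (auto simp: v'_def primitive_vec_def)
  qed
  have "(\<Sum>i\<in>I. of_int (w i) * (K (v' i) (p' i) - K (v' i) (p' i + l i *\<^sub>R v' i))) = 0"
  proof (rule segment_weights_vanish_oriented[OF I(1) _ I(3) E])
    show "primitive_vec (v' i)" if "i \<in> I" for i using c[of "v i"] I(2)[OF that] by (auto simp: v'_def)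
  qed (use w o in \<open>auto simp: seg\<close>)
  then show ?thesis unfolding K .
qed

text \<open>Chosen by SOME because a segment as a set remembers neither an orientation nor, if it is
  a point, a direction.\<close>

definition segment_value :: "(real ^ 'g) set \<Rightarrow> real" where
  "segment_value P = (SOME c. \<exists>p v l. primitive_vec v \<and> 0 \<le> l \<and> P = closed_segment p (p + l *\<^sub>R v) \<and>
     c = K v p - K v (p + l *\<^sub>R v))"

text \<open>The ends are determined up to order and the primitive direction up to sign, and K is odd
  in v. For a point every direction gives 0.\<close>

lemma segment_value_eq:
  assumes v: "primitive_vec v" and l: "0 \<le> l"
  shows "segment_value (closed_segment p (p + l *\<^sub>R v)) = K v p - K v (p + l *\<^sub>R v)"
proof -
  have "c = K v p - K v (p + l *\<^sub>R v)"
    if h: "primitive_vec v'" "0 \<le> l'" "closed_segment p (p + l *\<^sub>R v) = closed_segment p' (p' + l' *\<^sub>R v')"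
      "c = K v' p' - K v' (p' + l' *\<^sub>R v')" for c p' v' l'
  proof -
    have "{p, p + l *\<^sub>R v} = {p', p' + l' *\<^sub>R v'}" using h(3) by (simp add: closed_segment_eq)
    then consider "p = p'" "p + l *\<^sub>R v = p' + l' *\<^sub>R v'" | "p = p' + l' *\<^sub>R v'" "p + l *\<^sub>R v = p'"
      by (auto simp: doubleton_eq_iff)
    then show ?thesis
    proof cases
      case 1
      then have *: "l *\<^sub>R v = l' *\<^sub>R v'" by simp
      show ?thesis
      proof (cases "l = 0 \<and> l' = 0")
        case False
        then have "v = v' \<or> v = - v'" using primitive_vec_parallel[OF v h(1) *] by blast
        then show ?thesis
        proof
          assume "v = - v'"
          then have "(l + l') *\<^sub>R v' = 0" using * by (simp add: scaleR_add_left add_eq_0_iff)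
          then show ?thesis using h(1,2) l False by (auto simp: primitive_vec_def)
        qed (use 1 h in auto)
      qed (use h(4) in auto)
    next
      case 2
      then have "l *\<^sub>R v + l' *\<^sub>R v' = 0" by (simp add: algebra_simps)
      then have *: "l *\<^sub>R v = (- l') *\<^sub>R v'" by (simp add: eq_neg_iff_add_eq_0)
      show ?thesis
      proof (cases "l = 0 \<and> l' = 0")
        case False
        then have "v = v' \<or> v = - v'" using primitive_vec_parallel[OF v h(1) *] by simp
        then show ?thesis
        proof
          assume "v = v'"
          then have "(l + l') *\<^sub>R v' = 0" using * by (simp add: algebra_simps)
          then show ?thesis using h(1,2) l False by (auto simp: primitive_vec_def)
        qed (use 2 h in \<open>auto simp: K_minus\<close>)
      qed (use h(4) in auto)
    qed
  qed
  then show ?thesis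
    unfolding segment_value_def by (intro some_equality) (use assms in blast)+
qed

lemma segment_value_translate:
  assumes v: "primitive_vec v" and l: "0 \<le> l" and P: "P = closed_segment p (p + l *\<^sub>R v)"
    and \<gamma>: "\<gamma> \<in> \<Gamma>"
  shows "segment_value ((+) \<gamma> ` P) = segment_value P"
proof -
  have *: "(+) \<gamma> ` P = closed_segment (p + \<gamma>) ((p + \<gamma>) + l *\<^sub>R v)"
    unfolding P closed_segment_translation[symmetric] by (simp add: add_ac)
  have "(p + \<gamma>) + l *\<^sub>R v = (p + l *\<^sub>R v) + \<gamma>" by simp
  then show ?thesis unfolding * unfolding P segment_value_eq[OF v l] using K_translate[OF \<gamma>] by metis
qed

end

section \<open>Directions and faces\<close>

lemma subspace_direction: "subspace (direction P)"
  by (simp add: direction_def)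

lemma direction_diff: "x \<in> P \<Longrightarrow> y \<in> P \<Longrightarrow> x - y \<in> direction P"
  unfolding direction_def by (rule span_base) blast

lemma direction_mono: "P \<subseteq> Q \<Longrightarrow> direction P \<subseteq> direction Q"
  unfolding direction_def by (rule span_mono) blast

lemma direction_translate: "direction ((+) a ` P) = direction P"
proof -
  have "{x - y |x y. x \<in> (+) a ` P \<and> y \<in> (+) a ` P} = {x - y |x y. x \<in> P \<and> y \<in> P}"
  proof (intro equalityI subsetI)
    fix z assume "z \<in> {x - y |x y. x \<in> P \<and> y \<in> P}"
    then obtain x y where "x \<in> P" "y \<in> P" "z = (a + x) - (a + y)" by auto
    then show "z \<in> {x - y |x y. x \<in> (+) a ` P \<and> y \<in> (+) a ` P}" by blast
  next
    fix z assume "z \<in> {x - y |x y. x \<in> (+) a ` P \<and> y \<in> (+) a ` P}"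
    then obtain x y where "x \<in> P" "y \<in> P" "z = x - y" by auto
    then show "z \<in> {x - y |x y. x \<in> P \<and> y \<in> P}" by blast
  qed
  then show ?thesis by (simp add: direction_def)
qed

lemma direction_vanish:
  assumes z: "z \<in> direction P" and f: "linear f" "\<And>x. x \<in> P \<Longrightarrow> f x = b"
  shows "f z = (0::real)"
proof -
  have "f z = 0" if "z \<in> span {x - y |x y. x \<in> P \<and> y \<in> P}"
    by (rule span_induct[OF that])
      (auto simp: subspace_def linear_0[OF f(1)] linear_add[OF f(1)] linear_scale[OF f(1)]
        linear_diff[OF f(1)] f(2))
  then show ?thesis using z by (simp add: direction_def)
qed

lemma aff_dim_direction:
  fixes P :: "'a::euclidean_space set"
  assumes "P \<noteq> {}"
  shows "aff_dim P = int (dim (direction P))"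
proof -
  obtain a where a: "a \<in> P" using assms by blast
  have "aff_dim P = int (dim ((\<lambda>x. x - a) ` P))"
    by (rule aff_dim_eq_dim_subtract) (use a hull_subset in fast)
  moreover have "direction P = span ((\<lambda>x. x - a) ` P)"
    unfolding direction_def
  proof (rule span_eq[THEN iffD2], intro conjI subsetI)
    fix z assume "z \<in> {x - y |x y. x \<in> P \<and> y \<in> P}"
    then obtain x y where xy: "x \<in> P" "y \<in> P" "z = (x - a) - (y - a)" by auto
    show "z \<in> span ((\<lambda>x. x - a) ` P)"
      unfolding xy(3) by (rule span_diff) (auto intro!: span_base imageI xy)
  next
    fix z assume "z \<in> (\<lambda>x. x - a) ` P"
    then show "z \<in> span {x - y |x y. x \<in> P \<and> y \<in> P}" using a by (intro span_base) auto
  qed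
  ultimately show ?thesis by simp
qed

lemma dim_direction:
  fixes P :: "'a::euclidean_space set"
  shows "aff_dim P = 1 \<Longrightarrow> dim (direction P) = 1" "aff_dim P = 2 \<Longrightarrow> dim (direction P) = 2"
proof -
  have "int (dim (direction P)) = aff_dim P" if "0 < aff_dim P"
  proof -
    have "P \<noteq> {}" using that aff_dim_empty[of P] by linarith
    then show ?thesis by (rule aff_dim_direction[symmetric])
  qed
  then show "aff_dim P = 1 \<Longrightarrow> dim (direction P) = 1" "aff_dim P = 2 \<Longrightarrow> dim (direction P) = 2"
    by linarith+
qed

lemma direction_dim_1:
  fixes P :: "'a::euclidean_space set"
  assumes P: "aff_dim P = 1" and z: "z \<in> direction P" "z \<noteq> 0" and w: "w \<in> direction P"
  obtains c where "w = c *\<^sub>R z"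
proof -
  have "dim (direction P) = 1" by (rule dim_direction(1)[OF P])
  moreover have "dim {z} = 1" using z(2) by (simp add: dim_insert)
  ultimately have "span {z} = span (direction P)" using z(1) by (intro dim_eq_span) auto
  then have "w \<in> span {z}" using w span_base by blast
  then show thesis using that by (auto simp: span_singleton)
qed

lemma direction_dim_2:
  fixes P :: "'a::euclidean_space set"
  assumes P: "aff_dim P = 2" and z: "z \<in> direction P" "z \<noteq> 0" "u \<in> direction P" "u \<notin> span {z}"
    and w: "w \<in> direction P"
  obtains a b where "w = a *\<^sub>R z + b *\<^sub>R u"
proof -
  have "dim (direction P) = 2" by (rule dim_direction(2)[OF P])
  moreover have "dim {u, z} = 2" using z by (simp add: dim_insert)
  ultimately have "span {u, z} = span (direction P)" using z by (intro dim_eq_span) auto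
  then have "w \<in> span {u, z}" using w span_base by blast
  then obtain b where "w - b *\<^sub>R u \<in> span {z}" by (auto simp: span_insert)
  then obtain a where "w - b *\<^sub>R u = a *\<^sub>R z" by (auto simp: span_singleton)
  then show thesis using that[of a b] by (simp add: algebra_simps)
qed

text \<open>A supporting functional of F vanishes on the direction of F but not on u. So on P,
  relative to a point of F, it is a nonzero multiple of the coordinate along u, which therefore has
  constant sign.\<close>

lemma face_one_sided:
  fixes P :: "'a::euclidean_space set"
  assumes P: "polyhedron P" "aff_dim P = 2" and F: "F face_of P" "aff_dim F = 1"
    and z: "z \<in> F" and u: "u \<in> direction P" "u \<notin> direction F"
  obtains s :: real where "s = 1 \<or> s = -1"
    "\<And>y. y \<in> P \<Longrightarrow> \<exists>c. 0 \<le> s * c \<and> y - z - c *\<^sub>R u \<in> direction F"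
proof -
  have FP: "F \<subseteq> P" using F(1) face_of_imp_subset by blast
  obtain a b where a: "P \<subseteq> {x. a \<bullet> x \<le> b}" "F = P \<inter> {x. a \<bullet> x = b}"
  proof -
    have "F exposed_face_of P" by (rule exposed_face_of_polyhedron[OF P(1), THEN iffD2, OF F(1)])
    then have "\<exists>a b. P \<subseteq> {x. a \<bullet> x \<le> b} \<and> F = P \<inter> {x. a \<bullet> x = b}"
      unfolding exposed_face_of_def by (elim conjE)
    then show thesis by (elim exE conjE) (rule that)
  qed
  have lin: "linear (\<lambda>x. a \<bullet> x)" by (simp add: linear_iff inner_add_right)
  have aF: "a \<bullet> d = 0" if "d \<in> direction F" for d
    by (rule direction_vanish[OF that lin, of b]) (simp add: a(2))
  obtain d where d: "d \<in> direction F" "d \<noteq> 0"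
  proof -
    have "dim (direction F) = 1" by (rule dim_direction(1)[OF F(2)])
    then have "\<not> direction F \<subseteq> {0}" using dim_eq_0[of "direction F"] by simp
    then show thesis using that by blast
  qed
  have ud: "u \<notin> span {d}"
    using u(2) span_minimal[OF _ subspace_direction, of "{d}" F] d(1) by auto
  have dec: "\<exists>c. y - z - c *\<^sub>R u \<in> direction F \<and> a \<bullet> y - b = c * (a \<bullet> u)" if "y \<in> P" for y
  proof -
    have "y - z \<in> direction P" using direction_diff that z FP by blast
    then obtain e c where e: "y - z = e *\<^sub>R d + c *\<^sub>R u"
      using direction_dim_2[OF P(2) _ d(2) u(1) ud] d(1) direction_mono[OF FP] by blast
    have "y - z - c *\<^sub>R u \<in> direction F"
      unfolding e using d(1) subspace_scale[OF subspace_direction] by simp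
    moreover have "a \<bullet> y - b = a \<bullet> (y - z)" using z a(2) by (simp add: inner_diff_right)
    then have "a \<bullet> y - b = c * (a \<bullet> u)" unfolding e using aF[OF d(1)] by (simp add: inner_add_right)
    ultimately show ?thesis by blast
  qed
  have au: "a \<bullet> u \<noteq> 0"
  proof
    assume "a \<bullet> u = 0"
    then have "a \<bullet> y = b" if "y \<in> P" for y using dec[OF that] by auto
    then have "F = P" unfolding a(2) by auto
    then show False using P(2) F(2) by simp
  qed
  show thesis
  proof (rule that[of "if a \<bullet> u < 0 then 1 else -1"])
    fix y assume y: "y \<in> P"
    obtain c where c: "y - z - c *\<^sub>R u \<in> direction F" "a \<bullet> y - b = c * (a \<bullet> u)" using dec[OF y] by blast
    have "c * (a \<bullet> u) \<le> 0" using c(2) a(1) y by auto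
    then have "0 \<le> (if a \<bullet> u < 0 then 1 else -1) * c"
      using au by (auto simp: mult_le_0_iff)
    then show "\<exists>c. 0 \<le> (if a \<bullet> u < 0 then 1 else -1) * c \<and> y - z - c *\<^sub>R u \<in> direction F"
      using c(1) by blast
  qed simp
qed

section \<open>Points of cells at a given height\<close>

lemma convex_level:
  fixes P :: "('a::real_vector \<times> real) set"
  assumes P: "convex P" "(x, a) \<in> P" "(y, b) \<in> P" and t: "a \<le> t" "t \<le> b" "a < b"
  shows "(x + ((t - a) / (b - a)) *\<^sub>R (y - x), t) \<in> P"
proof -
  define \<theta> where "\<theta> = (t - a) / (b - a)"
  have \<theta>: "0 \<le> \<theta>" "\<theta> \<le> 1" using t by (auto simp: \<theta>_def field_simps)
  have "(1 - \<theta>) *\<^sub>R (x, a) + \<theta> *\<^sub>R (y, b) \<in> P"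
    using P(1) \<theta> by (intro convexD[OF P(1) P(2,3)]) auto
  moreover have "(1 - \<theta>) * a + \<theta> * b = t"
  proof -
    have "\<theta> * (b - a) = t - a" using t by (simp add: \<theta>_def)
    then show ?thesis by (simp add: algebra_simps)
  qed
  ultimately show ?thesis
    by (simp add: \<theta>_def[symmetric] scaleR_diff_left scaleR_diff_right algebra_simps)
qed

lemma line_level:
  fixes P :: "('a::euclidean_space \<times> real) set"
  assumes P: "aff_dim P = 1" "(x, a) \<in> P" "(y, b) \<in> P" "a \<noteq> b" and z: "(z, t) \<in> P"
  shows "z = x + ((t - a) / (b - a)) *\<^sub>R (y - x)"
proof -
  have *: "(y, b) - (x, a) \<in> direction P" "(z, t) - (x, a) \<in> direction P"
    using P z by (simp_all only: direction_diff)
  obtain c where "(z, t) - (x, a) = c *\<^sub>R ((y, b) - (x, a))"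
    by (rule direction_dim_1[OF P(1) *(1) _ *(2)]) (use P(4) in \<open>simp add: zero_prod_def\<close>)
  then have "z - x = c *\<^sub>R (y - x)" "t - a = c * (b - a)" by auto
  then have "z = x + c *\<^sub>R (y - x)" "c = (t - a) / (b - a)"
    using P(4) by (metis add.commute diff_add_cancel, simp)
  then show ?thesis by simp
qed

lemma plane_level:
  fixes P :: "('a::euclidean_space \<times> real) set"
  assumes P: "aff_dim P = 2" "(x, a) \<in> P" "(y, b) \<in> P" "a \<noteq> b" and v: "(v, 0) \<in> direction P" "v \<noteq> 0"
    and z: "(z, t) \<in> P"
  obtains s where "z = x + ((t - a) / (b - a)) *\<^sub>R (y - x) + s *\<^sub>R v"
proof -
  let ?u = "(y, b) - (x, a)"
  have *: "?u \<in> direction P" "(z, t) - (x, a) \<in> direction P"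
    using P z by (simp_all only: direction_diff)
  have u: "?u \<notin> span {(v, 0)}" using P(4) by (auto simp: span_singleton)
  obtain s c where "(z, t) - (x, a) = s *\<^sub>R (v, 0) + c *\<^sub>R ?u"
    by (rule direction_dim_2[OF P(1) v(1) _ *(1) u *(2)]) (use v(2) in \<open>simp add: zero_prod_def\<close>)
  then have "z - x = s *\<^sub>R v + c *\<^sub>R (y - x)" "t - a = c * (b - a)" by auto
  then have "z = x + c *\<^sub>R (y - x) + s *\<^sub>R v" "c = (t - a) / (b - a)"
    using P(4) by (metis add.assoc add.commute diff_add_cancel, simp)
  then have "z = x + ((t - a) / (b - a)) *\<^sub>R (y - x) + s *\<^sub>R v" by simp
  then show thesis by (rule that)
qed

section \<open>Lattices of cells\<close>

text \<open>The vectors (x, m) and (r, k) generate L. Dividing k x - m r by the gcd of m and k gives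
  a horizontal lattice vector w. Writing (v, 0) in the generators shows that v is an integer
  multiple of w, and v being primitive, w is v or -v. The gcd generates the heights of L. In this
  way the weight of a fibre emerges from the balancing condition.\<close>

lemma int_span_snd:
  fixes L :: "((real ^ 'g) \<times> real) set"
  assumes v: "primitive_vec v" "(v, 0) \<in> L" and L: "L \<subseteq> int_vectors \<times> \<int>" "add_subgroup L"
    and rk: "(r, of_int k) \<in> L" "0 < k"
    and n: "(x, of_int m) \<in> L" "\<And>u. u \<in> L \<Longrightarrow> \<exists>i j::int. u = of_int i *\<^sub>R (x, of_int m) + of_int j *\<^sub>R (r, of_int k)"
  shows "\<exists>e::int. (e = 1 \<or> e = -1) \<and>
    of_int k *\<^sub>R x - of_int m *\<^sub>R r = of_int (e * Gcd {n. \<exists>u\<in>L. snd u = of_int n}) *\<^sub>R v"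
proof -
  have scale: "of_int i *\<^sub>R u \<in> L" if "u \<in> L" for u i
  proof (induction i rule: int_induct[where k = 0])
    case base
    then show ?case using add_subgroupD(1)[OF L(2)] by simp
  next
    case (step1 i)
    then show ?case using add_subgroupD(4)[OF L(2) _ that, of "of_int i *\<^sub>R u"]
      by (simp add: scaleR_add_left)
  next
    case (step2 i)
    then show ?case using add_subgroupD(2)[OF L(2) _ that, of "of_int i *\<^sub>R u"]
      by (simp add: scaleR_diff_left)
  qed
  define g where "g = gcd m k"
  have g0: "0 < g" using rk(2) by (simp add: g_def)
  obtain m' k' where mk: "m = g * m'" "k = g * k'" "coprime m' k'"
    using gcd_coprime_exists[of m k] rk(2) unfolding g_def by (auto simp: mult.commute)
  have k'0: "k' \<noteq> 0" using mk rk(2) by auto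
  define w where "w = of_int k' *\<^sub>R x - of_int m' *\<^sub>R r"
  have w: "(w, 0) \<in> L"
  proof -
    have "of_int k' *\<^sub>R (x, of_int m) - of_int m' *\<^sub>R (r, of_int k) \<in> L"
      by (intro add_subgroupD(2)[OF L(2)] scale n rk)
    moreover have "of_int k' * of_int m - of_int m' * of_int k = (0::real)"
      unfolding mk by simp
    ultimately show ?thesis by (simp add: w_def)
  qed
  obtain i j :: int where ij: "(v, 0) = of_int i *\<^sub>R (x, real_of_int m) + of_int j *\<^sub>R (r, real_of_int k)"
    using n(2)[OF v(2)] by blast
  have "real_of_int (i * m + j * k) = 0" using ij by simp
  then have "i * m + j * k = 0" by linarith
  then have "g * (i * m' + j * k') = 0" unfolding mk by (simp add: algebra_simps)
  then have ij0: "i * m' = - j * k'" using g0 by simp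
  then have "k' dvd i * m'" by simp
  then have "k' dvd i" using mk(3) by (metis coprime_commute coprime_dvd_mult_left_iff)
  then obtain l where l: "i = k' * l" by blast
  have "k' * (j + m' * l) = 0" using ij0 unfolding l by (simp add: algebra_simps)
  then have "j = - m' * l" using k'0 by simp
  then have vw: "v = of_int l *\<^sub>R w" using ij l by (simp add: w_def algebra_simps)
  have l0: "l \<noteq> 0" using vw v by (auto simp: primitive_vec_def)
  then have "w = (1 / of_int l) *\<^sub>R v" using vw by simp
  moreover have "w \<in> int_vectors" using w L(1) by auto
  ultimately have "1 / real_of_int l \<in> \<int>" using v(1) unfolding primitive_vec_def by metis
  then obtain l' :: int where "1 / real_of_int l = of_int l'" by (auto elim: Ints_cases)
  then have "real_of_int (l * l') = 1" using l0 by (simp add: field_simps)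
  then have "l * l' = 1" by linarith
  then have l1: "l = 1 \<or> l = -1" by (auto simp: zmult_eq_1_iff)
  have "Gcd {n. \<exists>u\<in>L. snd u = of_int n} = g"
  proof (rule associated_eqI)
    have gL: "(g::int) \<in> {n. \<exists>u\<in>L. snd u = of_int n}"
    proof -
      obtain a b where ab: "a * m + b * k = g" using bezout_int[of m k] by (auto simp: g_def)
      have "of_int a *\<^sub>R (x, real_of_int m) + of_int b *\<^sub>R (r, real_of_int k) \<in> L"
        by (intro add_subgroupD(4)[OF L(2)] scale n rk)
      moreover have "snd (of_int a *\<^sub>R (x, real_of_int m) + of_int b *\<^sub>R (r, real_of_int k)) = real_of_int g"
        by (simp add: ab[symmetric])
      ultimately show ?thesis by blast
    qed
    show "Gcd {n. \<exists>u\<in>L. snd u = of_int n} dvd g" using gL by (rule Gcd_dvd)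
    show "g dvd Gcd {n. \<exists>u\<in>L. snd u = of_int n}"
    proof (rule Gcd_greatest)
      fix a assume "a \<in> {n. \<exists>u\<in>L. snd u = of_int n}"
      then obtain u where u: "u \<in> L" "snd u = of_int a" by blast
      obtain i j :: int where "u = of_int i *\<^sub>R (x, real_of_int m) + of_int j *\<^sub>R (r, real_of_int k)"
        using n(2)[OF u(1)] by blast
      then have "real_of_int a = of_int (i * m + j * k)" using u(2) by simp
      then have "a = i * m + j * k" by linarith
      then show "g dvd a" by (simp add: g_def)
    qed
  qed (use g0 in auto)
  moreover have "of_int k *\<^sub>R x - of_int m *\<^sub>R r = of_int g *\<^sub>R w"
    unfolding w_def mk by (simp add: algebra_simps)
  moreover have "w = of_int l *\<^sub>R v" using vw l1 by auto
  ultimately show ?thesis using l1 by (intro exI[of _ l]) (simp add: mult.commute)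
qed

lemma add_subgroup_edge_lattice: "add_subgroup edge_lattice"
  using add_subgroup_int_vectors by (auto simp: add_subgroup_def zero_prod_def)

lemma add_subgroup_cell_lattice: "add_subgroup L \<Longrightarrow> add_subgroup (cell_lattice L P)"
  using subspace_direction[of P]
  by (auto simp: add_subgroup_def cell_lattice_def subspace_0 subspace_diff)

lemma cell_lattice_translate: "cell_lattice L ((+) a ` P) = cell_lattice L P"
  by (simp add: cell_lattice_def direction_translate)

lemma fibre_index_translate: "fibre_index ((+) a ` P) = fibre_index P"
  by (simp add: fibre_index_def cell_lattice_translate)

text \<open>If no nonzero lattice vector were horizontal, lattice vectors u and w of heights m and k
  would satisfy m w = k u, and the lattice could not span a plane.\<close>

lemma exists_level_primitive_vec:
  fixes P :: "((real ^ 'g) \<times> real) set"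
  assumes P: "aff_dim P = 2" "rational_slope edge_lattice P"
  obtains v where "primitive_vec v" "(v, 0) \<in> direction P"
proof -
  let ?L = "cell_lattice edge_lattice P"
  have dim: "dim (direction P) = 2" by (rule dim_direction(2)[OF P(1)])
  have L: "?L \<subseteq> direction P" "add_subgroup ?L" "span ?L = direction P"
    using P(2) add_subgroup_cell_lattice[OF add_subgroup_edge_lattice]
    by (auto simp: cell_lattice_def rational_slope_def)
  have "\<exists>x. x \<noteq> 0 \<and> (x, 0) \<in> ?L"
  proof (rule ccontr)
    assume no: "\<nexists>x. x \<noteq> 0 \<and> (x, 0) \<in> ?L"
    have "dim ?L \<le> 1"
    proof (cases "?L \<subseteq> {0}")
      case True
      then show ?thesis using dim_eq_0 by (metis le0)
    next
      case False
      then obtain u where u: "u \<in> ?L" "u \<noteq> 0" by blast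
      obtain m :: int where m: "snd u = of_int m" using u by (auto simp: cell_lattice_def elim: Ints_cases)
      have m0: "m \<noteq> 0"
      proof
        assume "m = 0"
        then have "u = (fst u, 0)" using m by (simp add: prod_eq_iff)
        then show False using no u by (metis zero_prod_def)
      qed
      have "?L \<subseteq> span {u}"
      proof
        fix w assume w: "w \<in> ?L"
        obtain k :: int where k: "snd w = of_int k" using w by (auto simp: cell_lattice_def elim: Ints_cases)
        have sc: "of_int i *\<^sub>R y \<in> ?L" if "y \<in> ?L" for y and i :: int
          using that subspace_scale[OF subspace_direction[of P]] int_vectors_of_int_scale
          by (auto simp: cell_lattice_def)
        define z where "z = of_int m *\<^sub>R w - of_int k *\<^sub>R u"
        have "z \<in> ?L" unfolding z_def by (intro add_subgroupD(2)[OF L(2)] sc w u)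
        moreover have "snd z = 0" by (simp add: z_def m k)
        ultimately have "z = 0" using no by (metis prod.collapse zero_prod_def)
        then have "w = (of_int k / of_int m) *\<^sub>R u"
          using m0 by (simp add: z_def) (metis (no_types, lifting) divideR_right divide_inverse mult.commute of_int_eq_0_iff scaleR_scaleR)
        then show "w \<in> span {u}" by (auto simp: span_singleton)
      qed
      then have "dim ?L \<le> dim {u}" using dim_subset dim_span by metis
      also have "\<dots> \<le> 1" using dim_le_card[of "{u}"] by simp
      finally show ?thesis .
    qed
    moreover have "dim ?L = 2" using dim L(3) dim_span by metis
    ultimately show False by simp
  qed
  then obtain x where x: "x \<noteq> 0" "(x, 0) \<in> ?L" by blast
  then obtain v c where v: "primitive_vec v" "0 < c" "x = c *\<^sub>R v"
    using exists_primitive_vec[of x] by (auto simp: cell_lattice_def)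
  have "(1 / c) *\<^sub>R (x, 0) \<in> direction P"
    using x(2) L(1) by (intro subspace_scale[OF subspace_direction]) auto
  then show thesis using that[OF v(1)] v by simp
qed

text \<open>The heights of lattice vectors are integers, which makes the lattice of a non-horizontal
  line cyclic. The generator is chosen to point upwards, like (d, \<delta>).\<close>

lemma cell_lattice_line:
  fixes P :: "((real ^ 'g) \<times> real) set"
  assumes P: "aff_dim P = 1" "rational_slope edge_lattice P" and d: "(d, \<delta>) \<in> direction P" "0 < \<delta>"
  obtains k r c where "0 < k" "(r, of_int k) \<in> cell_lattice edge_lattice P" "0 < c"
    "(r, of_int k) = c *\<^sub>R (d, \<delta>)"
    "\<And>u. u \<in> cell_lattice edge_lattice P \<Longrightarrow> \<exists>j::int. u = of_int j *\<^sub>R (r, of_int k)"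
proof -
  let ?L = "cell_lattice edge_lattice P"
  have L: "?L \<subseteq> direction P" "add_subgroup ?L" "span ?L = direction P"
    using P(2) add_subgroup_cell_lattice[OF add_subgroup_edge_lattice]
    by (auto simp: cell_lattice_def rational_slope_def)
  define S where "S = {c. c *\<^sub>R (d, \<delta>) \<in> ?L}"
  have S: "add_subgroup S"
    unfolding add_subgroup_def S_def mem_Collect_eq ball_simps
    by (intro conjI allI impI ballI; simp only: scaleR_zero_left scaleR_diff_left mem_Collect_eq
        add_subgroupD(1)[OF L(2)] add_subgroupD(2)[OF L(2)])
  have int: "\<delta> * c \<in> \<int>" if "c \<in> S" for c using that by (auto simp: S_def cell_lattice_def mult.commute)
  obtain c where c: "S = range (\<lambda>n::int. of_int n * c)" "0 \<le> c"
    by (rule real_subgroup_cyclic[OF S _ int]) (use d(2) in auto)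
  have inS: "\<exists>n::int. u = of_int n *\<^sub>R (c *\<^sub>R (d, \<delta>))" if u: "u \<in> ?L" for u
  proof -
    obtain a where a: "u = a *\<^sub>R (d, \<delta>)"
      by (rule direction_dim_1[OF P(1) d(1) _ subsetD[OF L(1) u]]) (use d(2) in \<open>auto simp: zero_prod_def\<close>)
    then have "a \<in> S" using u by (simp add: S_def)
    then obtain n :: int where "a = of_int n * c" using c(1) by auto
    then show ?thesis using a by auto
  qed
  have c0: "0 < c"
  proof (rule ccontr)
    assume "\<not> 0 < c"
    then have "?L \<subseteq> {0}" using inS c(2) by (fastforce simp: zero_prod_def)
    then have "span ?L \<subseteq> {0}" using span_mono[of ?L "{0}"] by simp
    then have "direction P \<subseteq> {0}" unfolding L(3) .
    then show False using d by (auto simp: zero_prod_def)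
  qed
  have cS: "c \<in> S" unfolding c(1) by (rule range_eqI[of _ _ 1]) simp
  then obtain k :: int where k: "\<delta> * c = of_int k" using int by (metis Ints_cases)
  have "0 < real_of_int k" unfolding k[symmetric] using c0 d(2) by simp
  then have k0: "0 < k" by simp
  have eq: "(c *\<^sub>R d, of_int k) = c *\<^sub>R (d, \<delta>)" by (simp add: k[symmetric])
  show thesis
  proof (rule that[OF k0 _ c0 eq])
    show "(c *\<^sub>R d, real_of_int k) \<in> ?L" unfolding eq using cS by (simp add: S_def)
    show "\<exists>j::int. u = of_int j *\<^sub>R (c *\<^sub>R d, real_of_int k)" if "u \<in> ?L" for u
      unfolding eq using inS[OF that] .
  qed
qed

section \<open>The cells over one edge\<close>

lemma slice_translate: "slice ((+) (\<gamma>, 0) ` P) t = (+) \<gamma> ` slice P t" for \<gamma> :: "'a::ab_group_add"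
proof (intro equalityI subsetI)
  fix x assume "x \<in> slice ((+) (\<gamma>, 0) ` P) t"
  then obtain y s where "(y, s) \<in> P" "x = \<gamma> + y" "t = s" by (auto simp: slice_def)
  then show "x \<in> (+) \<gamma> ` slice P t" by (auto simp: slice_def)
next
  fix x assume "x \<in> (+) \<gamma> ` slice P t"
  then obtain y where "(y, t) \<in> P" "x = \<gamma> + y" by (auto simp: slice_def)
  then show "x \<in> slice ((+) (\<gamma>, 0) ` P) t"
    unfolding slice_def by (auto intro!: image_eqI[of _ _ "(y, t)"])
qed

text \<open>What a 2-dimensional cycle looks like over a single edge, possibly infinite. A face is
  again a cell here only if it meets the interior of the edge, since faces over an end belong to the
  complex of the vertex.\<close>

locale edge_complex = tropical_torus \<Gamma> \<Omega> M r
  for \<Gamma> :: "(real ^ 'g) set" and \<Omega> M r +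
  fixes X :: "((real ^ 'g) \<times> real) set set" and w :: "((real ^ 'g) \<times> real) set \<Rightarrow> int" and len :: ereal
  assumes periodic: "periodic_finite (\<Gamma> \<times> {0}) X w"
    and cell: "\<And>P. P \<in> X \<Longrightarrow> P \<noteq> {} \<and> polyhedron P \<and> bounded (fst ` P) \<and> rational_slope edge_lattice P"
    and range: "\<And>P y. P \<in> X \<Longrightarrow> y \<in> P \<Longrightarrow> 0 \<le> snd y \<and> ereal (snd y) \<le> len"
    and proper: "\<And>P t. P \<in> X \<Longrightarrow> ereal t \<in> {0, len} \<Longrightarrow> \<exists>y\<in>P. snd y \<noteq> t"
    and face: "\<And>P F y. P \<in> X \<Longrightarrow> F face_of P \<Longrightarrow> y \<in> F \<Longrightarrow> 0 < snd y \<Longrightarrow> ereal (snd y) < len \<Longrightarrow> F \<in> X"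
    and inter: "\<And>P P'. P \<in> X \<Longrightarrow> P' \<in> X \<Longrightarrow> P \<inter> P' face_of P"
    and balanced: "\<And>\<rho>. \<rho> \<in> X \<Longrightarrow> aff_dim \<rho> = 1 \<Longrightarrow>
      \<exists>n. (\<forall>\<tau>\<in>{\<tau> \<in> X. aff_dim \<tau> = 2 \<and> \<rho> \<subseteq> \<tau>}. primitive_normal edge_lattice \<rho> \<tau> (n \<tau>)) \<and>
        (\<Sum>\<tau>\<in>{\<tau> \<in> X. aff_dim \<tau> = 2 \<and> \<rho> \<subseteq> \<tau>}. of_int (w \<tau>) *\<^sub>R n \<tau>) \<in> direction \<rho>"
begin

lemma convex_cell: "P \<in> X \<Longrightarrow> convex P"
  using cell polyhedron_imp_convex by blast

lemma closed_cell: "P \<in> X \<Longrightarrow> closed P"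
  using cell polyhedron_imp_closed by blast

text \<open>Cells over an infinite edge can be unbounded, but only in height.\<close>

lemma compact_band: "P \<in> X \<Longrightarrow> compact (P \<inter> {y. a \<le> snd y \<and> snd y \<le> b})"
proof -
  assume P: "P \<in> X"
  have "closed {y::(real ^ 'g) \<times> real. a \<le> snd y \<and> snd y \<le> b}"
    by (intro closed_Collect_conj closed_Collect_le continuous_intros)
  moreover have "P \<inter> {y. a \<le> snd y \<and> snd y \<le> b} \<subseteq> fst ` P \<times> {a..b}"
    by (force intro: image_eqI[of _ fst])
  then have "bounded (P \<inter> {y. a \<le> snd y \<and> snd y \<le> b})"
    by (rule bounded_subset[rotated]) (use cell P in \<open>auto intro: bounded_Times\<close>)
  ultimately show ?thesis using closed_cell[OF P] by (auto simp: compact_eq_bounded_closed)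
qed

lemma compact_slice: "P \<in> X \<Longrightarrow> compact (slice P t)"
proof -
  assume P: "P \<in> X"
  have "slice P t = fst ` (P \<inter> {y. t \<le> snd y \<and> snd y \<le> t})"
    by (force simp: slice_def)
  moreover have "compact (fst ` (P \<inter> {y. t \<le> snd y \<and> snd y \<le> t}))"
    by (rule compact_continuous_image[OF _ compact_band[OF P]]) (intro continuous_intros)
  ultimately show ?thesis by simp
qed

lemma convex_slice: "P \<in> X \<Longrightarrow> convex (slice P t)"
proof -
  assume P: "P \<in> X"
  have "slice P t = fst ` (P \<inter> {y. snd y = t})" by (force simp: slice_def)
  moreover have "convex (P \<inter> {y. snd y = t})"
    using convex_cell[OF P] convex_linear_vimage[OF linear_snd convex_singleton, of t]
    by (intro convex_Int) (auto simp: vimage_def)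
  ultimately show ?thesis by (auto intro: convex_linear_image linear_fst)
qed

lemma level_face:
  assumes P: "P \<in> X" and t: "(\<forall>y\<in>P. snd y \<le> t) \<or> (\<forall>y\<in>P. t \<le> snd y)"
  shows "slice P t \<times> {t} face_of P"
proof -
  have eq: "slice P t \<times> {t} = P \<inter> {y. (0, 1) \<bullet> y = t}" by (auto simp: slice_def inner_prod_def)
  show ?thesis
    unfolding eq using t
  proof
    assume "\<forall>y\<in>P. snd y \<le> t"
    then show "P \<inter> {y. (0, 1) \<bullet> y = t} face_of P"
      by (intro face_of_Int_supporting_hyperplane_le convex_cell[OF P]) (auto simp: inner_prod_def)
  next
    assume "\<forall>y\<in>P. t \<le> snd y"
    then show "P \<inter> {y. (0, 1) \<bullet> y = t} face_of P"
      by (intro face_of_Int_supporting_hyperplane_ge convex_cell[OF P]) (auto simp: inner_prod_def)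
  qed
qed

section \<open>Levels of vertices\<close>

definition crit :: "real set" where
  "crit = {t. \<exists>x. {(x, t)} \<in> X}"

definition crit_free :: "real \<Rightarrow> real \<Rightarrow> bool" where
  "crit_free a b \<longleftrightarrow> (\<forall>t\<in>crit. \<not> (a < t \<and> t < b))"

text \<open>Translations by periods preserve heights, so all vertices of one orbit lie at one
  level.\<close>

lemma finite_crit: "finite crit"
proof -
  obtain F where F: "finite F" "\<forall>P\<in>X. \<exists>Q\<in>F. \<exists>\<gamma>\<in>\<Gamma> \<times> {0}. P = (+) \<gamma> ` Q"
    using periodic unfolding periodic_finite_def by (elim conjE exE)
  have "crit \<subseteq> (\<lambda>Q. snd (the_elem Q)) ` F"
  proof
    fix t assume "t \<in> crit"
    then obtain x where x: "{(x, t)} \<in> X" by (auto simp: crit_def)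
    obtain Q \<gamma> where Q: "Q \<in> F" "\<gamma> \<in> \<Gamma> \<times> {0}" "{(x, t)} = (+) \<gamma> ` Q"
      using bspec[OF F(2) x] by (elim bexE)
    have "Q = (+) (- \<gamma>) ` {(x, t)}" unfolding Q(3) translate_uminus ..
    then have "Q = {(x, t) - \<gamma>}" by simp
    then have "t = snd (the_elem Q)" using Q(2) by auto
    then show "t \<in> (\<lambda>Q. snd (the_elem Q)) ` F" using Q(1) by blast
  qed
  then show ?thesis using F(1) finite_surj by blast
qed

text \<open>The extremal level set is a compact face of P, and any extreme point of it is a vertex
  of P.\<close>

lemma extremal_level_crit:
  assumes P: "P \<in> X" and x: "x \<in> slice P t" and t: "(\<forall>y\<in>P. snd y \<le> t) \<or> (\<forall>y\<in>P. t \<le> snd y)"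
    and inner: "0 < t" "ereal t < len"
  shows "t \<in> crit"
proof -
  let ?F = "slice P t \<times> {t}"
  have "compact ?F" "convex ?F" "?F \<noteq> {}"
    using compact_slice[OF P] convex_slice[OF P] x by (auto intro: compact_Times convex_Times)
  then obtain y where y: "y extreme_point_of ?F" using extreme_point_exists_convex by blast
  then have "{y} face_of ?F" by (simp add: face_of_singleton)
  then have "{y} face_of P" using face_of_trans level_face[OF P t] by blast
  moreover have yF: "y \<in> ?F" using y by (auto simp: extreme_point_of_def)
  ultimately have "{y} \<in> X" using face[OF P, of "{y}" y] inner by auto
  moreover have "y = (fst y, t)" using yF by auto
  ultimately show ?thesis unfolding crit_def by (metis (mono_tags, lifting) mem_Collect_eq)
qed

text \<open>If P stopped before reaching a or b, the level at which it stops would be extremal for P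
  and hence critical.\<close>

lemma slices_nonempty:
  assumes P: "P \<in> X" and y: "y \<in> P" "a < snd y" "snd y < b" and ab: "0 \<le> a" "ereal b \<le> len"
    and cf: "crit_free a b"
  shows "slice P a \<noteq> {}" "slice P b \<noteq> {}"
proof -
  let ?C = "P \<inter> {y. a \<le> snd y \<and> snd y \<le> b}"
  have C: "compact ?C" "?C \<noteq> {}" using compact_band[OF P] y by auto
  have cont: "continuous_on ?C snd" by (intro continuous_intros)
  have lb: "a < t \<Longrightarrow> 0 < t" for t using ab by simp
  have ub: "t < b \<Longrightarrow> ereal t < len" for t using ab by (metis ereal_less(2) less_ereal.simps(1) order_less_le_trans)
  show "slice P b \<noteq> {}"
  proof
    assume none: "slice P b = {}"
    obtain z where z: "z \<in> ?C" "\<And>y. y \<in> ?C \<Longrightarrow> snd y \<le> snd z"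
      using continuous_attains_sup[OF C cont] by blast
    have zb: "snd z < b" using z none by (cases z) (force simp: slice_def)
    \<comment> \<open>A point of P above the band, joined to z, would by convexity give a point at
      level b.\<close>
    have "snd u \<le> snd z" if u: "u \<in> P" for u
    proof (rule ccontr)
      assume "\<not> snd u \<le> snd z"
      then have "b < snd u" using z(2)[of u] z(1) u by fastforce
      then have "(fst z + ((b - snd z) / (snd u - snd z)) *\<^sub>R (fst u - fst z), b) \<in> P"
        using convex_level[OF convex_cell[OF P], of "fst z" "snd z" "fst u" "snd u" b] z(1) u zb by simp
      then show False using none by (auto simp: slice_def)
    qed
    moreover have "a < snd z" using z(2)[of y] y by fastforce
    moreover have "fst z \<in> slice P (snd z)" using z(1) by (simp add: slice_def)
    ultimately have "snd z \<in> crit"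
      using lb ub[OF zb] by (intro extremal_level_crit[OF P]) blast+
    then show False using cf \<open>a < snd z\<close> zb unfolding crit_free_def by blast
  qed
  show "slice P a \<noteq> {}"
  proof
    assume none: "slice P a = {}"
    obtain z where z: "z \<in> ?C" "\<And>y. y \<in> ?C \<Longrightarrow> snd z \<le> snd y"
      using continuous_attains_inf[OF C cont] by blast
    have za: "a < snd z" using z none by (cases z) (force simp: slice_def)
    have "snd z \<le> snd u" if u: "u \<in> P" for u
    proof (rule ccontr)
      assume "\<not> snd z \<le> snd u"
      then have "snd u < a" using z(2)[of u] z(1) u by fastforce
      then have "(fst u + ((a - snd u) / (snd z - snd u)) *\<^sub>R (fst z - fst u), a) \<in> P"
        using convex_level[OF convex_cell[OF P], of "fst u" "snd u" "fst z" "snd z" a] z(1) u za by simp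
      then show False using none by (auto simp: slice_def)
    qed
    moreover have "snd z < b" using z(2)[of y] y by fastforce
    moreover have "fst z \<in> slice P (snd z)" using z(1) by (simp add: slice_def)
    ultimately have "snd z \<in> crit"
      using lb[OF za] ub by (intro extremal_level_crit[OF P]) blast+
    then show False using cf \<open>snd z < b\<close> za unfolding crit_free_def by blast
  qed
qed

section \<open>Slices and sides of a 2-cell\<close>

definition cells2 :: "((real ^ 'g) \<times> real) set set" where
  "cells2 = {P \<in> X. aff_dim P = 2}"

text \<open>The choice depends on \<open>direction P\<close> only and so is the same for all
  translates of P. A 2-cell inside a fibre has many horizontal directions; for any other 2-cell the
  vector is unique up to sign.\<close>

definition lvec :: "((real ^ 'g) \<times> real) set \<Rightarrow> real ^ 'g" where
  "lvec P = (SOME v. primitive_vec v \<and> (v, 0) \<in> direction P)"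

lemma lvec: "P \<in> cells2 \<Longrightarrow> primitive_vec (lvec P)" "P \<in> cells2 \<Longrightarrow> (lvec P, 0) \<in> direction P"
proof -
  assume P: "P \<in> cells2"
  obtain v where v: "primitive_vec v" "(v, 0) \<in> direction P"
    by (rule exists_level_primitive_vec[of P]) (use P cell in \<open>auto simp: cells2_def\<close>)
  have "primitive_vec (lvec P) \<and> (lvec P, 0) \<in> direction P"
    unfolding lvec_def by (rule someI) (use v in blast)
  then show "primitive_vec (lvec P)" "(lvec P, 0) \<in> direction P" by blast+
qed

lemma lvec_nonzero: "P \<in> cells2 \<Longrightarrow> lvec P \<noteq> 0"
  using lvec(1) by (auto simp: primitive_vec_def)

text \<open>A cell that also reaches another level is not horizontal, so its slice lies on a line in
  direction \<open>lvec P\<close>; being compact and convex, it is an interval there.\<close>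

lemma slice_segment:
  assumes P: "P \<in> cells2" and ne: "slice P t \<noteq> {}" and y: "y \<in> P" "snd y \<noteq> t"
  obtains p l where "0 \<le> l" "slice P t = closed_segment p (p + l *\<^sub>R lvec P)"
proof -
  have PX: "P \<in> X" "aff_dim P = 2" using P by (auto simp: cells2_def)
  define v where "v = lvec P"
  have v: "(v, 0) \<in> direction P" "v \<noteq> 0" using lvec[OF P] lvec_nonzero[OF P] by (auto simp: v_def)
  obtain x where x: "(x, t) \<in> P" using ne by (auto simp: slice_def)
  have on_line: "\<exists>s. x' = x + s *\<^sub>R v" if x': "(x', t) \<in> P" for x'
  proof -
    have "(fst y, snd y) \<in> P" using y by simp
    from plane_level[OF PX(2) x this _ v x'] y(2) show ?thesis by (auto simp: algebra_simps)
  qed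
  define S where "S = {s. x + s *\<^sub>R v \<in> slice P t}"
  have inj: "inj (\<lambda>s. x + s *\<^sub>R v)" using v(2) by (auto simp: inj_on_def)
  have S_img: "slice P t = (\<lambda>s. x + s *\<^sub>R v) ` S" using on_line by (auto simp: S_def slice_def)
  have "closed S"
    unfolding S_def using compact_slice[OF PX(1), of t]
    by (intro continuous_closed_vimage[unfolded vimage_def] compact_imp_closed) (auto intro!: continuous_intros)
  moreover have "bounded S"
  proof -
    have "bounded ((\<lambda>z. z - x) ` slice P t)"
      using bounded_translation[OF compact_imp_bounded[OF compact_slice[OF PX(1)]], of "- x" t] by simp
    then obtain B where B: "\<And>z. z \<in> slice P t \<Longrightarrow> norm (z - x) \<le> B"
      unfolding bounded_iff by auto
    have "\<bar>s\<bar> \<le> B / norm v" if "s \<in> S" for s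
      using B[of "x + s *\<^sub>R v"] that v(2) by (simp add: S_def field_simps)
    then show ?thesis unfolding bounded_iff by auto
  qed
  moreover have "convex S"
  proof (rule convexI)
    fix a b u c :: real assume h: "a \<in> S" "b \<in> S" "0 \<le> u" "0 \<le> c" "u + c = 1"
    then have "u *\<^sub>R (x + a *\<^sub>R v) + c *\<^sub>R (x + b *\<^sub>R v) \<in> slice P t"
      using convexD[OF convex_slice[OF PX(1)]] by (auto simp: S_def)
    moreover have "u *\<^sub>R (x + a *\<^sub>R v) + c *\<^sub>R (x + b *\<^sub>R v) = (u + c) *\<^sub>R x + (u *\<^sub>R a + c *\<^sub>R b) *\<^sub>R v"
      by (simp add: algebra_simps)
    ultimately show "u *\<^sub>R a + c *\<^sub>R b \<in> S" using h by (simp add: S_def)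
  qed
  ultimately obtain a b where ab: "S = {a..b}"
    using connected_compact_interval_1[of S] convex_connected by (auto simp: compact_eq_bounded_closed)
  have "0 \<in> S" using x by (simp add: S_def slice_def)
  then have "a \<le> b" using ab by auto
  have "slice P t = {x + a *\<^sub>R v + s *\<^sub>R v |s. 0 \<le> s \<and> s \<le> b - a}"
  proof (intro equalityI subsetI)
    fix z assume "z \<in> slice P t"
    then obtain s where "s \<in> {a..b}" "z = x + s *\<^sub>R v" using S_img ab by auto
    then have "z = x + a *\<^sub>R v + (s - a) *\<^sub>R v" "0 \<le> s - a" "s - a \<le> b - a" by (auto simp: algebra_simps)
    then show "z \<in> {x + a *\<^sub>R v + s *\<^sub>R v |s. 0 \<le> s \<and> s \<le> b - a}" by blast
  next
    fix z assume "z \<in> {x + a *\<^sub>R v + s *\<^sub>R v |s. 0 \<le> s \<and> s \<le> b - a}"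
    then obtain s where "0 \<le> s" "s \<le> b - a" "z = x + (a + s) *\<^sub>R v" by (auto simp: algebra_simps)
    then show "z \<in> slice P t" unfolding S_img ab by auto
  qed
  then show thesis
    using that[of "b - a" "x + a *\<^sub>R v"] \<open>a \<le> b\<close> closed_segment_param[of "b - a" "x + a *\<^sub>R v" v]
    by (simp add: v_def)
qed

text \<open>The end p of the slice lies on the relative boundary of P, hence on a side \<rho>, and
  \<rho> extends over all of [a, b] because no vertex lies strictly between these levels. The whole
  cell lies on that side of \<rho> to which the slice extends.\<close>

lemma boundary_cell:
  assumes P: "P \<in> cells2" and t: "a < t" "t < b" "0 \<le> a" "ereal b \<le> len" and cf: "crit_free a b"
    and v: "(v, 0) \<in> direction P" "v \<noteq> 0"
    and p: "(p, t) \<in> P" "(p + l *\<^sub>R v, t) \<in> P" "0 < l" "\<And>c. c < 0 \<Longrightarrow> (p + c *\<^sub>R v, t) \<notin> P"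
  obtains \<rho> pa pb where "\<rho> \<in> X" "aff_dim \<rho> = 1" "\<rho> \<subseteq> P" "(p, t) \<in> \<rho>" "(pa, a) \<in> \<rho>" "(pb, b) \<in> \<rho>"
    "\<And>y. y \<in> P \<Longrightarrow> \<exists>c\<ge>0. fst y = pa + ((snd y - a) / (b - a)) *\<^sub>R (pb - pa) + c *\<^sub>R v"
proof -
  have PX: "P \<in> X" "aff_dim P = 2" using P by (auto simp: cells2_def)
  have inner: "0 < t" "ereal t < len"
    using t by (simp, metis less_ereal.simps(1) order_less_le_trans)
  \<comment> \<open>Otherwise the segment from p + l v to p could be prolonged beyond p inside
    P.\<close>
  have "(p, t) \<notin> rel_interior P"
  proof
    assume "(p, t) \<in> rel_interior P"
    then obtain e where e: "1 < e" "(1 - e) *\<^sub>R (p + l *\<^sub>R v, t) + e *\<^sub>R (p, t) \<in> P"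
      using convex_rel_interior_iff[OF convex_cell[OF PX(1)]] p(1,2) by blast
    have "(1 - e) *\<^sub>R (p + l *\<^sub>R v) + e *\<^sub>R p = p + ((1 - e) * l) *\<^sub>R v" by (simp add: algebra_simps)
    moreover have "(1 - e) * t + e * t = t" by (simp add: algebra_simps)
    ultimately have "(p + ((1 - e) * l) *\<^sub>R v, t) \<in> P" using e(2) by simp
    moreover have "(1 - e) * l < 0" using e(1) p(3) by (simp add: mult_less_0_iff)
    ultimately show False using p(4) by blast
  qed
  then have "(p, t) \<in> rel_frontier P" using p(1) closure_subset by (auto simp: rel_frontier_def)
  then obtain \<rho> where \<rho>: "\<rho> facet_of P" "(p, t) \<in> \<rho>"
    using rel_frontier_of_polyhedron[of P] cell[OF PX(1)] by blast
  then have \<rho>P: "\<rho> face_of P" "aff_dim \<rho> = 1" using PX(2) by (auto simp: facet_of_def)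
  note \<rho>P = \<rho>P face_of_imp_subset[OF \<rho>P(1)]
  have \<rho>X: "\<rho> \<in> X" using face[OF PX(1) \<rho>P(1) \<rho>(2)] inner by simp
  obtain pa pb where pab: "(pa, a) \<in> \<rho>" "(pb, b) \<in> \<rho>"
    using slices_nonempty[OF \<rho>X \<rho>(2) _ _ t(3,4) cf] t(1,2) by (auto simp: slice_def)
  let ?d = "(pb, b) - (pa, a)"
  have d: "?d \<in> direction \<rho>" by (rule direction_diff[OF pab(2,1)])
  have d0: "?d \<noteq> 0" using t(1,2) by (simp add: zero_prod_def)
  have vn: "c *\<^sub>R (v, 0) \<in> direction \<rho> \<Longrightarrow> c = 0" for c
  proof -
    assume "c *\<^sub>R (v, 0) \<in> direction \<rho>"
    from direction_dim_1[OF \<rho>P(2) d d0 this] obtain k where k: "c *\<^sub>R (v, 0) = k *\<^sub>R ?d" by blast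
    then have "k * (b - a) = 0" by simp
    then have "k = 0" using t(1,2) by simp
    then show "c = 0" using k v(2) by (simp add: zero_prod_def)
  qed
  obtain s :: real where s: "s = 1 \<or> s = -1"
    "\<And>y. y \<in> P \<Longrightarrow> \<exists>c. 0 \<le> s * c \<and> y - (pa, a) - c *\<^sub>R (v, 0) \<in> direction \<rho>"
    by (rule face_one_sided[OF _ PX(2) \<rho>P(1,2) pab(1) v(1)])
      (use cell[OF PX(1)] vn[of 1] in \<open>auto simp: zero_prod_def\<close>)
  \<comment> \<open>The point p + l v of P lies on the positive side of \<rho> and fixes the
    sign.\<close>
  have s1: "s = 1"
  proof -
    obtain c where c: "0 \<le> s * c" "(p + l *\<^sub>R v, t) - (pa, a) - c *\<^sub>R (v, 0) \<in> direction \<rho>"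
      using s(2)[OF p(2)] by blast
    have "(p, t) - (pa, a) \<in> direction \<rho>" by (rule direction_diff[OF \<rho>(2) pab(1)])
    from subspace_diff[OF subspace_direction c(2) this] have "(l - c) *\<^sub>R (v, 0) \<in> direction \<rho>"
      by (simp add: algebra_simps)
    then have "c = l" using vn by fastforce
    then show ?thesis using c(1) p(3) s(1) by auto
  qed
  show thesis
  proof (rule that[OF \<rho>X \<rho>P(2,3) \<rho>(2) pab])
    fix y assume "y \<in> P"
    then obtain c where "0 \<le> s * c" and c2: "y - (pa, a) - c *\<^sub>R (v, 0) \<in> direction \<rho>" using s(2) by blast
    note c = this(1)[unfolded s1 mult_1] c2
    from direction_dim_1[OF \<rho>P(2) d d0 c(2)] obtain k where "y - (pa, a) - c *\<^sub>R (v, 0) = k *\<^sub>R ?d" by blast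
    then have "fst y - pa - c *\<^sub>R v = k *\<^sub>R (pb - pa)" "snd y - a = k * (b - a)" by (auto simp: prod_eq_iff)
    then have "fst y = pa + k *\<^sub>R (pb - pa) + c *\<^sub>R v" "k = (snd y - a) / (b - a)"
      using t(1,2) by (metis add.assoc add.commute diff_add_cancel, simp)
    then show "\<exists>c\<ge>0. fst y = pa + ((snd y - a) / (b - a)) *\<^sub>R (pb - pa) + c *\<^sub>R v" using c(1) by blast
  qed
qed

text \<open>P is two-dimensional, so it has a point y off the line joining (xa, a) and (xb, b).
  Joining y to that one of the two points which lies on the other side of level t gives a second
  point of the slice.\<close>

lemma slice_nondegenerate:
  assumes P: "P \<in> cells2" and t: "a < t" "t < b" and ne: "(xa, a) \<in> P" "(xb, b) \<in> P"
  obtains x x' where "x \<in> slice P t" "x' \<in> slice P t" "x \<noteq> x'"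
proof -
  have PX: "P \<in> X" "aff_dim P = 2" using P by (auto simp: cells2_def)
  define v where "v = lvec P"
  have v: "(v, 0) \<in> direction P" "v \<noteq> 0" using lvec[OF P] lvec_nonzero[OF P] by (auto simp: v_def)
  define D where "D = xb - xa"
  \<comment> \<open>The point of the line joining the two given points at level u.\<close>
  define b' where "b' u = xa + ((u - a) / (b - a)) *\<^sub>R D" for u
  have ab: "a < b" "a \<noteq> b" using t by auto
  have xm: "b' t \<in> slice P t"
    using convex_level[OF convex_cell[OF PX(1)] ne, of t] t by (simp add: slice_def b'_def D_def)
  have "\<exists>y s. y \<in> P \<and> s \<noteq> 0 \<and> fst y = b' (snd y) + s *\<^sub>R v"
  proof (rule ccontr)
    assume no: "\<nexists>y s. y \<in> P \<and> s \<noteq> 0 \<and> fst y = b' (snd y) + s *\<^sub>R v"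
    have line: "fst y = b' (snd y)" if "y \<in> P" for y
    proof -
      have "(fst y, snd y) \<in> P" using that by simp
      then obtain s where "fst y = b' (snd y) + s *\<^sub>R v"
        using plane_level[OF PX(2) ne ab(2) v] unfolding b'_def D_def by blast
      moreover from this have "s = 0" using no that by blast
      ultimately show ?thesis by simp
    qed
    have "direction P \<subseteq> span {(D, b - a)}"
      unfolding direction_def
    proof (rule span_minimal[OF _ subspace_span], rule subsetI)
      fix z assume "z \<in> {x - y |x y. x \<in> P \<and> y \<in> P}"
      then obtain x y where xy: "x \<in> P" "y \<in> P" "z = x - y" by blast
      have "fst z = ((snd x - snd y) / (b - a)) *\<^sub>R D"
        using line[OF xy(1)] line[OF xy(2)]
        by (simp add: xy(3) b'_def scaleR_diff_left[symmetric] diff_divide_distrib[symmetric])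
      moreover have "snd z = ((snd x - snd y) / (b - a)) * (b - a)" using ab by (simp add: xy(3))
      ultimately have "z = ((snd x - snd y) / (b - a)) *\<^sub>R (D, b - a)" by (simp add: prod_eq_iff)
      then show "z \<in> span {(D, b - a)}" unfolding span_singleton by (rule range_eqI)
    qed
    then have "(v, 0) \<in> span {(D, b - a)}" using v(1) by blast
    then show False using v(2) ab by (auto simp: span_singleton)
  qed
  then obtain y s where y: "y \<in> P" "s \<noteq> 0" "fst y = b' (snd y) + s *\<^sub>R v" by blast
  have yP: "(fst y, snd y) \<in> P" using y(1) by simp
  show thesis
  proof (cases "t \<le> snd y")
    case True
    define \<theta> where "\<theta> = (t - a) / (snd y - a)"
    have "xa + \<theta> *\<^sub>R (fst y - xa) \<in> slice P t"
      using convex_level[OF convex_cell[OF PX(1)] ne(1) yP, of t] t True by (simp add: slice_def \<theta>_def)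
    moreover have "xa + \<theta> *\<^sub>R (fst y - xa) = b' t + (\<theta> * s) *\<^sub>R v"
    proof -
      define k where "k = (snd y - a) / (b - a)"
      have "\<theta> * k = (t - a) / (b - a)" using t True by (simp add: \<theta>_def k_def)
      moreover have "xa + \<theta> *\<^sub>R (fst y - xa) = xa + (\<theta> * k) *\<^sub>R D + (\<theta> * s) *\<^sub>R v"
        unfolding y(3) b'_def k_def[symmetric] by (simp add: algebra_simps)
      ultimately show ?thesis by (simp add: b'_def)
    qed
    moreover have "\<theta> * s \<noteq> 0" using y(2) t True by (simp add: \<theta>_def)
    ultimately show thesis using that[OF xm] v(2) by (metis add_cancel_left_right scaleR_eq_0_iff)
  next
    case False
    define \<theta> where "\<theta> = (t - snd y) / (b - snd y)"
    have "fst y + \<theta> *\<^sub>R (xb - fst y) \<in> slice P t"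
      using convex_level[OF convex_cell[OF PX(1)] yP ne(2), of t] t False by (simp add: slice_def \<theta>_def)
    moreover have "fst y + \<theta> *\<^sub>R (xb - fst y) = b' t + ((1 - \<theta>) * s) *\<^sub>R v"
    proof -
      define k where "k = (snd y - a) / (b - a)"
      have "k + \<theta> * (1 - k) = (t - a) / (b - a)"
      proof -
        have "1 - k = (b - snd y) / (b - a)" using ab by (simp add: k_def field_simps)
        then have "\<theta> * (1 - k) = (t - snd y) / (b - a)" using t False by (simp add: \<theta>_def)
        then show ?thesis by (simp add: k_def add_divide_distrib[symmetric])
      qed
      moreover have "fst y + \<theta> *\<^sub>R (xb - fst y) = xa + (k + \<theta> * (1 - k)) *\<^sub>R D + ((1 - \<theta>) * s) *\<^sub>R v"
        unfolding y(3) b'_def k_def[symmetric] by (simp add: D_def algebra_simps)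
      ultimately show ?thesis by (simp add: b'_def)
    qed
    moreover have "(1 - \<theta>) * s \<noteq> 0" using y(2) t False by (simp add: \<theta>_def)
    ultimately show thesis using that[OF xm] v(2) by (metis add_cancel_left_right scaleR_eq_0_iff)
  qed
qed

text \<open>A proper nonempty face of a 1-cell is a point and cannot meet two levels.\<close>

lemma face_eq_of_slices:
  assumes \<rho>: "\<rho> \<in> X" "aff_dim \<rho> = 1" and F: "F face_of \<rho>" "slice F a \<noteq> {}" "slice F b \<noteq> {}" "a \<noteq> b"
  shows "F = \<rho>"
proof (rule ccontr)
  assume "F \<noteq> \<rho>"
  then have "aff_dim F < 1" using face_of_aff_dim_lt[OF convex_cell[OF \<rho>(1)] F(1)] \<rho>(2) by simp
  moreover have "F \<noteq> {}" using F(2) by (auto simp: slice_def)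
  then have "aff_dim F \<noteq> -1" by (simp add: aff_dim_empty)
  ultimately have "aff_dim F = 0" using aff_dim_geq[of F] by linarith
  then obtain z where "F = {z}" using aff_dim_eq_0 by blast
  then show False using F(2-4) by (auto simp: slice_def)
qed

text \<open>Without vertices strictly between the levels the cell is a trapezoid there, with the two
  slices as parallel sides. One of the slices may shrink to a point, but not both.\<close>

lemma polygon:
  assumes P: "P \<in> cells2" and ab: "a < b" "0 \<le> a" "ereal b \<le> len" and cf: "crit_free a b"
    and ne: "slice P a \<noteq> {}" "slice P b \<noteq> {}"
  obtains \<rho> \<rho>' pa pb la lb where
    "\<rho> \<in> X" "aff_dim \<rho> = 1" "\<rho> \<subseteq> P" "(pa, a) \<in> \<rho>" "(pb, b) \<in> \<rho>"
    "\<rho>' \<in> X" "aff_dim \<rho>' = 1" "\<rho>' \<subseteq> P" "(pa + la *\<^sub>R lvec P, a) \<in> \<rho>'" "(pb + lb *\<^sub>R lvec P, b) \<in> \<rho>'"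
    "0 \<le> la" "0 \<le> lb" "0 < la + lb" "\<rho> \<noteq> \<rho>'"
    "slice P a = closed_segment pa (pa + la *\<^sub>R lvec P)"
    "slice P b = closed_segment pb (pb + lb *\<^sub>R lvec P)"
    "\<And>\<sigma>. \<sigma> \<in> X \<Longrightarrow> aff_dim \<sigma> = 1 \<Longrightarrow> \<sigma> \<subseteq> P \<Longrightarrow> slice \<sigma> a \<noteq> {} \<Longrightarrow> slice \<sigma> b \<noteq> {} \<Longrightarrow> \<sigma> = \<rho> \<or> \<sigma> = \<rho>'"
proof -
  have PX: "P \<in> X" "aff_dim P = 2" using P by (auto simp: cells2_def)
  define v where "v = lvec P"
  have v: "(v, 0) \<in> direction P" "v \<noteq> 0" using lvec[OF P] lvec_nonzero[OF P] by (auto simp: v_def)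
  \<comment> \<open>Strictly between the levels the slice is a proper segment, and its two ends lead
    to the two sides.\<close>
  define t where "t = (a + b) / 2"
  have t: "a < t" "t < b" using ab by (auto simp: t_def)
  obtain xa xb where xab: "(xa, a) \<in> P" "(xb, b) \<in> P" using ne by (auto simp: slice_def)
  obtain x x' where x: "x \<in> slice P t" "x' \<in> slice P t" "x \<noteq> x'"
    by (rule slice_nondegenerate[OF P t xab])
  obtain p l where pl: "0 \<le> l" "slice P t = closed_segment p (p + l *\<^sub>R v)"
    by (rule slice_segment[OF P _ xab(1)]) (use x(1) t v_def in auto)
  have l0: "0 < l"
  proof (rule ccontr)
    assume "\<not> 0 < l"
    then have "slice P t = {p}" using pl by simp
    then show False using x by auto
  qed
  define q where "q = p + l *\<^sub>R v"
  have mem: "(p + c *\<^sub>R v, t) \<in> P \<longleftrightarrow> 0 \<le> c \<and> c \<le> l" for c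
  proof -
    have "(p + c *\<^sub>R v, t) \<in> P \<longleftrightarrow> p + c *\<^sub>R v \<in> slice P t" by (simp add: slice_def)
    also have "\<dots> \<longleftrightarrow> p + c *\<^sub>R v \<in> {p + s *\<^sub>R v |s. 0 \<le> s \<and> s \<le> l}"
      unfolding pl(2) closed_segment_param[OF pl(1)] ..
    also have "\<dots> \<longleftrightarrow> 0 \<le> c \<and> c \<le> l" using v(2) by auto
    finally show ?thesis .
  qed
  have p0: "(p, t) \<in> P" using mem[of 0] l0 by simp
  have q0: "(q, t) \<in> P" using mem[of l] l0 by (simp add: q_def)
  have mq: "(q + c *\<^sub>R - v, t) \<notin> P" if "c < 0" for c
    using mem[of "l - c"] that by (simp add: q_def algebra_simps)
  have mv: "(- v, 0) \<in> direction P" "- v \<noteq> 0"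
    using subspace_neg[OF subspace_direction v(1)] v(2) by auto
  have pq: "(p + l *\<^sub>R v, t) \<in> P" "(q + l *\<^sub>R - v, t) \<in> P" using p0 q0 by (simp_all add: q_def)
  have mp: "(p + c *\<^sub>R v, t) \<notin> P" if "c < 0" for c using mem[of c] that by simp
  obtain \<rho> pa pb where \<rho>: "\<rho> \<in> X" "aff_dim \<rho> = 1" "\<rho> \<subseteq> P" "(p, t) \<in> \<rho>" "(pa, a) \<in> \<rho>" "(pb, b) \<in> \<rho>"
    and side: "\<And>y. y \<in> P \<Longrightarrow> \<exists>c\<ge>0. fst y = pa + ((snd y - a) / (b - a)) *\<^sub>R (pb - pa) + c *\<^sub>R v"
    by (rule boundary_cell[OF P t ab(2,3) cf v p0 pq(1) l0 mp]) (assumption, rule that)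
  obtain \<rho>' qa qb where \<rho>': "\<rho>' \<in> X" "aff_dim \<rho>' = 1" "\<rho>' \<subseteq> P" "(q, t) \<in> \<rho>'" "(qa, a) \<in> \<rho>'" "(qb, b) \<in> \<rho>'"
    and side': "\<And>y. y \<in> P \<Longrightarrow> \<exists>c\<ge>0. fst y = qa + ((snd y - a) / (b - a)) *\<^sub>R (qb - qa) + c *\<^sub>R - v"
    by (rule boundary_cell[OF P t ab(2,3) cf mv q0 pq(2) l0 mq]) (assumption, rule that)
  have uniq: "x = x'" if h: "(x, u) \<in> \<sigma>" "(x', u) \<in> \<sigma>" "aff_dim \<sigma> = 1" "slice \<sigma> a \<noteq> {}" "slice \<sigma> b \<noteq> {}" for x x' u \<sigma>
  proof -
    obtain ya yb where "(ya, a) \<in> \<sigma>" "(yb, b) \<in> \<sigma>" using h(4,5) by (auto simp: slice_def)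
    from line_level[OF h(3) this _ h(1)] line_level[OF h(3) this _ h(2)] ab(1)
    show ?thesis by simp
  qed
  have sl: "slice \<rho> a \<noteq> {}" "slice \<rho> b \<noteq> {}" "slice \<rho>' a \<noteq> {}" "slice \<rho>' b \<noteq> {}"
    using \<rho> \<rho>' by (auto simp: slice_def)
  \<comment> \<open>\<open>side\<close> bounds the slice in one direction and \<open>side'\<close>
    in the other, so it is the segment between the two walls.\<close>
  have seg: "\<exists>l\<ge>0. y' = y + l *\<^sub>R v \<and> slice P u = closed_segment y (y + l *\<^sub>R v)"
    if yy: "(y, u) \<in> \<rho>" "(y', u) \<in> \<rho>'" and u: "a \<le> u" "u \<le> b" for y y' u
  proof -
    have yP: "(y, u) \<in> P" "(y', u) \<in> P" using yy \<rho>(3) \<rho>'(3) by auto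
    have ey: "pa + ((u - a) / (b - a)) *\<^sub>R (pb - pa) = y"
      using line_level[OF \<rho>(2,5,6) _ yy(1)] ab by simp
    have ey': "qa + ((u - a) / (b - a)) *\<^sub>R (qb - qa) = y'"
      using line_level[OF \<rho>'(2,5,6) _ yy(2)] ab by simp
    have s1: "\<exists>c\<ge>0. z = y + c *\<^sub>R v" if "(z, u) \<in> P" for z using side[OF that] by (simp add: ey)
    have s2: "\<exists>c\<ge>0. z = y' - c *\<^sub>R v" if "(z, u) \<in> P" for z using side'[OF that] by (simp add: ey')
    obtain l where l: "0 \<le> l" "y' = y + l *\<^sub>R v" using s1[OF yP(2)] by blast
    have "slice P u = closed_segment y (y + l *\<^sub>R v)"
    proof (intro equalityI subsetI)
      fix z assume "z \<in> slice P u"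
      then have z: "(z, u) \<in> P" by (simp add: slice_def)
      obtain c c' where c: "0 \<le> c" "z = y + c *\<^sub>R v" "0 \<le> c'" "z = y' - c' *\<^sub>R v"
        using s1[OF z] s2[OF z] by blast
      have "(c + c') *\<^sub>R v = (y + c *\<^sub>R v) - (y' - c' *\<^sub>R v) + l *\<^sub>R v"
        by (simp add: l(2) scaleR_add_left)
      also have "\<dots> = l *\<^sub>R v" using c(2,4) by simp
      finally have "c + c' = l" using v(2) by simp
      then show "z \<in> closed_segment y (y + l *\<^sub>R v)"
        unfolding closed_segment_param[OF l(1)] using c by auto
    next
      fix z assume "z \<in> closed_segment y (y + l *\<^sub>R v)"
      then show "z \<in> slice P u"
        using closed_segment_subset[OF _ _ convex_slice[OF PX(1), of u], of y "y + l *\<^sub>R v"] yP l(2)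
        by (auto simp: slice_def)
    qed
    then show ?thesis using l by blast
  qed
  obtain la where la: "0 \<le> la" "qa = pa + la *\<^sub>R v" "slice P a = closed_segment pa (pa + la *\<^sub>R v)"
    using seg[OF \<rho>(5) \<rho>'(5)] ab by auto
  obtain lb where lb: "0 \<le> lb" "qb = pb + lb *\<^sub>R v" "slice P b = closed_segment pb (pb + lb *\<^sub>R v)"
    using seg[OF \<rho>(6) \<rho>'(6)] ab by auto
  have ne\<rho>: "\<rho> \<noteq> \<rho>'"
  proof
    assume "\<rho> = \<rho>'"
    then have "p = q" using uniq[OF \<rho>(4) _ \<rho>(2) sl(1,2), of q] \<rho>'(4) by simp
    then show False using l0 v(2) by (simp add: q_def)
  qed
  have lab: "0 < la + lb"
  proof (rule ccontr)
    assume "\<not> 0 < la + lb"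
    then have "qa = pa" "qb = pb" using la lb by auto
    then have "p = q"
      using line_level[OF \<rho>(2,5,6) _ \<rho>(4)] line_level[OF \<rho>'(2,5,6) _ \<rho>'(4)] ab by simp
    then show False using l0 v(2) by (simp add: q_def)
  qed
  \<comment> \<open>At level t a further side would pass through p, q or the interior of the slice.
    In the first two cases it shares with \<rho> or \<rho>' a face that reaches both levels and so
    equals it; in the last case, being a face of P, it contains both p and q, two points at one
    level.\<close>
  have only: "\<sigma> = \<rho> \<or> \<sigma> = \<rho>'"
    if \<sigma>: "\<sigma> \<in> X" "aff_dim \<sigma> = 1" "\<sigma> \<subseteq> P" "slice \<sigma> a \<noteq> {}" "slice \<sigma> b \<noteq> {}" for \<sigma>
  proof -
    have eqI: "\<sigma> = \<theta>" if \<theta>: "\<theta> \<in> X" "aff_dim \<theta> = 1" "z \<in> \<sigma>" "z \<in> \<theta>" "snd z = t" for \<theta> z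
    proof -
      have F: "\<sigma> \<inter> \<theta> face_of \<sigma>" "\<sigma> \<inter> \<theta> face_of \<theta>" using inter[OF \<sigma>(1) \<theta>(1)] inter[OF \<theta>(1) \<sigma>(1)] by (simp_all add: Int_commute)
      have "ereal t < len" using t ab(3) by (metis less_ereal.simps(1) order_less_le_trans)
      then have FX: "\<sigma> \<inter> \<theta> \<in> X" using face[OF \<sigma>(1) F(1), of z] \<theta> t ab(2) by simp
      have "slice (\<sigma> \<inter> \<theta>) a \<noteq> {}" "slice (\<sigma> \<inter> \<theta>) b \<noteq> {}"
        using slices_nonempty[OF FX, of z a b] \<theta> t ab cf by auto
      then show ?thesis
        using face_eq_of_slices[OF \<sigma>(1,2) F(1)] face_eq_of_slices[OF \<theta>(1,2) F(2)] ab(1) by blast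
    qed
    obtain ya yb where y: "(ya, a) \<in> \<sigma>" "(yb, b) \<in> \<sigma>" using \<sigma>(4,5) by (auto simp: slice_def)
    obtain z where z: "(z, t) \<in> \<sigma>" using convex_level[OF convex_cell[OF \<sigma>(1)] y, of t] t by auto
    then have "z \<in> closed_segment p (p + l *\<^sub>R v)" using \<sigma>(3) pl(2) by (auto simp: slice_def)
    then obtain s where s: "0 \<le> s" "s \<le> l" "z = p + s *\<^sub>R v" using closed_segment_param[OF pl(1), of p v] by auto
    consider "s = 0" | "s = l" | "0 < s" "s < l" using s by linarith
    then show ?thesis
    proof cases
      case 1
      then show ?thesis using eqI[OF \<rho>(1,2) z] \<rho>(4) s by simp
    next
      case 2
      then show ?thesis using eqI[OF \<rho>'(1,2) z] \<rho>'(4) s by (simp add: q_def)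
    next
      case 3
      have "\<sigma> face_of P" using inter[OF PX(1) \<sigma>(1)] \<sigma>(3) by (simp add: Int_absorb1)
      moreover have "(z, t) \<in> open_segment (p, t) (q, t)"
      proof -
        have "(z, t) = (1 - s / l) *\<^sub>R (p, t) + (s / l) *\<^sub>R (q, t)"
          using l0 s by (simp add: q_def algebra_simps)
        moreover have "0 < s / l" "s / l < 1" using 3 l0 by auto
        moreover have "(p, t) \<noteq> (q, t)" using l0 v(2) by (simp add: q_def)
        ultimately show ?thesis by (auto simp: in_segment)
      qed
      ultimately have "(p, t) \<in> \<sigma>" "(q, t) \<in> \<sigma>" using z p0 q0 unfolding face_of_def by blast+
      then have "p = q" using uniq[OF _ _ \<sigma>(2,4,5)] by blast
      then show ?thesis using l0 v(2) by (simp add: q_def)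
    qed
  qed
  show thesis
    by (rule that[OF \<rho>(1,2,3,5,6) \<rho>'(1-3) _ _ la(1) lb(1) lab ne\<rho> _ _ only])
      (use \<rho>' la lb v_def in auto)
qed

end

section \<open>Constancy between critical levels\<close>

text \<open>Meant for flags: a 1-cell and a 2-cell containing it move together.\<close>

definition pair_translates :: "'a::ab_group_add set \<Rightarrow> 'a set \<times> 'a set \<Rightarrow> 'a set \<times> 'a set \<Rightarrow> bool" where
  "pair_translates G p q \<longleftrightarrow> (\<exists>\<gamma>\<in>G. q = ((+) \<gamma> ` fst p, (+) \<gamma> ` snd p))"

lemma equivp_pair_translates:
  assumes "add_subgroup G"
  shows "equivp (pair_translates G)"
proof (rule equivpI)
  show "reflp (pair_translates G)"
    using add_subgroupD(1)[OF assms] by (auto simp: reflp_def pair_translates_def intro!: bexI[of _ 0])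
  show "symp (pair_translates G)"
  proof (rule sympI)
    fix p q assume "pair_translates G p q"
    then obtain a where "a \<in> G" "q = ((+) a ` fst p, (+) a ` snd p)"
      unfolding pair_translates_def by (elim bexE)
    then have "p = ((+) (- a) ` fst q, (+) (- a) ` snd q)" "- a \<in> G"
      using add_subgroupD[OF assms] translate_uminus[of a] by auto
    then show "pair_translates G q p" unfolding pair_translates_def by blast
  qed
  show "transp (pair_translates G)"
  proof (rule transpI)
    fix p q s assume "pair_translates G p q" "pair_translates G q s"
    then obtain a b where "a \<in> G" "q = ((+) a ` fst p, (+) a ` snd p)" "b \<in> G" "s = ((+) b ` fst q, (+) b ` snd q)"
      unfolding pair_translates_def by (elim bexE)
    then have "s = ((+) (b + a) ` fst p, (+) (b + a) ` snd p)" "b + a \<in> G"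
      using add_subgroupD[OF assms] by (simp_all add: translate_translate)
    then show "pair_translates G p s" unfolding pair_translates_def by blast
  qed
qed

text \<open>Representatives can be pulled back along an equivariant map because the action on the
  target is free: two elements of one orbit with the same image coincide.\<close>

lemma transversal_equivariant:
  fixes \<pi> :: "'y \<Rightarrow> 'a::ab_group_add set"
  assumes G: "add_subgroup G" and R: "transversal (translates G) Z R"
    and \<pi>: "\<And>\<gamma> y. \<pi> (act \<gamma> y) = (+) \<gamma> ` \<pi> y"
    and Y: "\<And>y. y \<in> Y \<Longrightarrow> \<pi> y \<in> Z" "\<And>y \<gamma>. y \<in> Y \<Longrightarrow> \<gamma> \<in> G \<Longrightarrow> act \<gamma> y \<in> Y"
    and free: "\<And>P \<gamma>. P \<in> Z \<Longrightarrow> \<gamma> \<in> G \<Longrightarrow> (+) \<gamma> ` P = P \<Longrightarrow> \<gamma> = 0"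
  shows "transversal (\<lambda>y y'. \<exists>\<gamma>\<in>G. y' = act \<gamma> y) Y {y \<in> Y. \<pi> y \<in> R}"
  unfolding transversal_def
proof (intro conjI ballI)
  fix y assume y: "y \<in> Y"
  note E = equivp_translates[OF G]
  obtain P where P: "P \<in> R" "translates G (\<pi> y) P" using transversal_ex1[OF R Y(1)[OF y]] by (elim ex1E conjE)
  obtain \<gamma> where \<gamma>: "\<gamma> \<in> G" "P = (+) \<gamma> ` \<pi> y" using P(2) unfolding translates_def by (elim bexE)
  show "\<exists>!q. q \<in> {y \<in> Y. \<pi> y \<in> R} \<and> (\<exists>\<gamma>\<in>G. q = act \<gamma> y)"
  proof (rule ex1I[of _ "act \<gamma> y"])
    show "act \<gamma> y \<in> {y \<in> Y. \<pi> y \<in> R} \<and> (\<exists>\<gamma>'\<in>G. act \<gamma> y = act \<gamma>' y)"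
      using Y(2)[OF y \<gamma>(1)] P(1) \<gamma> by (auto simp: \<pi>)
    fix q assume q: "q \<in> {y \<in> Y. \<pi> y \<in> R} \<and> (\<exists>\<gamma>\<in>G. q = act \<gamma> y)"
    then obtain \<gamma>' where \<gamma>': "\<gamma>' \<in> G" "q = act \<gamma>' y" by (elim conjE bexE)
    have "\<pi> q \<in> R" "translates G (\<pi> y) (\<pi> q)"
      using q \<gamma>' unfolding translates_def by (auto simp: \<pi>)
    then have "\<pi> q = P" using P by (intro ex1_unique[OF transversal_ex1[OF R Y(1)[OF y]]]) auto
    then have "(+) \<gamma>' ` \<pi> y = (+) \<gamma> ` \<pi> y" using \<gamma>' \<gamma> by (simp add: \<pi>)
    then have "(+) (- \<gamma>) ` (+) \<gamma>' ` \<pi> y = (+) (- \<gamma>) ` (+) \<gamma> ` \<pi> y" by simp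
    then have "(+) (\<gamma>' - \<gamma>) ` \<pi> y = \<pi> y" unfolding translate_uminus translate_translate by simp
    then have "\<gamma>' - \<gamma> = 0" using free[OF Y(1)[OF y]] add_subgroupD(2)[OF G \<gamma>'(1) \<gamma>(1)] by blast
    then show "q = act \<gamma> y" using \<gamma>' by simp
  qed
qed auto

lemma transversal_pairs:
  fixes \<pi> :: "'a::ab_group_add set \<times> 'a set \<Rightarrow> 'a set"
  assumes G: "add_subgroup G" and R: "transversal (translates G) Z R"
    and \<pi>: "\<And>\<gamma> p. \<pi> ((+) \<gamma> ` fst p, (+) \<gamma> ` snd p) = (+) \<gamma> ` \<pi> p"
    and Y: "\<And>y \<gamma>. y \<in> Y \<Longrightarrow> \<gamma> \<in> G \<Longrightarrow> ((+) \<gamma> ` fst y, (+) \<gamma> ` snd y) \<in> Y" "\<And>y. y \<in> Y \<Longrightarrow> \<pi> y \<in> Z"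
    and free: "\<And>P \<gamma>. P \<in> Z \<Longrightarrow> \<gamma> \<in> G \<Longrightarrow> (+) \<gamma> ` P = P \<Longrightarrow> \<gamma> = 0"
  shows "transversal (pair_translates G) Y {y \<in> Y. \<pi> y \<in> R}"
proof -
  have "pair_translates G = (\<lambda>p q. \<exists>\<gamma>\<in>G. q = ((+) \<gamma> ` fst p, (+) \<gamma> ` snd p))"
    by (intro ext) (simp add: pair_translates_def)
  then show ?thesis
    using transversal_equivariant[OF G R, where \<pi> = \<pi> and Y = Y and act = "\<lambda>\<gamma> p. ((+) \<gamma> ` fst p, (+) \<gamma> ` snd p)",
        OF \<pi> Y(2) Y(1) free] by simp
qed

text \<open>A primitive normal leads from a point of F into P, so the sign in
  \<open>face_one_sided\<close> is +1. It is not parallel to F, as otherwise the lattice of P, which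
  it generates together with that of F, would not span the direction of P.\<close>

lemma normal_side:
  fixes P :: "((real ^ 'g) \<times> real) set"
  assumes P: "polyhedron P" "aff_dim P = 2" "rational_slope edge_lattice P"
    and F: "F face_of P" "aff_dim F = 1" and n: "primitive_normal edge_lattice F P n"
  shows "n \<in> direction P" "n \<notin> direction F"
    "\<And>y z. y \<in> P \<Longrightarrow> z \<in> F \<Longrightarrow> \<exists>c\<ge>0. y - z - c *\<^sub>R n \<in> direction F"
proof -
  have nL: "n \<in> cell_lattice edge_lattice P" and
    gen: "\<And>u. u \<in> cell_lattice edge_lattice P \<Longrightarrow> \<exists>j::int. u - of_int j *\<^sub>R n \<in> cell_lattice edge_lattice F"
    and ptd: "\<exists>x\<in>F. \<exists>\<epsilon>>0. x + \<epsilon> *\<^sub>R n \<in> P"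
    using n unfolding primitive_normal_def by blast+
  show nP: "n \<in> direction P" using nL by (simp add: cell_lattice_def)
  show nF: "n \<notin> direction F"
  proof
    assume nF: "n \<in> direction F"
    have "cell_lattice edge_lattice P \<subseteq> direction F"
    proof
      fix u assume "u \<in> cell_lattice edge_lattice P"
      then obtain j :: int where "u - of_int j *\<^sub>R n \<in> cell_lattice edge_lattice F" using gen by blast
      then have "u - of_int j *\<^sub>R n \<in> direction F" by (simp add: cell_lattice_def)
      then have "(u - of_int j *\<^sub>R n) + of_int j *\<^sub>R n \<in> direction F"
        by (intro subspace_add subspace_scale subspace_direction nF)
      then show "u \<in> direction F" by simp
    qed
    then have "direction P \<subseteq> direction F"
      using P(3) span_minimal[OF _ subspace_direction] unfolding rational_slope_def by metis
    then have "dim (direction P) \<le> dim (direction F)" by (rule dim_subset)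
    then show False using dim_direction(2)[OF P(2)] dim_direction(1)[OF F(2)] by simp
  qed
  fix y z assume y: "y \<in> P" and z: "z \<in> F"
  obtain s :: real where s: "s = 1 \<or> s = -1"
    "\<And>y. y \<in> P \<Longrightarrow> \<exists>c. 0 \<le> s * c \<and> y - z - c *\<^sub>R n \<in> direction F"
    by (rule face_one_sided[OF P(1,2) F z nP nF]) (assumption | rule that)+
  obtain x \<epsilon> where x: "x \<in> F" "0 < \<epsilon>" "x + \<epsilon> *\<^sub>R n \<in> P" using ptd by blast
  obtain c where c: "0 \<le> s * c" "x + \<epsilon> *\<^sub>R n - z - c *\<^sub>R n \<in> direction F" using s(2)[OF x(3)] by blast
  have "(x + \<epsilon> *\<^sub>R n - z - c *\<^sub>R n) - (x - z) \<in> direction F"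
    by (intro subspace_diff subspace_direction c(2) direction_diff x(1) z)
  then have *: "(\<epsilon> - c) *\<^sub>R n \<in> direction F" by (simp add: algebra_simps)
  have "\<epsilon> - c = 0"
  proof (rule ccontr)
    assume "\<epsilon> - c \<noteq> 0"
    then have "n = (1 / (\<epsilon> - c)) *\<^sub>R (\<epsilon> - c) *\<^sub>R n" by simp
    then have "n \<in> direction F" using subspace_scale[OF subspace_direction *] by metis
    then show False using nF by simp
  qed
  then have "s = 1" using c(1) x(2) s(1) by auto
  then show "\<exists>c\<ge>0. y - z - c *\<^sub>R n \<in> direction F" using s(2)[OF y] by auto
qed

section \<open>Moving a segment within a family\<close>

context tropical_torus
begin

text \<open>The period by which the lift \<open>r p'\<close> misses the lift \<open>r p\<close>
  carried along from p to p': r p' = r p + (p' - p) + lift_drift p p'.\<close>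

definition lift_drift :: "real ^ 'g \<Rightarrow> real ^ 'g \<Rightarrow> real ^ 'g" where
  "lift_drift p p' = (r p' - p') - (r p - p)"

text \<open>
  The contribution of a 1-cell of a family that passes through \<open>p\<close> and \<open>p'\<close> in two fibres.
\<close>

definition J :: "real ^ 'g \<Rightarrow> real ^ 'g \<Rightarrow> real ^ 'g \<Rightarrow> real" where
  "J p p' v = \<Omega> (r p + lift_drift p p') (p' - p) v + \<Omega> (lift_drift p p') (r p) v"

lemma lift_drift_mem: "lift_drift p p' \<in> \<Gamma>"
  unfolding lift_drift_def by (intro add_subgroupD(2)[OF \<Gamma>] r_mem)

lemma J_translate: "\<gamma> \<in> \<Gamma> \<Longrightarrow> J (p + \<gamma>) (p' + \<gamma>) v = J p p' v"
proof -
  assume "\<gamma> \<in> \<Gamma>"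
  moreover from this have "lift_drift (p + \<gamma>) (p' + \<gamma>) = lift_drift p p'"
    by (simp add: lift_drift_def r_inv)
  ultimately show ?thesis by (simp add: J_def r_inv)
qed

lemma J_sum: "J p p' (\<Sum>i\<in>I. c i *\<^sub>R f i) = (\<Sum>i\<in>I. c i * J p p' (f i))"
proof (induction I rule: infinite_finite_induct)
  case (insert i I)
  then show ?case by (simp add: J_def \<Omega>_linear algebra_simps)
qed (simp_all add: J_def)

text \<open>\<open>J\<close> is made for this. Modulo values on two periods, the change of the value
  splits into one term for the path of each end. The identity uses that the ends of both segments
  differ by a multiple of the same v.\<close>

lemma segment_transport:
  assumes v: "v \<in> int_vectors"
  shows "(K v p - K v (p + l *\<^sub>R v)) - (K v p' - K v (p' + l' *\<^sub>R v))
    + (J p p' v - J (p + l *\<^sub>R v) (p' + l' *\<^sub>R v) v) \<in> M"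
proof -
  define q where "q = p + l *\<^sub>R v"
  define q' where "q' = p' + l' *\<^sub>R v"
  define g where "g = lift_drift p p'"
  define h where "h = lift_drift q q'"
  have gh: "g \<in> \<Gamma>" "h \<in> \<Gamma>" by (simp_all add: g_def h_def lift_drift_mem)
  have rp': "r p' = r p + (p' - p) + g" by (simp add: g_def lift_drift_def)
  have rq': "r q' = r q + (q' - q) + h" by (simp add: h_def lift_drift_def)
  have "\<Omega> (r p - r q) p v - \<Omega> (r p' - r q') p' v + (J p p' v - J q q' v)
      = \<Omega> g (r p - p) v - \<Omega> h (r q - q) v"
    unfolding J_def g_def[symmetric] h_def[symmetric] rp' rq'
    unfolding q_def[unfolded atomize_eq] q'_def by (simp add: \<Omega>_linear algebra_simps)
  moreover have "\<Omega> g (r p - p) v - \<Omega> h (r q - q) v \<in> M"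
    by (intro add_subgroupD(2)[OF M] period gh r_mem v)
  ultimately have 1: "\<Omega> (r p - r q) p v - \<Omega> (r p' - r q') p' v + (J p p' v - J q q' v) \<in> M" by simp
  have 2: "(K v p - K v q - \<Omega> (r p - r q) p v) - (K v p' - K v q' - \<Omega> (r p' - r q') p' v) \<in> M"
    unfolding q_def q'_def by (intro add_subgroupD(2)[OF M] K_diff v)
  from add_subgroupD(4)[OF M 2 1] show ?thesis unfolding q_def q'_def by (simp add: algebra_simps)
qed

end

section \<open>Balancing along the sides of the 2-cells\<close>

context edge_complex
begin

abbreviation shift :: "real ^ 'g \<Rightarrow> ((real ^ 'g) \<times> real) set \<Rightarrow> ((real ^ 'g) \<times> real) set" where
  "shift \<gamma> P \<equiv> (+) (\<gamma>, 0) ` P"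

abbreviation (input) G :: "((real ^ 'g) \<times> real) set" where "G \<equiv> \<Gamma> \<times> {0}"

lemma G: "add_subgroup G" by (rule add_subgroup_times_zero[OF \<Gamma>])

lemma shift: "P \<in> X \<Longrightarrow> \<gamma> \<in> \<Gamma> \<Longrightarrow> shift \<gamma> P \<in> X" "P \<in> X \<Longrightarrow> \<gamma> \<in> \<Gamma> \<Longrightarrow> w (shift \<gamma> P) = w P"
  using periodic unfolding periodic_finite_def by auto

lemma shift_free: "P \<in> X \<Longrightarrow> \<gamma> \<in> \<Gamma> \<Longrightarrow> shift \<gamma> P = P \<Longrightarrow> \<gamma> = 0"
proof -
  assume P: "P \<in> X" and eq: "shift \<gamma> P = P"
  have "(+) \<gamma> ` fst ` P = fst ` shift \<gamma> P" by (simp add: image_image)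
  then show "\<gamma> = 0" using cell[OF P] bounded_translate_fixed[of "fst ` P" \<gamma>] eq by auto
qed

lemma translate_free: "P \<in> X \<Longrightarrow> \<gamma> \<in> G \<Longrightarrow> (+) \<gamma> ` P = P \<Longrightarrow> \<gamma> = 0"
  using shift_free[of P "fst \<gamma>"] by (auto simp: zero_prod_def)

lemma aff_dim_shift [simp]: "aff_dim (shift \<gamma> P) = aff_dim P"
  by (rule aff_dim_translation_eq)

lemma shift_cells2: "P \<in> cells2 \<Longrightarrow> \<gamma> \<in> \<Gamma> \<Longrightarrow> shift \<gamma> P \<in> cells2"
  using shift(1) by (simp add: cells2_def)

lemma lvec_shift [simp]: "lvec (shift \<gamma> P) = lvec P"
  by (simp add: lvec_def direction_translate)

lemma mem_shift: "(x, t) \<in> shift \<gamma> P \<longleftrightarrow> (x - \<gamma>, t) \<in> P"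
  by (force intro: image_eqI[of _ _ "(x - \<gamma>, t)"])

definition wm :: "((real ^ 'g) \<times> real) set \<Rightarrow> int" where
  "wm P = w P * fibre_index P"

lemma wm_shift: "P \<in> X \<Longrightarrow> \<gamma> \<in> \<Gamma> \<Longrightarrow> wm (shift \<gamma> P) = wm P"
  by (simp add: wm_def shift fibre_index_translate)

text \<open>
  The sign \<open>s\<close> selects the 2-cells that reach into the fibres over the levels next to \<open>t\<close>, above
  for \<open>s = 1\<close> and below for \<open>s = -1\<close>; \<open>fibre_value\<close> is a one-sided limit of values of fibres.
\<close>

definition active :: "((real ^ 'g) \<times> real) set \<Rightarrow> real \<Rightarrow> real \<Rightarrow> bool" where
  "active P t s \<longleftrightarrow> slice P t \<noteq> {} \<and> (\<exists>y\<in>P. 0 < s * (snd y - t))"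

lemma active_shift [simp]: "active (shift \<gamma> P) t s \<longleftrightarrow> active P t s"
  by (auto simp: active_def slice_translate)

text \<open>Fixed once for all levels, so that the values of all fibres are sums over subsets of one
  finite set.\<close>

definition reps :: "((real ^ 'g) \<times> real) set set" where
  "reps = (SOME R. finite R \<and> transversal (translates G) cells2 R)"

lemma reps: "finite reps" "transversal (translates G) cells2 reps"
proof -
  obtain R where "finite R" "transversal (translates G) cells2 R"
    by (rule periodic_finite_transversal[OF G periodic, of cells2])
      (use shift_cells2 in \<open>auto simp: cells2_def\<close>)
  then have "finite reps \<and> transversal (translates G) cells2 reps"
    unfolding reps_def by (intro someI[of "\<lambda>R. finite R \<and> transversal (translates G) cells2 R"]) simp
  then show "finite reps" "transversal (translates G) cells2 reps" by blast+
qed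

lemma reps_cells2: "P \<in> reps \<Longrightarrow> P \<in> cells2"
  using transversal_subset[OF reps(2)] by blast

definition fibre_value :: "real \<Rightarrow> real \<Rightarrow> real" where
  "fibre_value t s = (\<Sum>P | P \<in> reps \<and> active P t s. of_int (wm P) * segment_value (slice P t))"

definition spans :: "real \<Rightarrow> real \<Rightarrow> ((real ^ 'g) \<times> real) set \<Rightarrow> bool" where
  "spans a b P \<longleftrightarrow> slice P a \<noteq> {} \<and> slice P b \<noteq> {}"

lemma spans_shift [simp]: "spans a b (shift \<gamma> P) \<longleftrightarrow> spans a b P"
  by (simp add: spans_def slice_translate)

text \<open>No cell begins or ends strictly between a and b, so entering the interval at one end
  means crossing it.\<close>

lemma active_iff_spans:
  assumes P: "P \<in> X" and ab: "a < b" "0 \<le> a" "ereal b \<le> len" and cf: "crit_free a b"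
  shows "active P a 1 \<longleftrightarrow> spans a b P" "active P b (-1) \<longleftrightarrow> spans a b P"
proof -
  have "active P a 1 \<and> active P b (-1)" if h: "spans a b P"
  proof -
    obtain xa xb where "(xa, a) \<in> P" "(xb, b) \<in> P" using h by (auto simp: spans_def slice_def)
    then show ?thesis using ab h unfolding active_def spans_def by force
  qed
  moreover have "spans a b P" if h: "active P a 1"
  proof -
    obtain x y where xy: "(x, a) \<in> P" "y \<in> P" "a < snd y" using h by (auto simp: active_def slice_def)
    have "slice P b \<noteq> {}"
    proof (cases "snd y < b")
      case True
      then show ?thesis using slices_nonempty[OF P xy(2,3) True ab(2,3) cf] by blast
    next
      case False
      then show ?thesis
        using convex_level[OF convex_cell[OF P] xy(1), of "fst y" "snd y" b] xy ab by (auto simp: slice_def)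
    qed
    then show ?thesis using xy(1) by (auto simp: spans_def slice_def)
  qed
  moreover have "spans a b P" if h: "active P b (-1)"
  proof -
    obtain x y where xy: "(x, b) \<in> P" "y \<in> P" "snd y < b" using h by (auto simp: active_def slice_def)
    have "slice P a \<noteq> {}"
    proof (cases "a < snd y")
      case True
      then show ?thesis using slices_nonempty[OF P xy(2) True xy(3) ab(2,3) cf] by blast
    next
      case False
      then show ?thesis
        using convex_level[OF convex_cell[OF P] _ xy(1), of "fst y" "snd y" a] xy ab by (auto simp: slice_def)
    qed
    then show ?thesis using xy(1) by (auto simp: spans_def slice_def)
  qed
  ultimately show "active P a 1 \<longleftrightarrow> spans a b P" "active P b (-1) \<longleftrightarrow> spans a b P" by blast+
qed

definition pt :: "((real ^ 'g) \<times> real) set \<Rightarrow> real \<Rightarrow> real ^ 'g" where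
  "pt \<rho> t = (THE x. (x, t) \<in> \<rho>)"

lemma pt_eq:
  assumes "aff_dim \<rho> = 1" "spans a b \<rho>" "a \<noteq> b" "(x, t) \<in> \<rho>"
  shows "pt \<rho> t = x"
proof -
  obtain xa xb where *: "(xa, a) \<in> \<rho>" "(xb, b) \<in> \<rho>" using assms(2) by (auto simp: spans_def slice_def)
  show ?thesis
    unfolding pt_def
  proof (rule the_equality)
    show "(x, t) \<in> \<rho>" by (rule assms(4))
    fix x' assume "(x', t) \<in> \<rho>"
    from line_level[OF assms(1) * assms(3) this] line_level[OF assms(1) * assms(3,4)] show "x' = x" by simp
  qed
qed

lemma pt_mem:
  assumes "aff_dim \<rho> = 1" "spans a b \<rho>" "a \<noteq> b"
  shows "(pt \<rho> a, a) \<in> \<rho>" "(pt \<rho> b, b) \<in> \<rho>"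
proof -
  obtain xa xb where "(xa, a) \<in> \<rho>" "(xb, b) \<in> \<rho>" using assms(2) by (auto simp: spans_def slice_def)
  then show "(pt \<rho> a, a) \<in> \<rho>" "(pt \<rho> b, b) \<in> \<rho>" using pt_eq[OF assms] by metis+
qed

lemma pt_shift:
  assumes "aff_dim \<rho> = 1" "spans a b \<rho>" "a \<noteq> b"
  shows "pt (shift \<gamma> \<rho>) a = pt \<rho> a + \<gamma>" "pt (shift \<gamma> \<rho>) b = pt \<rho> b + \<gamma>"
  using assms pt_mem[OF assms] by (auto intro!: pt_eq[where a = a and b = b] simp: mem_shift)

text \<open>The sign that tells whether P extends from \<rho> along \<open>lvec P\<close> or against
  it. Both levels are tested, because at one of them the slice of P may be a point.\<close>

definition side :: "real \<Rightarrow> real \<Rightarrow> ((real ^ 'g) \<times> real) set \<Rightarrow> ((real ^ 'g) \<times> real) set \<Rightarrow> int" where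
  "side a b \<rho> P = (if \<exists>x c. 0 < c \<and> ((x, a) \<in> \<rho> \<and> (x + c *\<^sub>R lvec P, a) \<in> P \<or>
     (x, b) \<in> \<rho> \<and> (x + c *\<^sub>R lvec P, b) \<in> P) then 1 else - 1)"

lemma side_shift: "side a b (shift \<gamma> \<rho>) (shift \<gamma> P) = side a b \<rho> P"
proof -
  have "(\<exists>x c. 0 < c \<and> ((x - \<gamma>, a) \<in> \<rho> \<and> (x + c *\<^sub>R lvec P - \<gamma>, a) \<in> P \<or>
      (x - \<gamma>, b) \<in> \<rho> \<and> (x + c *\<^sub>R lvec P - \<gamma>, b) \<in> P)) \<longleftrightarrow>
    (\<exists>x c. 0 < c \<and> ((x, a) \<in> \<rho> \<and> (x + c *\<^sub>R lvec P, a) \<in> P \<or>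
      (x, b) \<in> \<rho> \<and> (x + c *\<^sub>R lvec P, b) \<in> P))" (is "(\<exists>x. ?A x) \<longleftrightarrow> (\<exists>x. ?B x)")
  proof -
    have 1: "?A x \<Longrightarrow> ?B (x - \<gamma>)" for x by (simp add: algebra_simps)
    have 2: "?B x \<Longrightarrow> ?A (x + \<gamma>)" for x by (simp add: algebra_simps)
    show ?thesis by (rule iffI; erule exE) (rule exI, erule 1, rule exI, erule 2)
  qed
  then show ?thesis by (simp add: side_def mem_shift)
qed

definition walls :: "real \<Rightarrow> real \<Rightarrow> ((real ^ 'g) \<times> real) set \<Rightarrow> ((real ^ 'g) \<times> real) set set" where
  "walls a b P = {\<rho> \<in> X. aff_dim \<rho> = 1 \<and> \<rho> \<subseteq> P \<and> spans a b \<rho>}"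

lemma polygon_walls:
  assumes P: "P \<in> cells2" and ab: "a < b" "0 \<le> a" "ereal b \<le> len" and cf: "crit_free a b"
    and sp: "spans a b P"
  obtains \<rho> \<rho>' la lb where "walls a b P = {\<rho>, \<rho>'}" "\<rho> \<noteq> \<rho>'" "side a b \<rho> P = 1" "side a b \<rho>' P = - 1"
    "0 \<le> la" "0 \<le> lb" "0 < la + lb"
    "pt \<rho>' a = pt \<rho> a + la *\<^sub>R lvec P" "pt \<rho>' b = pt \<rho> b + lb *\<^sub>R lvec P"
    "slice P a = closed_segment (pt \<rho> a) (pt \<rho> a + la *\<^sub>R lvec P)"
    "slice P b = closed_segment (pt \<rho> b) (pt \<rho> b + lb *\<^sub>R lvec P)"
proof -
  have sp': "slice P a \<noteq> {}" "slice P b \<noteq> {}" using sp by (simp_all add: spans_def)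
  obtain \<rho> \<rho>' pa pb la lb where
    \<rho>: "\<rho> \<in> X" "aff_dim \<rho> = 1" "\<rho> \<subseteq> P" "(pa, a) \<in> \<rho>" "(pb, b) \<in> \<rho>" and
    \<rho>': "\<rho>' \<in> X" "aff_dim \<rho>' = 1" "\<rho>' \<subseteq> P" "(pa + la *\<^sub>R lvec P, a) \<in> \<rho>'" "(pb + lb *\<^sub>R lvec P, b) \<in> \<rho>'" and
    l: "0 \<le> la" "0 \<le> lb" "0 < la + lb" "\<rho> \<noteq> \<rho>'" and
    sl: "slice P a = closed_segment pa (pa + la *\<^sub>R lvec P)" "slice P b = closed_segment pb (pb + lb *\<^sub>R lvec P)" and
    only: "\<And>\<sigma>. \<sigma> \<in> X \<Longrightarrow> aff_dim \<sigma> = 1 \<Longrightarrow> \<sigma> \<subseteq> P \<Longrightarrow> slice \<sigma> a \<noteq> {} \<Longrightarrow> slice \<sigma> b \<noteq> {} \<Longrightarrow> \<sigma> = \<rho> \<or> \<sigma> = \<rho>'"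
    by (rule polygon[OF P ab cf sp']) (assumption | rule that)+
  have sp\<rho>: "spans a b \<rho>" "spans a b \<rho>'" using \<rho> \<rho>' by (auto simp: spans_def slice_def)
  have pt: "pt \<rho> a = pa" "pt \<rho> b = pb" "pt \<rho>' a = pa + la *\<^sub>R lvec P" "pt \<rho>' b = pb + lb *\<^sub>R lvec P"
    using pt_eq[OF \<rho>(2) sp\<rho>(1)] pt_eq[OF \<rho>'(2) sp\<rho>(2)] \<rho>(4,5) \<rho>'(4,5) ab(1) by auto
  have walls: "walls a b P = {\<rho>, \<rho>'}"
    using \<rho>(1-3) \<rho>'(1-3) sp\<rho> only unfolding walls_def spans_def by blast
  have "side a b \<rho> P = 1"
  proof -
    have "pa + la *\<^sub>R lvec P \<in> slice P a" "pb + lb *\<^sub>R lvec P \<in> slice P b" unfolding sl by simp_all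
    then have "(pa + la *\<^sub>R lvec P, a) \<in> P" "(pb + lb *\<^sub>R lvec P, b) \<in> P" by (simp_all add: slice_def)
    moreover have "0 < la \<or> 0 < lb" using l by linarith
    ultimately show ?thesis using \<rho>(4,5) unfolding side_def by auto
  qed
  moreover have "side a b \<rho>' P = - 1"
  proof -
    \<comment> \<open>The slice has no point beyond its far end, so \<rho>' gets the sign
      -1.\<close>
    have no: False if h: "0 < c" "p + l *\<^sub>R lvec P + c *\<^sub>R lvec P \<in> closed_segment p (p + l *\<^sub>R lvec P)" "0 \<le> l" for p l c
    proof -
      obtain s where s: "s \<le> l" "p + l *\<^sub>R lvec P + c *\<^sub>R lvec P = p + s *\<^sub>R lvec P"
        using h(2) unfolding closed_segment_param[OF h(3)] by blast
      then have "(l + c) *\<^sub>R lvec P = s *\<^sub>R lvec P" by (simp add: scaleR_add_left add.assoc)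
      then have "l + c = s" using lvec_nonzero[OF P] by simp
      then show False using s(1) h(1) by simp
    qed
    have "x = pt \<rho>' a" if "(x, a) \<in> \<rho>'" for x using pt_eq[OF \<rho>'(2) sp\<rho>(2) _ that] ab(1) by simp
    moreover have "x = pt \<rho>' b" if "(x, b) \<in> \<rho>'" for x using pt_eq[OF \<rho>'(2) sp\<rho>(2) _ that] ab(1) by simp
    moreover have "(x, a) \<in> P \<longleftrightarrow> x \<in> slice P a" "(x, b) \<in> P \<longleftrightarrow> x \<in> slice P b" for x by (simp_all add: slice_def)
    ultimately show ?thesis
      using no[of _ pa la] no[of _ pb lb] l(1,2) unfolding side_def sl pt by auto
  qed
  ultimately show thesis
    using that[OF walls l(4) _ _ l(1-3)] pt sl by simp
qed

text \<open>Project V \<times> \<real> along \<rho> to V and scale by the height k of the lattice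
  generator of \<rho>. The balancing condition becomes a relation between horizontal vectors, and by
  \<open>int_span_snd\<close> the normal of P becomes \<open>lvec P\<close> times the fibre index,
  up to a sign that is then identified with \<open>side\<close>.\<close>

lemma wall_balanced:
  assumes \<rho>: "\<rho> \<in> X" "aff_dim \<rho> = 1" and ab: "a < b" "0 \<le> a" "ereal b \<le> len" and cf: "crit_free a b"
    and sp: "spans a b \<rho>"
  shows "(\<Sum>P | P \<in> cells2 \<and> \<rho> \<subseteq> P. of_int (side a b \<rho> P * wm P) *\<^sub>R lvec P) = 0"
proof -
  have star: "{\<tau> \<in> X. aff_dim \<tau> = 2 \<and> \<rho> \<subseteq> \<tau>} = {P. P \<in> cells2 \<and> \<rho> \<subseteq> P}"
    unfolding cells2_def by auto
  obtain n where n: "\<And>P. P \<in> cells2 \<Longrightarrow> \<rho> \<subseteq> P \<Longrightarrow> primitive_normal edge_lattice \<rho> P (n P)"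
    and bal: "(\<Sum>P | P \<in> cells2 \<and> \<rho> \<subseteq> P. of_int (w P) *\<^sub>R n P) \<in> direction \<rho>"
    using balanced[OF \<rho>] unfolding star by blast
  define d where "d = pt \<rho> b - pt \<rho> a"
  have pm: "(pt \<rho> a, a) \<in> \<rho>" "(pt \<rho> b, b) \<in> \<rho>" using pt_mem[OF \<rho>(2) sp] ab(1) by simp_all
  have d: "(d, b - a) \<in> direction \<rho>" using direction_diff[OF pm(2,1)] by (simp add: d_def)
  have rat: "rational_slope edge_lattice \<rho>" using cell[OF \<rho>(1)] by blast
  have ba: "0 < b - a" using ab by simp
  obtain k u c where k: "0 < k" "(u, of_int k) \<in> cell_lattice edge_lattice \<rho>" "0 < c"
    "(u, of_int k) = c *\<^sub>R (d, b - a)"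
    and gen: "\<And>z. z \<in> cell_lattice edge_lattice \<rho> \<Longrightarrow> \<exists>j::int. z = of_int j *\<^sub>R (u, of_int k)"
    by (rule cell_lattice_line[OF \<rho>(2) rat d ba]) (assumption | rule that)+
  define \<kappa> where "\<kappa> z = of_int k *\<^sub>R fst z - snd z *\<^sub>R u" for z :: "(real ^ 'g) \<times> real"
  have lin: "\<kappa> (x + y) = \<kappa> x + \<kappa> y" "\<kappa> (x - y) = \<kappa> x - \<kappa> y" "\<kappa> (s *\<^sub>R x) = s *\<^sub>R \<kappa> x" for x y s
    by (simp_all add: \<kappa>_def algebra_simps)
  have \<kappa>0: "\<kappa> z = 0" if "z \<in> direction \<rho>" for z
  proof -
    have "(d, b - a) \<noteq> 0" using ba by (simp add: zero_prod_def)
    from direction_dim_1[OF \<rho>(2) d this that] obtain e where "z = e *\<^sub>R (d, b - a)" by blast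
    moreover have "\<kappa> (u, of_int k) = 0" by (simp add: \<kappa>_def)
    then have "\<kappa> (d, b - a) = 0" unfolding k(4) lin using k(3) by simp
    ultimately show ?thesis by (simp only: lin scaleR_zero_right)
  qed
  have key: "\<kappa> (n P) = of_int (side a b \<rho> P * fibre_index P) *\<^sub>R lvec P" if P: "P \<in> cells2" "\<rho> \<subseteq> P" for P
  proof -
    have PX: "P \<in> X" "aff_dim P = 2" using P(1) by (auto simp: cells2_def)
    note cP = cell[OF PX(1)]
    have \<rho>F: "\<rho> face_of P" using inter[OF PX(1) \<rho>(1)] P(2) by (simp add: Int_absorb1)
    have spP: "spans a b P" using sp P(2) by (auto simp: spans_def slice_def)
    note pn = n[OF P]
    have poly: "polyhedron P" "rational_slope edge_lattice P" using cP by blast+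
    note ns = normal_side[OF poly(1) PX(2) poly(2) \<rho>F \<rho>(2) pn]
    let ?L = "cell_lattice edge_lattice P"
    have nL: "n P \<in> ?L" using pn by (simp add: primitive_normal_def)
    obtain m :: int where m: "snd (n P) = of_int m" using nL by (auto simp: cell_lattice_def elim: Ints_cases)
    have nP: "n P = (fst (n P), of_int m)" using m by (simp add: prod_eq_iff)
    have vL: "(lvec P, 0) \<in> ?L"
      using lvec[OF P(1)] by (simp add: cell_lattice_def primitive_vec_def)
    have "\<exists>e::int. (e = 1 \<or> e = -1) \<and>
      of_int k *\<^sub>R fst (n P) - of_int m *\<^sub>R u = of_int (e * Gcd {n. \<exists>u\<in>?L. snd u = of_int n}) *\<^sub>R lvec P"
    proof (rule int_span_snd[OF lvec(1)[OF P(1)] vL _ add_subgroup_cell_lattice[OF add_subgroup_edge_lattice] _ k(1)])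
      show "?L \<subseteq> edge_lattice" by (simp add: cell_lattice_def)
      show "(u, real_of_int k) \<in> ?L" using k(2) direction_mono[OF P(2)] by (auto simp: cell_lattice_def)
      show "(fst (n P), real_of_int m) \<in> ?L" using nL nP by simp
      fix z assume "z \<in> ?L"
      then obtain i :: int where "z - of_int i *\<^sub>R n P \<in> cell_lattice edge_lattice \<rho>"
        using pn unfolding primitive_normal_def by blast
      then obtain j :: int where "z - of_int i *\<^sub>R n P = of_int j *\<^sub>R (u, of_int k)" using gen by blast
      then have "z = of_int i *\<^sub>R n P + of_int j *\<^sub>R (u, of_int k)" by (simp add: algebra_simps)
      then show "\<exists>i j::int. z = of_int i *\<^sub>R (fst (n P), real_of_int m) + of_int j *\<^sub>R (u, real_of_int k)"
        using nP by metis
    qed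
    then obtain e :: int where e: "e = 1 \<or> e = -1" "\<kappa> (n P) = of_int (e * fibre_index P) *\<^sub>R lvec P"
      by (auto simp: \<kappa>_def fibre_index_def m)
    have fi: "0 \<le> fibre_index P" by (simp add: fibre_index_def)
    \<comment> \<open>A horizontal step h from \<rho> into P has a nonnegative coefficient along the
      normal; applying \<kappa> ties the sign of h to e.\<close>
    have sgn: "\<exists>c\<ge>0. h * of_int k = c * of_int (e * fibre_index P)"
      if h: "z \<in> \<rho>" "y \<in> P" "y - z = h *\<^sub>R (lvec P, 0)" for z y h
    proof -
      obtain c where c: "0 \<le> c" "y - z - c *\<^sub>R n P \<in> direction \<rho>" using ns(3)[OF h(2,1)] by blast
      from \<kappa>0[OF c(2)] have "\<kappa> (h *\<^sub>R (lvec P, 0)) = c *\<^sub>R \<kappa> (n P)" by (simp add: h(3) lin)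
      then have "(h * of_int k) *\<^sub>R lvec P = (c * of_int (e * fibre_index P)) *\<^sub>R lvec P"
        unfolding e(2) by (simp add: lin \<kappa>_def mult_ac)
      then show ?thesis using c(1) lvec_nonzero[OF P(1)] by (metis scaleR_cancel_right)
    qed
    obtain \<sigma> \<sigma>' la lb where W: "walls a b P = {\<sigma>, \<sigma>'}" "\<sigma> \<noteq> \<sigma>'" "side a b \<sigma> P = 1" "side a b \<sigma>' P = - 1"
      "0 \<le> la" "0 \<le> lb" "0 < la + lb"
      "pt \<sigma>' a = pt \<sigma> a + la *\<^sub>R lvec P" "pt \<sigma>' b = pt \<sigma> b + lb *\<^sub>R lvec P"
      by (rule polygon_walls[OF P(1) ab cf spP]) (assumption | rule that)+
    have "\<rho> \<in> walls a b P" using \<rho> P(2) sp by (simp add: walls_def)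
    then have or: "\<rho> = \<sigma> \<or> \<rho> = \<sigma>'" using W(1) by simp
    have \<sigma>: "\<sigma> \<in> walls a b P" "\<sigma>' \<in> walls a b P" using W(1) by auto
    have mem: "(pt \<sigma> a, a) \<in> P" "(pt \<sigma> b, b) \<in> P" "(pt \<sigma>' a, a) \<in> P" "(pt \<sigma>' b, b) \<in> P"
      using pt_mem[of \<sigma> a b] pt_mem[of \<sigma>' a b] \<sigma> ab(1) by (auto simp: walls_def)
    \<comment> \<open>At one of the two levels the slice is a proper segment, which provides a
      nonzero horizontal step.\<close>
    have lab: "0 < la \<or> 0 < lb" using W(5-7) by linarith
    have "e * fibre_index P = side a b \<rho> P * fibre_index P"
      using or
    proof
      assume eq: "\<rho> = \<sigma>"
      have "\<exists>c\<ge>0. la * of_int k = c * of_int (e * fibre_index P)" "\<exists>c\<ge>0. lb * of_int k = c * of_int (e * fibre_index P)"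
        using sgn[OF pm(1) mem(3), of la] sgn[OF pm(2) mem(4), of lb] by (simp_all add: W eq)
      then have "0 < real_of_int (e * fibre_index P)"
        using lab k(1) by (metis mult_pos_pos of_int_0_less_iff zero_less_mult_iff not_less order.order_iff_strict)
      then have "0 < e * fibre_index P" by linarith
      then have "e = 1" using e(1) fi by auto
      then show ?thesis using W(3) eq by simp
    next
      assume eq: "\<rho> = \<sigma>'"
      have "\<exists>c\<ge>0. - la * of_int k = c * of_int (e * fibre_index P)" "\<exists>c\<ge>0. - lb * of_int k = c * of_int (e * fibre_index P)"
        using sgn[OF pm(1) mem(1), of "- la"] sgn[OF pm(2) mem(2), of "- lb"] by (simp_all add: W eq)
      then obtain c c' where c: "0 \<le> c" "- (la * of_int k) = c * of_int (e * fibre_index P)"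
        "0 \<le> c'" "- (lb * of_int k) = c' * of_int (e * fibre_index P)" by auto
      have "\<not> 0 \<le> real_of_int (e * fibre_index P)"
      proof
        assume "0 \<le> real_of_int (e * fibre_index P)"
        then have "0 \<le> - (la * of_int k)" "0 \<le> - (lb * of_int k)" using c by simp_all
        then show False using lab k(1) by (auto simp: mult_le_0_iff)
      qed
      then have "e * fibre_index P < 0" by linarith
      then have "e = - 1" using e(1) fi by auto
      then show ?thesis using W(4) eq by simp
    qed
    then show ?thesis using e(2) by simp
  qed
  have "0 = \<kappa> (\<Sum>P | P \<in> cells2 \<and> \<rho> \<subseteq> P. of_int (w P) *\<^sub>R n P)" using \<kappa>0[OF bal] by simp
  also have "\<dots> = (\<Sum>P | P \<in> cells2 \<and> \<rho> \<subseteq> P. of_int (w P) *\<^sub>R \<kappa> (n P))"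
  proof -
    have "linear \<kappa>" by (rule linearI) (simp_all add: lin)
    then show ?thesis by (simp add: linear_sum lin)
  qed
  also have "\<dots> = (\<Sum>P | P \<in> cells2 \<and> \<rho> \<subseteq> P. of_int (side a b \<rho> P * wm P) *\<^sub>R lvec P)"
    by (rule sum.cong) (auto simp: key wm_def mult_ac)
  finally show ?thesis ..
qed

text \<open>Add the sum of \<open>j\<close> over the orbits of flags of a side in a 2-cell. Taken by
  sides it vanishes, by balancing and linearity of \<open>J\<close> in v. Taken by 2-cells it
  corrects the change of each segment to an element of \<open>M\<close>, since the two sides of a
  cell enter with opposite signs.\<close>

lemma fibre_value_between:
  assumes ab: "a < b" "0 \<le> a" "ereal b \<le> len" and cf: "crit_free a b"
  shows "fibre_value a 1 - fibre_value b (-1) \<in> M"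
proof -
  define Y where "Y = {(\<rho>, P). P \<in> cells2 \<and> spans a b P \<and> \<rho> \<in> walls a b P}"
  define Z where "Z = {\<rho> \<in> X. aff_dim \<rho> = 1 \<and> spans a b \<rho>}"
  define j where "j \<rho> P = of_int (side a b \<rho> P * wm P) * J (pt \<rho> a) (pt \<rho> b) (lvec P)" for \<rho> P
  have Y2: "((+) \<gamma> ` fst y, (+) \<gamma> ` snd y) \<in> Y" if "y \<in> Y" "\<gamma> \<in> G" for y \<gamma>
    using that shift shift_cells2 by (auto simp: Y_def walls_def)
  obtain R1 where R1: "finite R1" "transversal (translates G) Z R1"
    by (rule periodic_finite_transversal[OF G periodic, of Z]) (use shift in \<open>auto simp: Z_def\<close>)
  have T1: "transversal (pair_translates G) Y {y \<in> Y. snd y \<in> reps}"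
    by (rule transversal_pairs[where \<pi> = snd, OF G reps(2) snd_conv Y2])
      (use translate_free in \<open>auto simp: Y_def cells2_def\<close>)
  have T2: "transversal (pair_translates G) Y {y \<in> Y. fst y \<in> R1}"
    by (rule transversal_pairs[where \<pi> = fst, OF G R1(2) fst_conv Y2])
      (use translate_free in \<open>auto simp: Y_def Z_def walls_def\<close>)
  have fin_walls: "finite (walls a b P)" if "P \<in> cells2" "spans a b P" for P
    by (rule polygon_walls[OF that(1) ab cf that(2)]) simp
  have Y1_eq: "{y \<in> Y. snd y \<in> reps} = prod.swap ` (SIGMA P:{P. P \<in> reps \<and> spans a b P}. walls a b P)"
    using reps_cells2 by (force simp: Y_def)
  have fin1: "finite {y \<in> Y. snd y \<in> reps}"
    unfolding Y1_eq using reps fin_walls reps_cells2 by (intro finite_imageI finite_SigmaI) auto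
  have Y2_eq: "{y \<in> Y. fst y \<in> R1} = (SIGMA \<rho>:R1. {P. P \<in> cells2 \<and> \<rho> \<subseteq> P})"
  proof -
    have "\<rho> \<in> Z" if "\<rho> \<in> R1" for \<rho> using subsetD[OF transversal_subset[OF R1(2)] that] .
    moreover have "spans a b P" if "\<rho> \<subseteq> P" "spans a b \<rho>" for \<rho> P
      using that by (auto simp: spans_def slice_def)
    ultimately show ?thesis unfolding Y_def Z_def walls_def by auto
  qed
  \<comment> \<open>A 2-cell has only two walls, so the flags form finitely many orbits; listed by
    walls, this bounds the number of 2-cells around each wall.\<close>
  have fin2: "finite {P. P \<in> cells2 \<and> \<rho> \<subseteq> P}" if "\<rho> \<in> R1" for \<rho>
  proof -
    have "finite {y \<in> Y. fst y \<in> R1}"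
      by (rule transversal_finite[OF equivp_pair_translates[OF G] T1 T2 fin1])
    then have "finite (snd ` {y \<in> Y. fst y \<in> R1})" by simp
    then show ?thesis by (rule rev_finite_subset) (use that in \<open>force simp: Y2_eq\<close>)
  qed
  have "(\<Sum>P | P \<in> reps \<and> spans a b P. \<Sum>\<rho>\<in>walls a b P. j \<rho> P)
      = (\<Sum>(P, \<rho>)\<in>(SIGMA P:{P. P \<in> reps \<and> spans a b P}. walls a b P). j \<rho> P)"
    using reps fin_walls reps_cells2 by (intro sum.Sigma) auto
  also have "\<dots> = (\<Sum>(\<rho>, P)\<in>{y \<in> Y. snd y \<in> reps}. j \<rho> P)"
    unfolding Y1_eq by (subst sum.reindex) (auto simp: case_prod_unfold o_def)
  also have "\<dots> = (\<Sum>(\<rho>, P)\<in>{y \<in> Y. fst y \<in> R1}. j \<rho> P)"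
  proof (rule sum_transversal[OF equivp_pair_translates[OF G] T1 T2])
    fix x y assume xy: "x \<in> Y" "y \<in> Y" "pair_translates G x y"
    obtain \<rho> P where x: "x = (\<rho>, P)" by (cases x)
    obtain \<gamma> where \<gamma>: "\<gamma> \<in> \<Gamma>" "y = (shift \<gamma> \<rho>, shift \<gamma> P)"
      using xy(3) x unfolding pair_translates_def by auto
    have h: "P \<in> X" "aff_dim \<rho> = 1" "spans a b \<rho>" using xy(1) x by (auto simp: Y_def walls_def cells2_def)
    show "(case x of (\<rho>, P) \<Rightarrow> j \<rho> P) = (case y of (\<rho>, P) \<Rightarrow> j \<rho> P)"
      using ab(1) pt_shift[OF h(2,3)]
      by (simp add: x \<gamma>(2) j_def side_shift wm_shift[OF h(1) \<gamma>(1)] J_translate[OF \<gamma>(1)])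
  qed
  also have "\<dots> = (\<Sum>\<rho>\<in>R1. \<Sum>P | P \<in> cells2 \<and> \<rho> \<subseteq> P. j \<rho> P)"
    unfolding Y2_eq using R1 fin2 by (intro sum.Sigma[symmetric]) auto
  also have "\<dots> = 0"
  proof (rule sum.neutral, rule ballI)
    fix \<rho> assume "\<rho> \<in> R1"
    then have \<rho>: "\<rho> \<in> X" "aff_dim \<rho> = 1" "spans a b \<rho>" using transversal_subset[OF R1(2)] by (auto simp: Z_def)
    have "(\<Sum>P | P \<in> cells2 \<and> \<rho> \<subseteq> P. j \<rho> P) =
      J (pt \<rho> a) (pt \<rho> b) (\<Sum>P | P \<in> cells2 \<and> \<rho> \<subseteq> P. of_int (side a b \<rho> P * wm P) *\<^sub>R lvec P)"
      unfolding J_sum j_def ..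
    then show "(\<Sum>P | P \<in> cells2 \<and> \<rho> \<subseteq> P. j \<rho> P) = 0"
      unfolding wall_balanced[OF \<rho>(1,2) ab cf \<rho>(3)] by (simp add: J_def)
  qed
  finally have flags: "(\<Sum>P | P \<in> reps \<and> spans a b P. \<Sum>\<rho>\<in>walls a b P. j \<rho> P) = 0" .
  have act: "{P. P \<in> reps \<and> active P a 1} = {P. P \<in> reps \<and> spans a b P}"
    "{P. P \<in> reps \<and> active P b (-1)} = {P. P \<in> reps \<and> spans a b P}"
    using active_iff_spans[OF _ ab cf] reps_cells2 by (auto simp: cells2_def)
  have "fibre_value a 1 - fibre_value b (-1) + (\<Sum>P | P \<in> reps \<and> spans a b P. \<Sum>\<rho>\<in>walls a b P. j \<rho> P)
    = (\<Sum>P | P \<in> reps \<and> spans a b P. of_int (wm P) * segment_value (slice P a)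
        - of_int (wm P) * segment_value (slice P b) + (\<Sum>\<rho>\<in>walls a b P. j \<rho> P))"
    unfolding fibre_value_def act by (simp add: sum_subtractf sum.distrib)
  also have "\<dots> \<in> M"
  proof (rule add_subgroup_sum[OF M])
    fix P assume "P \<in> {P. P \<in> reps \<and> spans a b P}"
    then have P: "P \<in> cells2" "spans a b P" using reps_cells2 by auto
    obtain \<rho> \<rho>' la lb where W: "walls a b P = {\<rho>, \<rho>'}" "\<rho> \<noteq> \<rho>'" "side a b \<rho> P = 1" "side a b \<rho>' P = - 1"
      "0 \<le> la" "0 \<le> lb" "0 < la + lb"
      "pt \<rho>' a = pt \<rho> a + la *\<^sub>R lvec P" "pt \<rho>' b = pt \<rho> b + lb *\<^sub>R lvec P"
      "slice P a = closed_segment (pt \<rho> a) (pt \<rho> a + la *\<^sub>R lvec P)"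
      "slice P b = closed_segment (pt \<rho> b) (pt \<rho> b + lb *\<^sub>R lvec P)"
      by (rule polygon_walls[OF P(1) ab cf P(2)]) (assumption | rule that)+
    note v = lvec(1)[OF P(1)]
    have vi: "lvec P \<in> int_vectors" using v by (simp add: primitive_vec_def)
    have "of_int (wm P) * segment_value (slice P a) - of_int (wm P) * segment_value (slice P b)
        + (\<Sum>\<rho>\<in>walls a b P. j \<rho> P)
      = of_int (wm P) * ((K (lvec P) (pt \<rho> a) - K (lvec P) (pt \<rho> a + la *\<^sub>R lvec P))
        - (K (lvec P) (pt \<rho> b) - K (lvec P) (pt \<rho> b + lb *\<^sub>R lvec P))
        + (J (pt \<rho> a) (pt \<rho> b) (lvec P) - J (pt \<rho> a + la *\<^sub>R lvec P) (pt \<rho> b + lb *\<^sub>R lvec P) (lvec P)))"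
      unfolding W(10,11) segment_value_eq[OF v W(5)] segment_value_eq[OF v W(6)] W(1)
      using W(2) by (simp add: j_def W(3,4,8,9) algebra_simps)
    also have "\<dots> \<in> M" by (intro add_subgroup_of_int_mult[OF M] segment_transport vi)
    finally show "of_int (wm P) * segment_value (slice P a) - of_int (wm P) * segment_value (slice P b)
        + (\<Sum>\<rho>\<in>walls a b P. j \<rho> P) \<in> M" .
  qed
  finally show ?thesis unfolding flags by simp
qed

end

section \<open>Crossing a critical level\<close>

lemma aff_dim_times_singleton:
  fixes Q :: "'a::euclidean_space set"
  shows "aff_dim (Q \<times> {t::real}) = aff_dim Q"
proof -
  have "linear (\<lambda>x::'a. (x, 0::real))" by (rule linearI) simp_all
  moreover have "inj (\<lambda>x::'a. (x, 0::real))" by (auto simp: inj_on_def)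
  ultimately have "aff_dim ((\<lambda>x. (x, 0::real)) ` Q) = aff_dim Q" by (rule aff_dim_injective_linear_image)
  moreover have "Q \<times> {t} = (+) (0, t) ` (\<lambda>x. (x, 0::real)) ` Q" by (auto simp: image_image)
  ultimately show ?thesis by (simp add: aff_dim_translation_eq)
qed

lemma Gcd_multiples: "Gcd (range ((*) (m::int))) = \<bar>m\<bar>"
proof (rule associated_eqI)
  show "Gcd (range ((*) m)) dvd \<bar>m\<bar>" by (simp, rule Gcd_dvd, rule range_eqI[of _ _ 1]) simp
  show "\<bar>m\<bar> dvd Gcd (range ((*) m))" by (rule Gcd_greatest) auto
qed auto

context edge_complex
begin

lemma active_slice_segment:
  assumes P: "P \<in> cells2" and act: "active P t s"
  obtains p l where "0 \<le> l" "slice P t = closed_segment p (p + l *\<^sub>R lvec P)"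
proof -
  obtain y where y: "y \<in> P" "0 < s * (snd y - t)" and ne: "slice P t \<noteq> {}" using act unfolding active_def by blast
  from y(2) have "snd y \<noteq> t" by auto
  note y = y(1) this
  show thesis by (rule slice_segment[OF P ne y]) (rule that)
qed

lemma slice_value_translate:
  assumes P: "P \<in> cells2" and act: "active P t s" and \<gamma>: "\<gamma> \<in> \<Gamma>"
  shows "segment_value ((+) \<gamma> ` slice P t) = segment_value (slice P t)"
proof -
  obtain p l where pl: "0 \<le> l" "slice P t = closed_segment p (p + l *\<^sub>R lvec P)"
    by (rule active_slice_segment[OF P act]) (rule that)
  show ?thesis by (rule segment_value_translate[OF lvec(1)[OF P] pl \<gamma>])
qed

lemma slice_value_degenerate:
  assumes P: "P \<in> cells2" and act: "active P t s" and dim: "aff_dim (slice P t) \<noteq> 1"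
  shows "segment_value (slice P t) = 0"
proof -
  obtain p l where pl: "0 \<le> l" "slice P t = closed_segment p (p + l *\<^sub>R lvec P)"
    by (rule active_slice_segment[OF P act]) (rule that)
  have "l = 0"
  proof (rule ccontr)
    assume "l \<noteq> 0"
    then have "p \<noteq> p + l *\<^sub>R lvec P" using lvec_nonzero[OF P] by simp
    then have "aff_dim (slice P t) = 1"
      unfolding pl(2) segment_convex_hull aff_dim_convex_hull aff_dim_2 by (rule if_not_P)
    then show False using dim by simp
  qed
  then show ?thesis unfolding pl(2) segment_value_eq[OF lvec(1)[OF P] pl(1)] by simp
qed

text \<open>A 2-cell on one side of level t touches it in a face, and grouping by this face collects
  the weights of all 2-cells ending there. Slices that are points have value 0. The family B is left
  open, because over an end of the edge these faces belong to the complex of the vertex.\<close>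

lemma one_sided_sum:
  assumes B: "\<And>Q \<gamma>. Q \<in> B \<Longrightarrow> \<gamma> \<in> \<Gamma> \<Longrightarrow> (+) \<gamma> ` Q \<in> B" "\<And>Q. Q \<in> B \<Longrightarrow> bounded Q \<and> Q \<noteq> {}"
    and R: "finite R" "transversal (translates \<Gamma>) B R"
    and slB: "\<And>P. P \<in> cells2 \<Longrightarrow> active P t s \<Longrightarrow> \<not> active P t (- s) \<Longrightarrow> aff_dim (slice P t) = 1 \<Longrightarrow> slice P t \<in> B"
  shows "(\<Sum>P | P \<in> reps \<and> active P t s \<and> \<not> active P t (- s). of_int (wm P) * segment_value (slice P t)) =
    (\<Sum>Q\<in>R. segment_value Q * of_int (\<Sum>P | P \<in> cells2 \<and> active P t s \<and> \<not> active P t (- s) \<and> slice P t = Q. wm P))"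
proof -
  define Y where "Y = {P \<in> cells2. active P t s \<and> \<not> active P t (- s) \<and> slice P t \<in> B}"
  let ?g = "\<lambda>P. of_int (wm P) * segment_value (slice P t)"
  have Yinv: "shift \<gamma> P \<in> Y" if "P \<in> Y" "\<gamma> \<in> \<Gamma>" for P \<gamma>
    using that shift_cells2 B(1) by (simp add: Y_def slice_translate)
  have Yinv': "(+) \<gamma> ` P \<in> Y" if "P \<in> Y" "\<gamma> \<in> G" for P \<gamma>
    using that Yinv by auto
  have Ycells: "id P \<in> cells2" if "P \<in> Y" for P using that by (simp add: Y_def)
  have free2: "\<gamma> = 0" if "P \<in> cells2" "\<gamma> \<in> G" "(+) \<gamma> ` P = P" for P \<gamma>
    by (rule translate_free[of P]) (use that in \<open>auto simp: cells2_def\<close>)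
  have freeB: "\<gamma> = 0" if "Q \<in> B" "\<gamma> \<in> \<Gamma>" "(+) \<gamma> ` Q = Q" for Q \<gamma>
    using that B(2) bounded_translate_fixed by blast
  have YB: "slice P t \<in> B" if "P \<in> Y" for P using that by (simp add: Y_def)
  have rel: "translates G = (\<lambda>y y'. \<exists>\<gamma>\<in>G. y' = (+) \<gamma> ` y)" "translates G = (\<lambda>y y'. \<exists>\<gamma>\<in>\<Gamma>. y' = shift \<gamma> y)"
    by (intro ext, simp add: translates_def)+
  have T1: "transversal (translates G) Y {P \<in> Y. id P \<in> reps}"
    unfolding rel(1)
    by (rule transversal_equivariant[where \<pi> = id and act = "\<lambda>\<gamma> P. (+) \<gamma> ` P", OF G reps(2) _ Ycells Yinv' free2]) simp
  have T2: "transversal (translates G) Y {P \<in> Y. slice P t \<in> R}"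
    unfolding rel(2)
    by (rule transversal_equivariant[where \<pi> = "\<lambda>P. slice P t" and act = shift, OF \<Gamma> R(2) slice_translate YB Yinv freeB])
  have fin1: "finite {P \<in> Y. id P \<in> reps}" using reps(1) by simp
  have fin2: "finite {P \<in> Y. slice P t \<in> R}"
    by (rule transversal_finite[OF equivp_translates[OF G] T1 T2 fin1])
  have "(\<Sum>P | P \<in> reps \<and> active P t s \<and> \<not> active P t (- s). ?g P) = (\<Sum>P\<in>{P \<in> Y. id P \<in> reps}. ?g P)"
  proof (rule sum.mono_neutral_right)
    show "finite {P. P \<in> reps \<and> active P t s \<and> \<not> active P t (- s)}" using reps(1) by simp
    show "{P \<in> Y. id P \<in> reps} \<subseteq> {P. P \<in> reps \<and> active P t s \<and> \<not> active P t (- s)}" by (auto simp: Y_def)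
    show "\<forall>P\<in>{P. P \<in> reps \<and> active P t s \<and> \<not> active P t (- s)} - {P \<in> Y. id P \<in> reps}. ?g P = 0"
    proof
      fix P assume "P \<in> {P. P \<in> reps \<and> active P t s \<and> \<not> active P t (- s)} - {P \<in> Y. id P \<in> reps}"
      then have P: "P \<in> cells2" "active P t s" "\<not> active P t (- s)" "slice P t \<notin> B"
        using reps_cells2 by (auto simp: Y_def)
      then have "aff_dim (slice P t) \<noteq> 1" using slB by blast
      then show "?g P = 0" using slice_value_degenerate[OF P(1,2)] by simp
    qed
  qed
  also have "\<dots> = (\<Sum>P\<in>{P \<in> Y. slice P t \<in> R}. ?g P)"
  proof (rule sum_transversal[OF equivp_translates[OF G] T1 T2])
    fix P P' assume h: "P \<in> Y" "translates G P P'"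
    then obtain \<gamma> where \<gamma>: "\<gamma> \<in> \<Gamma>" "P' = shift \<gamma> P" unfolding rel(2) by (elim bexE)
    have P: "P \<in> cells2" "active P t s" "P \<in> X" using h(1) by (simp_all add: Y_def cells2_def)
    show "?g P = ?g P'"
      unfolding \<gamma>(2) slice_translate wm_shift[OF P(3) \<gamma>(1)] slice_value_translate[OF P(1,2) \<gamma>(1)] ..
  qed
  also have "\<dots> = (\<Sum>Q\<in>R. \<Sum>P\<in>{P \<in> {P \<in> Y. slice P t \<in> R}. slice P t = Q}. ?g P)"
    by (rule sum.group[symmetric, OF fin2 R(1)]) auto
  also have "\<dots> = (\<Sum>Q\<in>R. segment_value Q * of_int (\<Sum>P | P \<in> cells2 \<and> active P t s \<and> \<not> active P t (- s) \<and> slice P t = Q. wm P))"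
  proof (rule sum.cong[OF refl])
    fix Q assume Q: "Q \<in> R"
    then have QB: "Q \<in> B" using transversal_subset[OF R(2)] by blast
    have "{P \<in> {P \<in> Y. slice P t \<in> R}. slice P t = Q} =
        {P. P \<in> cells2 \<and> active P t s \<and> \<not> active P t (- s) \<and> slice P t = Q}"
      using Q QB by (auto simp: Y_def)
    then show "(\<Sum>P\<in>{P \<in> {P \<in> Y. slice P t \<in> R}. slice P t = Q}. ?g P) =
      segment_value Q * of_int (\<Sum>P | P \<in> cells2 \<and> active P t s \<and> \<not> active P t (- s) \<and> slice P t = Q. wm P)"
      by (simp add: sum_distrib_left mult.commute)
  qed
  finally show ?thesis .
qed

text \<open>The lattice of Q \<times> {t} is horizontal, so the heights in the lattice of P are the
  multiples of \<open>snd n\<close>, which is the index up to sign. The sign tells on which side of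
  the level P lies; height 0 means that P itself is contracted.\<close>

lemma level_face_normal:
  assumes P: "P \<in> cells2" and \<sigma>: "Q \<times> {t} face_of P" "aff_dim (Q \<times> {t}) = 1"
    and n: "primitive_normal edge_lattice (Q \<times> {t}) P n"
  shows "\<bar>snd n\<bar> = of_int (fibre_index P)"
    "0 < s * snd n \<Longrightarrow> active P t s \<and> \<not> active P t (- s) \<and> slice P t = Q"
    "\<not> 0 < s * snd n \<Longrightarrow> \<not> active P t s"
proof -
  have PX: "P \<in> X" "aff_dim P = 2" using P by (auto simp: cells2_def)
  have poly: "polyhedron P" "rational_slope edge_lattice P" using cell[OF PX(1)] by blast+
  let ?\<sigma> = "Q \<times> {t}"
  note ns = normal_side[OF poly(1) PX(2) poly(2) \<sigma> n]
  have flat: "snd z = 0" if "z \<in> direction ?\<sigma>" for z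
    by (rule direction_vanish[OF that linear_snd, of t]) auto
  have "?\<sigma> \<noteq> {}" using \<sigma>(2) by (auto simp: aff_dim_empty)
  then obtain q where q: "(q, t) \<in> ?\<sigma>" by auto
  then have qP: "(q, t) \<in> P" using face_of_imp_subset[OF \<sigma>(1)] by blast
  have height: "\<exists>c\<ge>0. snd y - t = c * snd n" if y: "y \<in> P" for y
  proof -
    obtain c where c: "0 \<le> c" "y - (q, t) - c *\<^sub>R n \<in> direction ?\<sigma>" using ns(3)[OF y q] by blast
    then show ?thesis using flat[OF c(2)] by (intro exI[of _ c]) simp
  qed
  show "\<bar>snd n\<bar> = of_int (fibre_index P)"
  proof -
    let ?L = "cell_lattice edge_lattice P"
    have nL: "n \<in> ?L" using n by (simp add: primitive_normal_def)
    obtain m :: int where m: "snd n = of_int m" using nL by (auto simp: cell_lattice_def elim: Ints_cases)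
    have "{k. \<exists>u\<in>?L. snd u = of_int k} = range ((*) m)"
    proof (intro equalityI subsetI)
      fix k assume "k \<in> {k. \<exists>u\<in>?L. snd u = of_int k}"
      then obtain u where u: "u \<in> ?L" "snd u = of_int k" by blast
      obtain j :: int where "u - of_int j *\<^sub>R n \<in> cell_lattice edge_lattice ?\<sigma>"
        using n u(1) unfolding primitive_normal_def by blast
      then have "u - of_int j *\<^sub>R n \<in> direction ?\<sigma>" by (simp add: cell_lattice_def)
      from flat[OF this] have "snd (u - of_int j *\<^sub>R n) = 0" .
      then have "real_of_int k = of_int (m * j)" by (simp add: u(2) m mult.commute)
      then have "k = m * j" by linarith
      then show "k \<in> range ((*) m)" by blast
    next
      fix k assume "k \<in> range ((*) m)"
      then obtain j where j: "k = m * j" by blast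
      have "of_int j *\<^sub>R n \<in> ?L"
        using nL subspace_scale[OF subspace_direction[of P]] int_vectors_of_int_scale
        by (auto simp: cell_lattice_def mem_Times_iff)
      then show "k \<in> {k. \<exists>u\<in>?L. snd u = of_int k}" by (auto simp: j m intro!: bexI[of _ "of_int j *\<^sub>R n"])
    qed
    then have "fibre_index P = \<bar>m\<bar>" by (simp add: fibre_index_def Gcd_multiples)
    then show ?thesis by (simp add: m)
  qed
  show "active P t s \<and> \<not> active P t (- s) \<and> slice P t = Q" if pos: "0 < s * snd n"
  proof (intro conjI)
    have ne: "slice P t \<noteq> {}" using qP by (auto simp: slice_def)
    obtain x \<epsilon> where x: "x \<in> ?\<sigma>" "0 < \<epsilon>" "x + \<epsilon> *\<^sub>R n \<in> P" using n unfolding primitive_normal_def by blast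
    have "0 < s * (snd (x + \<epsilon> *\<^sub>R n) - t)" using x pos by (auto simp: algebra_simps zero_less_mult_iff)
    then show "active P t s" using ne x(3) unfolding active_def by blast
    have ge: "0 \<le> s * (snd y - t)" if y: "y \<in> P" for y
    proof -
      obtain c where c: "0 \<le> c" "snd y - t = c * snd n" using height[OF y] by blast
      have "s * (snd y - t) = c * (s * snd n)" unfolding c(2) by simp
      also have "\<dots> \<ge> 0" using c(1) pos by simp
      finally show ?thesis .
    qed
    then show "\<not> active P t (- s)" unfolding active_def by fastforce
    have "(\<forall>y\<in>P. snd y \<le> t) \<or> (\<forall>y\<in>P. t \<le> snd y)"
    proof (cases "0 < s")
      case True
      then show ?thesis using ge by (auto simp: zero_le_mult_iff)
    next
      case False
      then have "s < 0" using pos by (cases "s = 0") auto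
      then show ?thesis using ge by (auto simp: zero_le_mult_iff)
    qed
    note T = level_face[OF PX(1) this]
    \<comment> \<open>A proper face of P has dimension at most 1, so the slice cannot be larger than
      its 1-dimensional face Q.\<close>
    have "slice P t \<times> {t} \<noteq> P"
    proof
      assume "slice P t \<times> {t} = P"
      then have "x + \<epsilon> *\<^sub>R n \<in> slice P t \<times> {t}" using x(3) by simp
      then have "snd (x + \<epsilon> *\<^sub>R n) = t" by (simp add: mem_Times_iff)
      then show False using \<open>0 < s * (snd (x + \<epsilon> *\<^sub>R n) - t)\<close> by simp
    qed
    then have T2: "aff_dim (slice P t \<times> {t}) < 2"
      using face_of_aff_dim_lt[OF convex_cell[OF PX(1)] T] PX(2) by simp
    have sub: "?\<sigma> \<subseteq> slice P t \<times> {t}" using face_of_imp_subset[OF \<sigma>(1)] by (auto simp: slice_def)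
    have \<sigma>T: "?\<sigma> face_of slice P t \<times> {t}" by (rule face_of_subset[OF \<sigma>(1) sub face_of_imp_subset[OF T]])
    have "?\<sigma> = slice P t \<times> {t}"
    proof (rule ccontr)
      assume "?\<sigma> \<noteq> slice P t \<times> {t}"
      then have "aff_dim ?\<sigma> < aff_dim (slice P t \<times> {t})"
        using face_of_aff_dim_lt[OF face_of_imp_convex[OF T] \<sigma>T] convex_cell[OF PX(1)] by blast
      then show False using \<sigma>(2) T2 by simp
    qed
    then show "slice P t = Q" by auto
  qed
  show "\<not> active P t s" if neg: "\<not> 0 < s * snd n"
  proof
    assume "active P t s"
    then obtain y where y: "y \<in> P" "0 < s * (snd y - t)" by (auto simp: active_def)
    obtain c where c: "0 \<le> c" "snd y - t = c * snd n" using height[OF y(1)] by blast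
    have "s * (snd y - t) = c * (s * snd n)" unfolding c(2) by simp
    also have "\<dots> \<le> 0" by (rule mult_nonneg_nonpos) (use c(1) neg in linarith)+
    finally show False using y(2) by simp
  qed
qed

text \<open>A point of \<sigma> lies in finitely many translates of each of the finitely many
  representatives.\<close>

lemma finite_star:
  assumes "\<sigma> \<noteq> {}"
  shows "finite {P. P \<in> cells2 \<and> \<sigma> \<subseteq> P}"
proof -
  obtain q t where q: "(q, t) \<in> \<sigma>" using assms by auto
  define A where "A = (\<Union>P\<in>reps. {\<gamma>\<in>\<Gamma>. q - \<gamma> \<in> fst ` P})"
  have "finite A"
    unfolding A_def using reps(1) reps_cells2 cell by (intro finite_UN_I finite_translates) (auto simp: cells2_def)
  then have "finite ((\<lambda>(\<gamma>, P). shift \<gamma> P) ` (A \<times> reps))" using reps(1) by simp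
  moreover have "{P. P \<in> cells2 \<and> \<sigma> \<subseteq> P} \<subseteq> (\<lambda>(\<gamma>, P). shift \<gamma> P) ` (A \<times> reps)"
  proof
    fix P assume P: "P \<in> {P. P \<in> cells2 \<and> \<sigma> \<subseteq> P}"
    then have "\<exists>!r. r \<in> reps \<and> translates G P r" by (intro transversal_ex1[OF reps(2)]) simp
    then obtain P' where P': "P' \<in> reps" "translates G P P'" by (elim ex1E conjE)
    from equivp_symp[OF equivp_translates[OF G] P'(2)] obtain \<gamma> where \<gamma>: "\<gamma> \<in> \<Gamma>" "P = shift \<gamma> P'"
      unfolding translates_def by auto
    have "(q - \<gamma>, t) \<in> P'" using P q unfolding \<gamma>(2) by (auto simp: mem_shift)
    then have "\<gamma> \<in> A" using \<gamma>(1) P'(1) by (force simp: A_def)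
    then show "P \<in> (\<lambda>(\<gamma>, P). shift \<gamma> P) ` (A \<times> reps)"
      using \<gamma>(2) P'(1) by (intro image_eqI[of _ _ "(\<gamma>, P')"]) auto
  qed
  ultimately show ?thesis by (rule finite_subset[rotated])
qed

lemma fibre_value_split:
  "fibre_value t s = (\<Sum>P | P \<in> reps \<and> active P t s \<and> active P t (- s). of_int (wm P) * segment_value (slice P t))
    + (\<Sum>P | P \<in> reps \<and> active P t s \<and> \<not> active P t (- s). of_int (wm P) * segment_value (slice P t))"
  unfolding fibre_value_def
  by (subst sum.union_disjoint[symmetric]) (use reps(1) in \<open>auto intro!: sum.cong\<close>)

text \<open>Cells passing through the level contribute the same from both sides. Those ending there
  are grouped by their 1-cells at level t, and the height component of balancing at such a 1-cell
  equates the total weight above with that below. The result is an equality, not only a congruence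
  modulo \<open>M\<close>.\<close>

lemma fibre_value_cross:
  assumes t: "0 < t" "ereal t < len"
  shows "fibre_value t 1 = fibre_value t (-1)"
proof -
  define B where "B = {Q. Q \<times> {t} \<in> X \<and> aff_dim (Q \<times> {t}) = 1}"
  have sl: "slice (Q \<times> {t}) t = Q" for Q :: "(real ^ 'g) set" by (auto simp: slice_def)
  have tr: "shift \<gamma> (Q \<times> {t}) = ((+) \<gamma> ` Q) \<times> {t}" for \<gamma> and Q :: "(real ^ 'g) set"
    by force
  have B1: "(+) \<gamma> ` Q \<in> B" if "Q \<in> B" "\<gamma> \<in> \<Gamma>" for Q \<gamma>
    using that shift(1)[of "Q \<times> {t}" \<gamma>] aff_dim_shift[of \<gamma> "Q \<times> {t}"] by (simp add: B_def tr)
  have B2: "bounded Q \<and> Q \<noteq> {}" if "Q \<in> B" for Q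
    using that cell[of "Q \<times> {t}"] by (auto simp: B_def)
  obtain F where F: "finite F" "\<forall>P\<in>X. \<exists>P'\<in>F. \<exists>\<gamma>\<in>G. P = (+) \<gamma> ` P'"
    using periodic unfolding periodic_finite_def by (elim conjE exE)
  define F' where "F' = {Q \<in> (\<lambda>P. slice P t) ` F. Q \<in> B}"
  have F': "finite F'" "F' \<subseteq> B" using F(1) by (auto simp: F'_def)
  have F'3: "\<exists>Q'\<in>F'. translates \<Gamma> Q Q'" if Q: "Q \<in> B" for Q
  proof -
    have QX: "Q \<times> {t} \<in> X" using Q by (simp add: B_def)
    obtain P' \<gamma> where P': "P' \<in> F" "\<gamma> \<in> G" "Q \<times> {t} = (+) \<gamma> ` P'" using bspec[OF F(2) QX] by (elim bexE)
    obtain g where g: "\<gamma> = (g, 0)" "g \<in> \<Gamma>" using P'(2) by auto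
    have "Q = (+) g ` slice P' t" using P'(3) sl[of Q] slice_translate[of g P' t] by (simp add: g)
    then have eq: "slice P' t = (+) (- g) ` Q" using translate_uminus[of g "slice P' t"] by simp
    have mg: "- g \<in> \<Gamma>" using add_subgroupD(3)[OF \<Gamma> g(2)] .
    then have "slice P' t \<in> F'" using P'(1) B1[OF Q mg] eq by (auto simp: F'_def)
    moreover have "translates \<Gamma> Q (slice P' t)" unfolding translates_def eq using mg by (rule rev_bexI) (rule refl)
    ultimately show ?thesis by (rule rev_bexI)
  qed
  obtain R where R: "finite R" "transversal (translates \<Gamma>) B R"
  proof (rule exists_transversal[OF equivp_translates[OF \<Gamma>] F' F'3 subset_refl])
    fix P Q assume "Q \<in> B"
    then show "Q \<in> B" .
  qed (assumption | rule that)+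
  have level: "slice P t \<in> B" if P: "P \<in> cells2" "active P t s" "\<not> active P t (- s)" "aff_dim (slice P t) = 1"
    and s: "s = 1 \<or> s = -1" for P s
  proof -
    have PX: "P \<in> X" using P(1) by (simp add: cells2_def)
    have "slice P t \<noteq> {}" using P(2) by (simp add: active_def)
    then obtain x where x: "x \<in> slice P t" by blast
    have nb: "\<not> 0 < - s * (snd y - t)" if "y \<in> P" for y using P(3) x that unfolding active_def by blast
    have "(\<forall>y\<in>P. snd y \<le> t) \<or> (\<forall>y\<in>P. t \<le> snd y)"
      using s
    proof
      assume "s = 1"
      then have "t \<le> snd y" if "y \<in> P" for y using nb[OF that] by simp
      then show ?thesis by blast
    next
      assume "s = -1"
      then have "snd y \<le> t" if "y \<in> P" for y using nb[OF that] by simp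
      then show ?thesis by blast
    qed
    note T = level_face[OF PX this]
    have "slice P t \<times> {t} \<in> X" using face[OF PX T, of "(x, t)"] x t by auto
    then show ?thesis using P(4) by (simp add: B_def aff_dim_times_singleton)
  qed
  have one: "(\<Sum>P | P \<in> reps \<and> active P t s \<and> \<not> active P t (- s). of_int (wm P) * segment_value (slice P t)) =
    (\<Sum>Q\<in>R. segment_value Q * of_int (\<Sum>P | P \<in> cells2 \<and> active P t s \<and> \<not> active P t (- s) \<and> slice P t = Q. wm P))"
    if s: "s = 1 \<or> s = -1" for s
    by (rule one_sided_sum[OF B1 B2 R level[OF _ _ _ _ s]])
  have bal: "(\<Sum>P | P \<in> cells2 \<and> active P t 1 \<and> \<not> active P t (- 1) \<and> slice P t = Q. wm P) =
      (\<Sum>P | P \<in> cells2 \<and> active P t (-1) \<and> \<not> active P t (- (-1)) \<and> slice P t = Q. wm P)" if QR: "Q \<in> R" for Q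
  proof -
    have Q: "Q \<times> {t} \<in> X" "aff_dim (Q \<times> {t}) = 1" using transversal_subset[OF R(2)] QR by (auto simp: B_def)
    let ?S = "{P. P \<in> cells2 \<and> Q \<times> {t} \<subseteq> P}"
    have star: "{\<tau> \<in> X. aff_dim \<tau> = 2 \<and> Q \<times> {t} \<subseteq> \<tau>} = ?S" unfolding cells2_def by auto
    obtain n where n: "\<And>P. P \<in> ?S \<Longrightarrow> primitive_normal edge_lattice (Q \<times> {t}) P (n P)"
      and sum: "(\<Sum>P\<in>?S. of_int (w P) *\<^sub>R n P) \<in> direction (Q \<times> {t})"
      using balanced[OF Q] unfolding star by blast
    have face: "Q \<times> {t} face_of P" if "P \<in> ?S" for P
      using inter[of P "Q \<times> {t}"] that Q(1) by (auto simp: cells2_def Int_absorb1)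
    have lf: "\<bar>snd (n P)\<bar> = of_int (fibre_index P)"
      "0 < s * snd (n P) \<longleftrightarrow> active P t s \<and> \<not> active P t (- s) \<and> slice P t = Q" if "P \<in> ?S" for P s
      using level_face_normal[OF _ face[OF that] Q(2) n[OF that]] that by blast+
    have sets: "{P. P \<in> cells2 \<and> active P t s \<and> \<not> active P t (- s) \<and> slice P t = Q} = {P \<in> ?S. 0 < s * snd (n P)}" for s
    proof (intro equalityI subsetI)
      fix P assume P: "P \<in> {P. P \<in> cells2 \<and> active P t s \<and> \<not> active P t (- s) \<and> slice P t = Q}"
      then have "P \<in> ?S" by (auto simp: slice_def)
      then show "P \<in> {P \<in> ?S. 0 < s * snd (n P)}" using P lf(2) by blast
    next
      fix P assume "P \<in> {P \<in> ?S. 0 < s * snd (n P)}"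
      then show "P \<in> {P. P \<in> cells2 \<and> active P t s \<and> \<not> active P t (- s) \<and> slice P t = Q}" using lf(2) by blast
    qed
    have flat: "snd z = 0" if "z \<in> direction (Q \<times> {t})" for z
      by (rule direction_vanish[OF that linear_snd, of t]) auto
    have "Q \<times> {t} \<noteq> {}" using Q(2) by (auto simp: aff_dim_empty)
    note True = finite_star[OF this]
    have "0 = snd (\<Sum>P\<in>?S. of_int (w P) *\<^sub>R n P)" using flat[OF sum] by simp
    also have "\<dots> = (\<Sum>P\<in>?S. of_int (w P) * snd (n P))" by (simp add: snd_sum)
    \<comment> \<open>The height of a normal is the fibre index, positive for cells above the level
      and negative for cells below it.\<close>
    also have "\<dots> = (\<Sum>P\<in>?S. (if 0 < 1 * snd (n P) then of_int (wm P) else 0) - (if 0 < - 1 * snd (n P) then of_int (wm P) else 0))"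
    proof (rule sum.cong[OF refl])
      fix P assume "P \<in> ?S"
      from lf(1)[OF this, symmetric]
      show "of_int (w P) * snd (n P) =
        (if 0 < 1 * snd (n P) then of_int (wm P) else 0) - (if 0 < - 1 * snd (n P) then of_int (wm P) else 0)"
        by (simp add: wm_def abs_if)
    qed
    also have "\<dots> = of_int (\<Sum>P\<in>{P \<in> ?S. 0 < 1 * snd (n P)}. wm P) - of_int (\<Sum>P\<in>{P \<in> ?S. 0 < - 1 * snd (n P)}. wm P)"
      unfolding sum_subtractf sum.inter_filter[OF True] of_int_sum
      by (intro arg_cong2[where f = minus] sum.cong) auto
    finally show ?thesis unfolding sets by linarith
  qed
  have "(\<Sum>P | P \<in> reps \<and> active P t 1 \<and> \<not> active P t (- 1). of_int (wm P) * segment_value (slice P t)) =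
    (\<Sum>P | P \<in> reps \<and> active P t (-1) \<and> \<not> active P t (- (-1)). of_int (wm P) * segment_value (slice P t))"
    unfolding one[OF disjI1[OF refl]] one[OF disjI2[OF refl]]
    by (rule sum.cong[OF refl]) (simp only: bal)
  moreover have "{P. P \<in> reps \<and> active P t 1 \<and> active P t (- 1)} =
      {P. P \<in> reps \<and> active P t (-1) \<and> active P t (- (-1))}" by auto
  ultimately show ?thesis
    unfolding fibre_value_split[of t 1] fibre_value_split[of t "-1"] by (simp only:)
qed

section \<open>Constancy along a whole edge\<close>

definition admissible :: "real \<Rightarrow> real \<Rightarrow> bool" where
  "admissible t s \<longleftrightarrow> s = 1 \<and> 0 \<le> t \<and> ereal t < len \<or> s = -1 \<and> 0 < t \<and> ereal t \<le> len"

text \<open>Induction on the number of critical levels strictly between a and b, cutting at one of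
  them.\<close>

lemma fibre_value_mono:
  assumes "a < b" "0 \<le> a" "ereal b \<le> len"
  shows "fibre_value a 1 - fibre_value b (-1) \<in> M"
  using assms
proof (induction "card {t \<in> crit. a < t \<and> t < b}" arbitrary: a b rule: less_induct)
  case less
  show ?case
  proof (cases "crit_free a b")
    case True
    then show ?thesis using fibre_value_between less.prems by blast
  next
    case False
    then obtain t where t: "t \<in> crit" "a < t" "t < b" by (auto simp: crit_free_def)
    have tl: "ereal t < len" using t(3) less.prems(3) by (metis less_ereal.simps(1) order_less_le_trans)
    have fin: "finite {t \<in> crit. a < t \<and> t < b}" using finite_crit by simp
    have "card {u \<in> crit. a < u \<and> u < t} < card {t \<in> crit. a < t \<and> t < b}"
      by (rule psubset_card_mono[OF fin]) (use t in auto)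
    from less.hyps[OF this t(2) less.prems(2)] have 1: "fibre_value a 1 - fibre_value t (-1) \<in> M" using tl by simp
    have "card {u \<in> crit. t < u \<and> u < b} < card {t \<in> crit. a < t \<and> t < b}"
      by (rule psubset_card_mono[OF fin]) (use t in auto)
    from less.hyps[OF this t(3) _ less.prems(3)] have 2: "fibre_value t 1 - fibre_value b (-1) \<in> M"
      using t less.prems by simp
    have "fibre_value t 1 = fibre_value t (-1)" using fibre_value_cross t tl less.prems by simp
    then show ?thesis using add_subgroupD(4)[OF M 1 2] by simp
  qed
qed

lemma fibre_value_const:
  assumes "admissible t s" "admissible t' s'"
  shows "fibre_value t s - fibre_value t' s' \<in> M"
proof -
  have base: "fibre_value 0 1 - fibre_value t s \<in> M" if h: "admissible t s" for t s
  proof -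
    consider "s = 1" "t = 0" | "s = 1" "0 < t" "ereal t < len" | "s = -1" "0 < t" "ereal t \<le> len"
      using h by (cases "t = 0") (auto simp: admissible_def)
    then show ?thesis
    proof cases
      case 1
      then show ?thesis using add_subgroupD(1)[OF M] by simp
    next
      case 2
      then show ?thesis using fibre_value_mono[of 0 t] fibre_value_cross[of t] by simp
    next
      case 3
      then show ?thesis using fibre_value_mono[of 0 t] by simp
    qed
  qed
  from add_subgroupD(2)[OF M base[OF assms(2)] base[OF assms(1)]] show ?thesis by simp
qed

end

section \<open>Fibres of a family\<close>

context edge_complex
begin

definition fibre_fun :: "real \<Rightarrow> real \<Rightarrow> real ^ 'g \<Rightarrow> int" where
  "fibre_fun t s x = (\<Sum>P | P \<in> reps \<and> active P t s. wm P * int (card {\<gamma>\<in>\<Gamma>. x - \<gamma> \<in> slice P t}))"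

lemma fibre_fun_eq:
  "(\<Sum>P | P \<in> X \<and> aff_dim P = 2 \<and> x \<in> slice P t \<and> active P t s. w P * fibre_index P) = fibre_fun t s x"
proof -
  define Q where "Q P \<longleftrightarrow> x \<in> slice P t \<and> active P t s" for P
  have Q_shift: "{\<gamma>\<in>G. Q ((+) \<gamma> ` P)} = (if active P t s then (\<lambda>\<gamma>. (\<gamma>, 0)) ` {\<gamma>\<in>\<Gamma>. x - \<gamma> \<in> slice P t} else {})" for P
  proof -
    have "Q (shift \<gamma> P) \<longleftrightarrow> x - \<gamma> \<in> slice P t \<and> active P t s" for \<gamma>
    proof -
      have "x \<in> slice (shift \<gamma> P) t \<longleftrightarrow> x - \<gamma> \<in> slice P t" unfolding slice_def by (simp add: mem_shift)
      then show ?thesis by (simp add: Q_def)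
    qed
    then show ?thesis by auto
  qed
  have fin: "finite {\<gamma>\<in>\<Gamma>. x - \<gamma> \<in> slice P t}" if "P \<in> reps" for P
    using reps_cells2[OF that] compact_slice
    by (intro finite_translates) (auto simp: cells2_def intro: compact_imp_bounded)
  have "(\<Sum>P | P \<in> X \<and> aff_dim P = 2 \<and> x \<in> slice P t \<and> active P t s. w P * fibre_index P)
      = (\<Sum>P | P \<in> cells2 \<and> Q P. wm P)"
    by (rule sum.cong) (auto simp: cells2_def Q_def wm_def)
  also have "\<dots> = (\<Sum>P\<in>reps. wm P * int (card {\<gamma>\<in>G. Q ((+) \<gamma> ` P)}))"
  proof (rule sum_orbits[OF G reps])
    show "(+) \<gamma> ` P \<in> cells2" if "P \<in> cells2" "\<gamma> \<in> G" for P \<gamma> using that shift_cells2 by auto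
    show "\<gamma> = 0" if "P \<in> cells2" "\<gamma> \<in> G" "(+) \<gamma> ` P = P" for P \<gamma>
      by (rule translate_free[of P]) (use that in \<open>auto simp: cells2_def\<close>)
    show "wm ((+) \<gamma> ` P) = wm P" if "P \<in> cells2" "\<gamma> \<in> G" for P \<gamma>
      using that wm_shift by (auto simp: cells2_def)
    show "finite {\<gamma>\<in>G. Q ((+) \<gamma> ` P)}" if "P \<in> reps" for P unfolding Q_shift using fin[OF that] by simp
  qed
  also have "\<dots> = (\<Sum>P\<in>reps. if active P t s then wm P * int (card {\<gamma>\<in>\<Gamma>. x - \<gamma> \<in> slice P t}) else 0)"
    unfolding Q_shift by (rule sum.cong) (auto simp: card_image inj_on_def)
  also have "\<dots> = fibre_fun t s x"
    unfolding fibre_fun_def using sum.inter_filter[OF reps(1), symmetric] by simp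
  finally show ?thesis .
qed

text \<open>A limit point lies in P since P is closed, and the nonempty slices nearby show that P
  reaches to this side. Conversely, the segment from (x, t) to a point of P on this side crosses all
  nearby levels close to x.\<close>

lemma set_limit_slice:
  assumes P: "P \<in> X" and s: "s = 1 \<or> s = -1" and D: "D \<noteq> bot"
    "\<And>e. 0 < e \<Longrightarrow> eventually (\<lambda>u. 0 < s * (u - t) \<and> s * (u - t) < e) D"
  shows "x \<in> set_limit D (slice P) \<longleftrightarrow> x \<in> slice P t \<and> active P t s"
proof
  assume x: "x \<in> set_limit D (slice P)"
  have near: "\<exists>y u. (y, u) \<in> P \<and> dist y x < e \<and> 0 < s * (u - t) \<and> s * (u - t) < e" if "0 < e" for e
  proof -
    have "eventually (\<lambda>u. \<exists>y\<in>slice P u. dist y x < e) D" using x that by (simp add: set_limit_def)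
    from eventually_happens'[OF D(1) eventually_conj[OF this D(2)[OF that]]] show ?thesis
      by (auto simp: slice_def)
  qed
  have "(x, t) \<in> closure P"
    unfolding closure_approachable
  proof (intro allI impI)
    fix e :: real assume e: "0 < e"
    obtain y u where y: "(y, u) \<in> P" "dist y x < e / 2" "0 < s * (u - t)" "s * (u - t) < e / 2"
      using near[of "e / 2"] e by auto
    have "dist u t < e / 2" using y(3,4) s by (auto simp: dist_real_def)
    then have "dist (y, u) (x, t) < e"
      using y(2) sqrt_sum_squares_le_sum[of "dist y x" "dist u t"] by (simp add: dist_Pair_Pair)
    then show "\<exists>y\<in>P. dist y (x, t) < e" using y(1) by blast
  qed
  then have "(x, t) \<in> P" using closed_cell[OF P] by simp
  moreover obtain y u where "(y, u) \<in> P" "0 < s * (u - t)" using near[of 1] by auto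
  ultimately show "x \<in> slice P t \<and> active P t s" unfolding active_def by (force simp: slice_def)
next
  assume *: "x \<in> slice P t \<and> active P t s"
  then obtain y where y: "y \<in> P" "0 < s * (snd y - t)" by (auto simp: active_def)
  have xP: "(x, t) \<in> P" using * by (simp add: slice_def)
  show "x \<in> set_limit D (slice P)"
    unfolding set_limit_def mem_Collect_eq
  proof (intro allI impI)
    fix e :: real assume e: "0 < e"
    define d where "d = s * (snd y - t)"
    define N where "N = norm (fst y - x) + 1"
    have N: "0 < N" "norm (fst y - x) < N" by (simp_all add: N_def add_nonneg_pos)
    have d: "0 < d" using y by (simp add: d_def)
    have "eventually (\<lambda>u. 0 < s * (u - t) \<and> s * (u - t) < min d (e * d / N)) D"
      by (rule D(2)) (use e d N in simp)
    then show "eventually (\<lambda>u. \<exists>z\<in>slice P u. dist z x < e) D"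
    proof (rule eventually_mono)
      fix u assume u: "0 < s * (u - t) \<and> s * (u - t) < min d (e * d / N)"
      define \<theta> where "\<theta> = s * (u - t) / d"
      have \<theta>: "0 \<le> \<theta>" "\<theta> \<le> 1" using u d by (auto simp: \<theta>_def)
      have "(1 - \<theta>) *\<^sub>R (x, t) + \<theta> *\<^sub>R y \<in> P"
        using \<theta> by (intro convexD[OF convex_cell[OF P] xP y(1)]) auto
      moreover have "(1 - \<theta>) *\<^sub>R (x, t) + \<theta> *\<^sub>R y = (x + \<theta> *\<^sub>R (fst y - x), u)"
      proof -
        have "\<theta> * (snd y - t) = u - t" using s d y(2) by (auto simp: \<theta>_def d_def)
        then show ?thesis by (simp add: prod_eq_iff algebra_simps)
      qed
      ultimately have mem: "x + \<theta> *\<^sub>R (fst y - x) \<in> slice P u" by (simp add: slice_def)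
      have "dist (x + \<theta> *\<^sub>R (fst y - x)) x = \<theta> * norm (fst y - x)" using \<theta>(1) by (simp add: dist_norm)
      also have "\<dots> \<le> \<theta> * N" using \<theta>(1) N by (intro mult_left_mono) auto
      also have "\<dots> < e" using u d N by (simp add: \<theta>_def field_simps)
      finally show "\<exists>z\<in>slice P u. dist z x < e" using mem by blast
    qed
  qed
qed

lemma limit_fibre:
  assumes "s = 1 \<or> s = -1" "D \<noteq> bot" "\<And>e. 0 < e \<Longrightarrow> eventually (\<lambda>u. 0 < s * (u - t) \<and> s * (u - t) < e) D"
  shows "(\<Sum>P | P \<in> X \<and> aff_dim P = 2 \<and> x \<in> set_limit D (slice P). w P * fibre_index P) = fibre_fun t s x"
  unfolding fibre_fun_eq[symmetric] using set_limit_slice[OF _ assms] by (intro sum.cong) auto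

lemma eventually_right: "0 < e \<Longrightarrow> eventually (\<lambda>u. 0 < 1 * (u - t) \<and> 1 * (u - t) < e) (at_right t)" for t :: real
  unfolding eventually_at_right_field by (intro exI[of _ "t + e"]) auto

lemma eventually_left: "0 < e \<Longrightarrow> eventually (\<lambda>u. 0 < - 1 * (u - t) \<and> - 1 * (u - t) < e) (at_left t)" for t :: real
  unfolding eventually_at_left_field by (intro exI[of _ "t - e"]) auto

text \<open>A cell that meets level t without reaching above it would have a contracted face there.
  So the set-theoretic fibre is the limit from above.\<close>

lemma transversal_fibre:
  assumes t: "0 < t" "ereal t < len" and nc: "\<forall>P\<in>X. snd ` P \<noteq> {t}"
  shows "(\<Sum>P | P \<in> X \<and> aff_dim P = 2 \<and> x \<in> slice P t. w P * fibre_index P) = fibre_fun t 1 x"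
proof -
  have "active P t 1" if P: "P \<in> X" "x \<in> slice P t" for P
  proof (rule ccontr)
    assume "\<not> active P t 1"
    then have "\<not> 0 < 1 * (snd y - t)" if "y \<in> P" for y using P(2) that unfolding active_def by blast
    then have le: "snd y \<le> t" if "y \<in> P" for y using that by fastforce
    have "slice P t \<times> {t} face_of P" using level_face[OF P(1)] le by blast
    from face[OF P(1) this, of "(x, t)"] have "slice P t \<times> {t} \<in> X" using P(2) t by simp
    moreover have "snd ` (slice P t \<times> {t}) = {t}" using P(2) by auto
    ultimately show False using nc by blast
  qed
  then show ?thesis unfolding fibre_fun_eq[symmetric] by (intro sum.cong) auto
qed

text \<open>Cells are products near infinity, and as there are finitely many orbits a common
  threshold T exists. Slices are constant from T on, so the fibre over the infinite point already
  appears at the finite level T.\<close>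

lemma top_fibre:
  assumes prod: "\<And>P. P \<in> X \<Longrightarrow> \<exists>T Q. P \<inter> UNIV \<times> {T..} = Q \<times> {T..}"
  obtains T where "0 \<le> T"
    "\<And>x. (\<Sum>P | P \<in> X \<and> aff_dim P = 2 \<and> x \<in> set_limit at_top (slice P). w P * fibre_index P) = fibre_fun T 1 x"
proof -
  obtain F where F: "finite F" "F \<subseteq> X" "\<forall>P\<in>X. \<exists>P'\<in>F. \<exists>\<gamma>\<in>G. P = (+) \<gamma> ` P'"
    using periodic unfolding periodic_finite_def by (elim conjE exE)
  have "\<exists>T. \<forall>u\<ge>T. slice P u = slice P T" if P: "P \<in> X" for P
  proof -
    obtain T Q where TQ: "P \<inter> UNIV \<times> {T..} = Q \<times> {T..}" using prod[OF P] by blast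
    have "slice P u = Q" if "T \<le> u" for u
    proof -
      have "x \<in> slice P u \<longleftrightarrow> (x, u) \<in> P \<inter> UNIV \<times> {T..}" for x using that by (simp add: slice_def)
      also have "(x, u) \<in> P \<inter> UNIV \<times> {T..} \<longleftrightarrow> x \<in> Q" for x unfolding TQ using that by simp
      finally show ?thesis by blast
    qed
    then show ?thesis by auto
  qed
  then obtain \<tau> where \<tau>: "\<And>P u. P \<in> X \<Longrightarrow> \<tau> P \<le> u \<Longrightarrow> slice P u = slice P (\<tau> P)" by metis
  define T where "T = Max (insert 0 (\<tau> ` F))"
  have T0: "0 \<le> T" unfolding T_def by (rule Max_ge) (use F(1) in auto)
  have const: "slice P u = slice P T" if P: "P \<in> X" and u: "T \<le> u" for P u
  proof -
    obtain P' \<gamma> where P': "P' \<in> F" "\<gamma> \<in> G" "P = (+) \<gamma> ` P'" using bspec[OF F(3) P] by (elim bexE)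
    obtain g where g: "\<gamma> = (g, 0)" using P'(2) by auto
    have "\<tau> P' \<le> T" unfolding T_def by (rule Max_ge) (use F(1) P'(1) in auto)
    then have "slice P' u = slice P' T" using \<tau>[of P' u] \<tau>[of P' T] P'(1) F(2) u by auto
    then show ?thesis unfolding P'(3) g slice_translate by simp
  qed
  have lim: "x \<in> set_limit at_top (slice P) \<longleftrightarrow> x \<in> slice P T \<and> active P T 1" if P: "P \<in> X" for P x
  proof -
    have "eventually (\<lambda>u. \<exists>y\<in>slice P u. dist y x < e) at_top \<longleftrightarrow> (\<exists>y\<in>slice P T. dist y x < e)" for e
    proof
      assume "eventually (\<lambda>u. \<exists>y\<in>slice P u. dist y x < e) at_top"
      then have "eventually (\<lambda>u. T \<le> u \<and> (\<exists>y\<in>slice P u. dist y x < e)) at_top"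
        by (intro eventually_conj eventually_ge_at_top)
      from eventually_happens'[OF _ this] obtain u where u: "T \<le> u" "\<exists>y\<in>slice P u. dist y x < e"
        using trivial_limit_at_top_linorder by blast
      show "\<exists>y\<in>slice P T. dist y x < e" using u(2) unfolding const[OF P u(1)] .
    next
      assume *: "\<exists>y\<in>slice P T. dist y x < e"
      show "eventually (\<lambda>u. \<exists>y\<in>slice P u. dist y x < e) at_top"
      proof (rule eventually_mono[OF eventually_ge_at_top[of T]])
        fix u assume u: "T \<le> u"
        show "\<exists>y\<in>slice P u. dist y x < e" unfolding const[OF P u] by (rule *)
      qed
    qed
    then have "x \<in> set_limit at_top (slice P) \<longleftrightarrow> x \<in> closure (slice P T)"
      by (simp add: set_limit_def closure_approachable)
    also have "\<dots> \<longleftrightarrow> x \<in> slice P T" using compact_imp_closed[OF compact_slice[OF P]] by simp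
    also have "\<dots> \<longleftrightarrow> x \<in> slice P T \<and> active P T 1"
    proof -
      have "active P T 1" if "x \<in> slice P T"
      proof -
        have "(x, T + 1) \<in> P" using const[OF P, of "T + 1"] that by (auto simp: slice_def)
        then show ?thesis using that unfolding active_def by (auto intro!: bexI[of _ "(x, T + 1)"])
      qed
      then show ?thesis by blast
    qed
    finally show ?thesis .
  qed
  show thesis
  proof (rule that[OF T0])
    fix x
    show "(\<Sum>P | P \<in> X \<and> aff_dim P = 2 \<and> x \<in> set_limit at_top (slice P). w P * fibre_index P) = fibre_fun T 1 x"
      unfolding fibre_fun_eq[symmetric] using lim by (intro sum.cong) auto
  qed
qed

end

section \<open>The family over the whole curve S\<close>

locale torus_family = tropical_torus \<Gamma> \<Omega> M r
  for \<Gamma> :: "(real ^ 'g) set" and \<Omega> M r +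
  fixes S :: "('v, 'e) mgraph" and W :: "('v, 'e, real ^ 'g) prod_complex"
  assumes graph: "metric_graph S" and cycle: "algebraic_cycle \<Gamma> S 2 W"
begin

lemma edge_props:
  assumes e: "e \<in> edges S"
  shows "periodic_finite (\<Gamma> \<times> {0}) (ecells W e) (eweight W e)"
    and "\<And>P. P \<in> ecells W e \<Longrightarrow> edge_cell S e P"
    and "\<And>P F. P \<in> ecells W e \<Longrightarrow> F face_of P \<Longrightarrow> F \<noteq> {} \<Longrightarrow> over_end S (e, b) F \<Longrightarrow> fst ` F \<in> vcells W (source S (e, b))"
    and "\<And>P F. P \<in> ecells W e \<Longrightarrow> F face_of P \<Longrightarrow> F \<noteq> {} \<Longrightarrow> (\<And>b. \<not> over_end S (e, b) F) \<Longrightarrow> F \<in> ecells W e"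
    and "\<And>P P'. P \<in> ecells W e \<Longrightarrow> P' \<in> ecells W e \<Longrightarrow> P \<inter> P' face_of P"
    and "\<And>\<rho>. \<rho> \<in> ecells W e \<Longrightarrow> aff_dim \<rho> = 1 \<Longrightarrow> balanced_at_edge_cell 2 W e \<rho>"
  using cycle e unfolding algebraic_cycle_def is_prod_complex_def by force+

lemma edge_complex_edge:
  assumes e: "e \<in> edges S"
  shows "edge_complex \<Gamma> \<Omega> M r (ecells W e) (eweight W e) (len S e)"
proof (unfold_locales)
  note p = edge_props[OF e]
  show "periodic_finite (\<Gamma> \<times> {0}) (ecells W e) (eweight W e)" by (rule p(1))
  fix P assume P: "P \<in> ecells W e"
  note ec = p(2)[OF P, unfolded edge_cell_def]
  show "P \<noteq> {} \<and> polyhedron P \<and> bounded (fst ` P) \<and> rational_slope edge_lattice P" using ec by blast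
  show "0 \<le> snd y \<and> ereal (snd y) \<le> len S e" if "y \<in> P" for y using ec that by blast
  show "\<exists>y\<in>P. snd y \<noteq> t" if t: "ereal t \<in> {0, len S e}" for t
  proof -
    have "\<not> over_end S (e, False) P" "\<not> over_end S (e, True) P" using ec by blast+
    then show ?thesis using t by (auto simp: over_end_def end_pos_def)
  qed
  show "F \<in> ecells W e" if F: "F face_of P" "y \<in> F" "0 < snd y" "ereal (snd y) < len S e" for F y
  proof (rule p(4)[OF P F(1)])
    show "F \<noteq> {}" using F by auto
    fix b show "\<not> over_end S (e, b) F" using F(2-4) by (cases b) (force simp: over_end_def end_pos_def)+
  qed
  show "P \<inter> P' face_of P" if "P' \<in> ecells W e" for P' by (rule p(5)[OF P that])
next
  fix \<rho> assume "\<rho> \<in> ecells W e" "aff_dim \<rho> = 1"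
  from edge_props(6)[OF e this] show "\<exists>n. (\<forall>\<tau>\<in>{\<tau> \<in> ecells W e. aff_dim \<tau> = 2 \<and> \<rho> \<subseteq> \<tau>}. primitive_normal edge_lattice \<rho> \<tau> (n \<tau>)) \<and>
        (\<Sum>\<tau>\<in>{\<tau> \<in> ecells W e. aff_dim \<tau> = 2 \<and> \<rho> \<subseteq> \<tau>}. of_int (eweight W e \<tau>) *\<^sub>R n \<tau>) \<in> direction \<rho>"
    by (simp add: balanced_at_edge_cell_def Let_def)
qed

abbreviation edge_value :: "'e \<Rightarrow> real \<Rightarrow> real \<Rightarrow> real" where
  "edge_value e \<equiv> edge_complex.fibre_value \<Gamma> \<Omega> r (ecells W e) (eweight W e)"

abbreviation edge_fibre :: "'e \<Rightarrow> real \<Rightarrow> real \<Rightarrow> real ^ 'g \<Rightarrow> int" where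
  "edge_fibre e \<equiv> edge_complex.fibre_fun \<Gamma> (ecells W e) (eweight W e)"

abbreviation edge_admissible :: "'e \<Rightarrow> real \<Rightarrow> real \<Rightarrow> bool" where
  "edge_admissible e \<equiv> edge_complex.admissible (len S e)"

lemma len_pos: "e \<in> edges S \<Longrightarrow> 0 < len S e"
  using graph by (simp add: metric_graph_def)

lemma fibre_is_edge_fibre:
  assumes f: "is_fibre S 1 W s f" and s: "s \<in> points S"
  obtains e t \<sigma> where "e \<in> edges S" "edge_admissible e t \<sigma>" "f = edge_fibre e t \<sigma>"
  using f
proof (cases rule: is_fibre.cases)
  case (transversal e t)
  have e: "e \<in> edges S" and t: "0 < t" "ereal t < len S e" using s transversal(1) by (auto simp: points_def)
  interpret edge_complex \<Gamma> \<Omega> M r "ecells W e" "eweight W e" "len S e" by (rule edge_complex_edge[OF e])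
  have "f = fibre_fun t 1"
    unfolding transversal(2) using transversal_fibre[OF t transversal(3)] by (intro ext) simp
  moreover have "admissible t 1" using t by (simp add: admissible_def)
  ultimately show thesis using that e by blast
next
  case (limit e D)
  have e: "e \<in> edges S"
    using limit(2) s by (cases s) (auto simp: half_edges_def points_def)
  interpret edge_complex \<Gamma> \<Omega> M r "ecells W e" "eweight W e" "len S e" by (rule edge_complex_edge[OF e])
  have right: thesis if "D = at_right t" "admissible t 1" for t
  proof -
    have "f = fibre_fun t 1"
      unfolding limit(1) that(1) using limit_fibre[OF disjI1[OF refl] trivial_limit_at_right_real eventually_right]
      by (intro ext) simp
    then show thesis using \<open>admissible t 1\<close> \<open>\<And>e t \<sigma>. e \<in> edges S \<Longrightarrow> edge_admissible e t \<sigma> \<Longrightarrow> f = edge_fibre e t \<sigma> \<Longrightarrow> thesis\<close> e by blast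
  qed
  have left: thesis if "D = at_left t" "admissible t (-1)" for t
  proof -
    have "f = fibre_fun t (-1)"
      unfolding limit(1) that(1) using limit_fibre[OF disjI2[OF refl] trivial_limit_at_left_real eventually_left]
      by (intro ext) simp
    then show thesis using \<open>admissible t (-1)\<close> \<open>\<And>e t \<sigma>. e \<in> edges S \<Longrightarrow> edge_admissible e t \<sigma> \<Longrightarrow> f = edge_fibre e t \<sigma> \<Longrightarrow> thesis\<close> e by blast
  qed
  show thesis
  proof (cases s)
    case (EPoint e' t)
    then have e': "e' = e" "D = at_left t \<or> D = at_right t" using limit(2) by auto
    have "0 < t" "ereal t < len S e" using s EPoint e'(1) by (auto simp: points_def)
    then have "admissible t 1" "admissible t (-1)" by (auto simp: admissible_def)
    then show thesis using e'(2) left right by blast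
  next
    case (VPoint v)
    then obtain h where h: "h \<in> half_edges S v" "e = fst h" "D = (if \<not> snd h then at_right 0
        else if len S (fst h) = \<infinity> then at_top else at_left (real_of_ereal (len S (fst h))))"
      using limit(2) by auto
    consider "\<not> snd h" | "snd h" "len S e = \<infinity>" | "snd h" "len S e \<noteq> \<infinity>" by blast
    then show thesis
    proof cases
      case 1
      then show thesis using right[of 0] h(3) len_pos[OF e] by (simp add: admissible_def zero_ereal_def)
    next
      case 2
      have "\<exists>T Q. P \<inter> UNIV \<times> {T..} = Q \<times> {T..}" if "P \<in> ecells W e" for P
        using edge_props(2)[OF e that] 2(2) by (auto simp: edge_cell_def)
      then obtain T where T: "0 \<le> T"
        "\<And>x. (\<Sum>P | P \<in> ecells W e \<and> aff_dim P = 2 \<and> x \<in> set_limit at_top (slice P). eweight W e P * fibre_index P) = fibre_fun T 1 x"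
        by (rule top_fibre) (assumption | rule that)+
      have "f = fibre_fun T 1" unfolding limit(1) using T(2) 2 h by (intro ext) simp
      moreover have "admissible T 1" unfolding admissible_def using T(1) 2(2) by simp
      ultimately show thesis using that e by blast
    next
      case 3
      have "ereal (real_of_ereal (len S e)) = len S e" "0 < real_of_ereal (len S e)"
        using len_pos[OF e] 3(2) by (cases "len S e"; simp)+
      then have "admissible (real_of_ereal (len S e)) (-1)" unfolding admissible_def by simp
      moreover have "D = at_left (real_of_ereal (len S e))" using h 3 by simp
      ultimately show thesis using left by blast
    qed
  qed
qed

section \<open>Passing through a vertex of S\<close>

lemma vertex_props:
  assumes v: "v \<in> verts S"
  shows "periodic_finite \<Gamma> (vcells W v) (vweight W v)"
    and "\<And>P. P \<in> vcells W v \<Longrightarrow> P \<noteq> {} \<and> polytope P"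
    and "\<And>P P'. P \<in> vcells W v \<Longrightarrow> P' \<in> vcells W v \<Longrightarrow> P \<inter> P' face_of P"
    and "\<And>\<rho>. \<rho> \<in> vcells W v \<Longrightarrow> aff_dim \<rho> = 1 \<Longrightarrow> balanced_at_vertex_cell S 2 W v \<rho>"
proof -
  note c = cycle[unfolded algebraic_cycle_def is_prod_complex_def]
  note vc = bspec[OF conjunct1[OF conjunct1[OF c]] v]
  show "periodic_finite \<Gamma> (vcells W v) (vweight W v)" by (rule conjunct1[OF conjunct2[OF vc]])
  note cells = conjunct2[OF conjunct2[OF vc]]
  show "P \<noteq> {} \<and> polytope P" if "P \<in> vcells W v" for P
    using bspec[OF cells that] by (elim conjE) (intro conjI)
  show "P \<inter> P' face_of P" if "P \<in> vcells W v" "P' \<in> vcells W v" for P P'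
    using bspec[OF cells that(1)] by (elim conjE) (rule bspec[OF _ that(2)])
  show "balanced_at_vertex_cell S 2 W v \<rho>" if "\<rho> \<in> vcells W v" "aff_dim \<rho> = 1" for \<rho>
    using bspec[OF bspec[OF conjunct2[OF conjunct2[OF c]] v] that(1)] that(2) by simp
qed

definition end_sign :: "'e \<times> bool \<Rightarrow> real" where
  "end_sign h = (if snd h then - 1 else 1)"

text \<open>Over an end of an edge all cells lie on one side, and their slices there are cells of
  the complex over v. The value thus depends only on the weight collected at each 1-cell over v, and
  this weight is expressed by the outgoing components of the normals in the balancing
  condition.\<close>

lemma end_value:
  assumes v: "v \<in> verts S" "valence S v \<noteq> 1" and h: "h \<in> half_edges S v"
    and R: "finite R" "transversal (translates \<Gamma>) {Q \<in> vcells W v. aff_dim Q = 1} R"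
  shows "edge_admissible (fst h) (real_of_ereal (end_pos S h)) (end_sign h)"
    "edge_value (fst h) (real_of_ereal (end_pos S h)) (end_sign h) = (\<Sum>Q\<in>R. segment_value Q *
      of_int (\<Sum>P\<in>{\<tau> \<in> ecells W (fst h). aff_dim \<tau> = 2 \<and> Q \<times> {real_of_ereal (end_pos S h)} \<subseteq> \<tau>}.
        eweight W (fst h) P * fibre_index P))"
    "\<And>Q P n. Q \<in> vcells W v \<Longrightarrow> aff_dim Q = 1 \<Longrightarrow> P \<in> ecells W (fst h) \<Longrightarrow> aff_dim P = 2 \<Longrightarrow>
      Q \<times> {real_of_ereal (end_pos S h)} \<subseteq> P \<Longrightarrow>
      primitive_normal edge_lattice (Q \<times> {real_of_ereal (end_pos S h)}) P n \<Longrightarrow>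
      (if snd h then - snd n else snd n) = of_int (fibre_index P)"
proof -
  define e where "e = fst h"
  define t where "t = real_of_ereal (end_pos S h)"
  define s where "s = end_sign h"
  have e: "e \<in> edges S" and src: "source S h = v" using h by (auto simp: half_edges_def e_def)
  have he: "h = (e, snd h)" by (simp add: e_def)
  interpret edge_complex \<Gamma> \<Omega> M r "ecells W e" "eweight W e" "len S e" by (rule edge_complex_edge[OF e])
  have s1: "s = 1 \<or> s = -1" by (simp add: s_def end_sign_def)
  \<comment> \<open>An infinite edge has its head at a 1-valent vertex, which is excluded. So the
    end position is finite and not the 0 that \<open>real_of_ereal\<close> makes of
    \<infinity>.\<close>
  have fin: "len S e \<noteq> \<infinity>" if "snd h"
  proof -
    have "head S e = v" using src that he by (metis source_def fst_conv snd_conv)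
    then show ?thesis using graph e v(2) by (auto simp: metric_graph_def)
  qed
  have t_eq: "ereal t = end_pos S h"
    using fin len_pos[OF e] by (cases "len S e") (auto simp: t_def end_pos_def e_def zero_ereal_def)
  have t_cases: "snd h \<and> ereal t = len S e \<and> s = -1 \<or> \<not> snd h \<and> t = 0 \<and> s = 1"
    using t_eq by (auto simp: end_pos_def e_def s_def end_sign_def zero_ereal_def)
  have adm: "admissible t s"
  proof -
    have "0 < t" if "ereal t = len S e" using len_pos[OF e] unfolding that[symmetric] by simp
    then show ?thesis using t_cases len_pos[OF e] unfolding admissible_def by (auto simp: zero_ereal_def)
  qed
  then show "edge_admissible (fst h) (real_of_ereal (end_pos S h)) (end_sign h)"
    unfolding e_def t_def s_def .
  have side: "0 \<le> s * (snd y - t)" if "P \<in> ecells W e" "y \<in> P" for P y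
  proof -
    have "snd y \<le> t" if "ereal t = len S e"
      using range[OF \<open>P \<in> ecells W e\<close> \<open>y \<in> P\<close>] unfolding that[symmetric] by simp
    then show ?thesis using range[OF that] t_cases by auto
  qed
  have one_sided: "\<not> active P t (- s)" if "P \<in> ecells W e" for P
    using side[OF that] unfolding active_def by fastforce
  have act: "active P t s" if P: "P \<in> ecells W e" "slice P t \<noteq> {}" for P
  proof -
    have "ereal t \<in> {0, len S e}" using t_cases by (auto simp: zero_ereal_def)
    then obtain y where y: "y \<in> P" "snd y \<noteq> t" using proper[OF P(1)] by blast
    then have "s * (snd y - t) \<noteq> 0" using s1 by auto
    then have "0 < s * (snd y - t)" using side[OF P(1) y(1)] by linarith
    then show ?thesis using P(2) y(1) unfolding active_def by blast
  qed
  have level: "slice P t \<times> {t} face_of P" if P: "P \<in> ecells W e" for P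
  proof (rule level_face[OF P])
    show "(\<forall>y\<in>P. snd y \<le> t) \<or> (\<forall>y\<in>P. t \<le> snd y)" using s1 side[OF P] by auto
  qed
  have level_vcell: "slice P t \<in> vcells W v" if P: "P \<in> ecells W e" "slice P t \<noteq> {}" for P
  proof -
    have "over_end S (e, snd h) (slice P t \<times> {t})" using t_eq he by (auto simp: over_end_def)
    from edge_props(3)[OF e P(1) level[OF P(1)] _ this] P(2) have "fst ` (slice P t \<times> {t}) \<in> vcells W (source S (e, snd h))"
      by auto
    moreover have "fst ` (slice P t \<times> {t}) = slice P t" by force
    ultimately show ?thesis using src he by simp
  qed
  have level_dim: "aff_dim (slice P t) < 2" if P: "P \<in> cells2" "slice P t \<noteq> {}" for P
  proof -
    have PX: "P \<in> ecells W e" "aff_dim P = 2" using P(1) by (simp_all add: cells2_def)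
    obtain y where y: "y \<in> P" "0 < s * (snd y - t)" using act[OF PX(1) P(2)] by (auto simp: active_def)
    have "slice P t \<times> {t} \<noteq> P"
    proof
      assume "slice P t \<times> {t} = P"
      then have "y \<in> slice P t \<times> {t}" using y(1) by simp
      then show False using y(2) by (auto simp: mem_Times_iff)
    qed
    then show ?thesis
      using face_of_aff_dim_lt[OF convex_cell[OF PX(1)] level[OF PX(1)]] PX(2) by (simp add: aff_dim_times_singleton)
  qed
  \<comment> \<open>In the complex over v the 1-cell Q is a face of the slice, which has dimension
    at most 1 as well.\<close>
  have slice_eq: "slice P t = Q" if Q: "Q \<in> vcells W v" "aff_dim Q = 1" and P: "P \<in> cells2" "Q \<times> {t} \<subseteq> P" for P Q
  proof -
    have Qs: "Q \<subseteq> slice P t" using P(2) by (auto simp: slice_def)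
    then have ne: "slice P t \<noteq> {}" using vertex_props(2)[OF v(1) Q(1)] by blast
    have PX: "P \<in> ecells W e" using P(1) by (simp add: cells2_def)
    have "Q face_of slice P t"
      using vertex_props(3)[OF v(1) level_vcell[OF PX ne] Q(1)] Qs by (simp add: Int_absorb1)
    then show ?thesis
      using face_of_aff_dim_lt[OF convex_slice[OF PX], of Q t] Q(2) level_dim[OF P(1) ne] by fastforce
  qed
  define B where "B = {Q \<in> vcells W v. aff_dim Q = 1}"
  have B1: "(+) \<gamma> ` Q \<in> B" if "Q \<in> B" "\<gamma> \<in> \<Gamma>" for Q \<gamma>
    using that vertex_props(1)[OF v(1)] by (auto simp: B_def periodic_finite_def aff_dim_translation_eq)
  have B2: "bounded Q \<and> Q \<noteq> {}" if "Q \<in> B" for Q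
    using that vertex_props(2)[OF v(1)] by (auto simp: B_def intro: polytope_imp_bounded)
  have B3: "slice P t \<in> B" if "P \<in> cells2" "active P t s" "\<not> active P t (- s)" "aff_dim (slice P t) = 1" for P
    using that level_vcell by (auto simp: B_def cells2_def active_def)
  have "fibre_value t s = (\<Sum>P | P \<in> reps \<and> active P t s \<and> \<not> active P t (- s). of_int (wm P) * segment_value (slice P t))"
    unfolding fibre_value_def
    by (rule sum.cong) (use one_sided reps_cells2 in \<open>auto simp: cells2_def\<close>)
  also have "\<dots> = (\<Sum>Q\<in>R. segment_value Q * of_int (\<Sum>P | P \<in> cells2 \<and> active P t s \<and> \<not> active P t (- s) \<and> slice P t = Q. wm P))"
    by (rule one_sided_sum[OF B1 B2 R(1) _ B3]) (use R(2) B_def in auto)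
  also have "\<dots> = (\<Sum>Q\<in>R. segment_value Q *
      of_int (\<Sum>P\<in>{\<tau> \<in> ecells W e. aff_dim \<tau> = 2 \<and> Q \<times> {t} \<subseteq> \<tau>}. eweight W e P * fibre_index P))"
  proof (rule sum.cong[OF refl])
    fix Q assume "Q \<in> R"
    then have Q: "Q \<in> vcells W v" "aff_dim Q = 1" using transversal_subset[OF R(2)] by auto
    have "{P. P \<in> cells2 \<and> active P t s \<and> \<not> active P t (- s) \<and> slice P t = Q} =
        {\<tau> \<in> ecells W e. aff_dim \<tau> = 2 \<and> Q \<times> {t} \<subseteq> \<tau>}"
    proof (intro equalityI subsetI)
      fix P assume "P \<in> {P. P \<in> cells2 \<and> active P t s \<and> \<not> active P t (- s) \<and> slice P t = Q}"
      then show "P \<in> {\<tau> \<in> ecells W e. aff_dim \<tau> = 2 \<and> Q \<times> {t} \<subseteq> \<tau>}" by (auto simp: cells2_def slice_def)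
    next
      fix P assume "P \<in> {\<tau> \<in> ecells W e. aff_dim \<tau> = 2 \<and> Q \<times> {t} \<subseteq> \<tau>}"
      then have P: "P \<in> cells2" "Q \<times> {t} \<subseteq> P" "P \<in> ecells W e" by (auto simp: cells2_def)
      have eq: "slice P t = Q" by (rule slice_eq[OF Q P(1,2)])
      moreover have "slice P t \<noteq> {}" using vertex_props(2)[OF v(1) Q(1)] eq by simp
      ultimately show "P \<in> {P. P \<in> cells2 \<and> active P t s \<and> \<not> active P t (- s) \<and> slice P t = Q}"
        using P act one_sided by blast
    qed
    then show "segment_value Q * of_int (\<Sum>P | P \<in> cells2 \<and> active P t s \<and> \<not> active P t (- s) \<and> slice P t = Q. wm P) =
      segment_value Q * of_int (\<Sum>P\<in>{\<tau> \<in> ecells W e. aff_dim \<tau> = 2 \<and> Q \<times> {t} \<subseteq> \<tau>}. eweight W e P * fibre_index P)"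
      by (simp add: wm_def)
  qed
  finally show "edge_value (fst h) (real_of_ereal (end_pos S h)) (end_sign h) = (\<Sum>Q\<in>R. segment_value Q *
      of_int (\<Sum>P\<in>{\<tau> \<in> ecells W (fst h). aff_dim \<tau> = 2 \<and> Q \<times> {real_of_ereal (end_pos S h)} \<subseteq> \<tau>}.
        eweight W (fst h) P * fibre_index P))"
    unfolding e_def t_def s_def .
  fix Q P n
  assume Q: "Q \<in> vcells W v" "aff_dim Q = 1" and "P \<in> ecells W (fst h)" "aff_dim P = 2"
    "Q \<times> {real_of_ereal (end_pos S h)} \<subseteq> P"
    "primitive_normal edge_lattice (Q \<times> {real_of_ereal (end_pos S h)}) P n"
  then have P': "P \<in> ecells W e" "aff_dim P = 2" "Q \<times> {t} \<subseteq> P" "primitive_normal edge_lattice (Q \<times> {t}) P n"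
    unfolding e_def t_def by simp_all
  then have "P \<in> cells2" by (simp add: cells2_def)
  note P = this P'(1,3,4)
  have eq: "slice P t = Q" by (rule slice_eq[OF Q P(1,3)])
  then have ne: "slice P t \<noteq> {}" using vertex_props(2)[OF v(1) Q(1)] by simp
  have f: "Q \<times> {t} face_of P" using level[OF P(2)] eq by simp
  have d: "aff_dim (Q \<times> {t}) = 1" using Q(2) by (simp add: aff_dim_times_singleton)
  note lf = level_face_normal[OF P(1) f d P(4)]
  have "0 < s * snd n" using lf(3)[of s] act[OF P(2) ne] by blast
  then show "(if snd h then - snd n else snd n) = of_int (fibre_index P)"
    using lf(1) t_cases by (auto simp: abs_if split: if_splits)
qed

text \<open>Balancing at a 1-cell over v demands equal outgoing components along all half-edges, so
  the values at the ends of the edges meeting in v are equal. Along an edge the value is constant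
  modulo \<open>M\<close>, so it may be read off at the tail, whichever end lies at v.\<close>

lemma vertex_edge_values:
  assumes v: "v \<in> verts S" and h: "h \<in> half_edges S v" "h' \<in> half_edges S v"
  shows "edge_value (fst h) 0 1 - edge_value (fst h') 0 1 \<in> M"
proof (cases "valence S v = 1")
  case True
  then have "h = h'" using h unfolding valence_def by (metis card_1_singletonE singletonD)
  then show ?thesis using add_subgroupD(1)[OF M] by simp
next
  case False
  obtain R where R: "finite R" "transversal (translates \<Gamma>) {Q \<in> vcells W v. aff_dim Q = 1} R"
  proof (rule periodic_finite_transversal[OF \<Gamma> vertex_props(1)[OF v], of "{Q \<in> vcells W v. aff_dim Q = 1}"])
    show "(+) \<gamma> ` Q \<in> {Q \<in> vcells W v. aff_dim Q = 1}" if "Q \<in> {Q \<in> vcells W v. aff_dim Q = 1}" "\<gamma> \<in> \<Gamma>" for Q \<gamma>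
      using that vertex_props(1)[OF v] by (auto simp: periodic_finite_def aff_dim_translation_eq)
  qed (auto intro: that)
  let ?t = "\<lambda>h. real_of_ereal (end_pos S h)"
  let ?star = "\<lambda>h Q. {\<tau> \<in> ecells W (fst h). aff_dim \<tau> = 2 \<and> Q \<times> {?t h} \<subseteq> \<tau>}"
  let ?N = "\<lambda>h Q. \<Sum>P\<in>?star h Q. eweight W (fst h) P * fibre_index P"
  have "?N h Q = ?N h' Q" if Q: "Q \<in> R" for Q
  proof -
    have Qv: "Q \<in> vcells W v" "aff_dim Q = 1" using Q transversal_subset[OF R(2)] by auto
    note b = vertex_props(4)[OF v Qv, unfolded balanced_at_vertex_cell_def Let_def of_nat_numeral]
    obtain n c where n': "\<forall>h\<in>half_edges S v. \<forall>\<tau>\<in>?star h Q. primitive_normal edge_lattice (Q \<times> {?t h}) \<tau> (n h \<tau>)"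
      and c': "\<forall>h\<in>half_edges S v.
        (\<Sum>\<tau>\<in>?star h Q. of_int (eweight W (fst h) \<tau>) * (if snd h then - snd (n h \<tau>) else snd (n h \<tau>))) = c"
      using b by (elim exE conjE) (rule that)
    note n = bspec[OF bspec[OF n']] and c = bspec[OF c']
    have "of_int (?N h Q) = c" if hv: "h \<in> half_edges S v" for h
    proof -
      have "of_int (?N h Q) = (\<Sum>\<tau>\<in>?star h Q. of_int (eweight W (fst h) \<tau>) * (if snd h then - snd (n h \<tau>) else snd (n h \<tau>)))"
        unfolding of_int_sum
      proof (rule sum.cong[OF refl])
        fix \<tau> assume \<tau>: "\<tau> \<in> ?star h Q"
        have "(if snd h then - snd (n h \<tau>) else snd (n h \<tau>)) = of_int (fibre_index \<tau>)"
          using \<tau> by (intro end_value(3)[OF v False hv R Qv _ _ _ n[OF hv \<tau>]]) auto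
        then show "of_int (eweight W (fst h) \<tau> * fibre_index \<tau>) =
            of_int (eweight W (fst h) \<tau>) * (if snd h then - snd (n h \<tau>) else snd (n h \<tau>))" by simp
      qed
      then show ?thesis using c[OF hv] by simp
    qed
    from this[OF h(1)] this[OF h(2)] show ?thesis by linarith
  qed
  then have eq: "edge_value (fst h) (?t h) (end_sign h) = edge_value (fst h') (?t h') (end_sign h')"
    unfolding end_value(2)[OF v False h(1) R] end_value(2)[OF v False h(2) R] by (intro sum.cong) auto
  have edge: "edge_value (fst h) (?t h) (end_sign h) - edge_value (fst h) 0 1 \<in> M" if hv: "h \<in> half_edges S v" for h
  proof -
    have e: "fst h \<in> edges S" using hv by (simp add: half_edges_def)
    interpret edge_complex \<Gamma> \<Omega> M r "ecells W (fst h)" "eweight W (fst h)" "len S (fst h)"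
      by (rule edge_complex_edge[OF e])
    show ?thesis
      by (rule fibre_value_const[OF end_value(1)[OF v False hv R]])
        (use len_pos[OF e] in \<open>simp add: admissible_def zero_ereal_def\<close>)
  qed
  from add_subgroupD(2)[OF M edge[OF h(2)] edge[OF h(1)]] show ?thesis unfolding eq by simp
qed

text \<open>One value represents the entire edge modulo \<open>M\<close>, so only the vertices along
  the walk have to be passed.\<close>

lemma walk_edge_values:
  assumes "walk S u hs v" "u \<in> verts S" "h \<in> half_edges S u" "h' \<in> half_edges S v"
  shows "edge_value (fst h) 0 1 - edge_value (fst h') 0 1 \<in> M"
  using assms
proof (induction hs arbitrary: u h)
  case Nil
  then show ?case using vertex_edge_values by simp
next
  case (Cons k hs)
  have k: "fst k \<in> edges S" "source S k = u" "walk S (target S k) hs v" using Cons.prems(1) by simp_all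
  have "k \<in> half_edges S u" using k by (simp add: half_edges_def)
  then have 1: "edge_value (fst h) 0 1 - edge_value (fst k) 0 1 \<in> M"
    using vertex_edge_values Cons.prems by blast
  have "(fst k, \<not> snd k) \<in> half_edges S (target S k)" using k(1) by (simp add: half_edges_def target_def)
  moreover have "target S k \<in> verts S" using graph k(1) by (auto simp: metric_graph_def target_def source_def)
  ultimately have "edge_value (fst k) 0 1 - edge_value (fst h') 0 1 \<in> M"
    using Cons.IH[OF k(3), of "(fst k, \<not> snd k)"] Cons.prems(4) by simp
  from add_subgroupD(4)[OF M 1 this] show ?case by simp
qed

lemma edge_values_agree:
  assumes "e \<in> edges S" "edge_admissible e t \<sigma>" "e' \<in> edges S" "edge_admissible e' t' \<sigma>'"
  shows "edge_value e t \<sigma> - edge_value e' t' \<sigma>' \<in> M"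
proof -
  have base: "edge_value e t \<sigma> - edge_value e 0 1 \<in> M" if e: "e \<in> edges S" "edge_admissible e t \<sigma>" for e t \<sigma>
  proof -
    interpret edge_complex \<Gamma> \<Omega> M r "ecells W e" "eweight W e" "len S e" by (rule edge_complex_edge[OF e(1)])
    show ?thesis
      by (rule fibre_value_const[OF e(2)])
        (use len_pos[OF e(1)] in \<open>simp add: admissible_def zero_ereal_def\<close>)
  qed
  have t: "tail S e \<in> verts S" "tail S e' \<in> verts S" using graph assms(1,3) by (auto simp: metric_graph_def)
  then obtain hs where hs: "walk S (tail S e) hs (tail S e')" using graph unfolding metric_graph_def by blast
  have "edge_value e 0 1 - edge_value e' 0 1 \<in> M"
    using walk_edge_values[OF hs t(1), of "(e, False)" "(e', False)"] assms(1,3)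
    by (simp add: half_edges_def source_def)
  from add_subgroupD(2)[OF M add_subgroupD(4)[OF M base[OF assms(1,2)] this] base[OF assms(3,4)]]
  show ?thesis by simp
qed

end

section \<open>Algebraically equivalent cycles have equal invariants\<close>

context edge_complex
begin

lemma fibre_segments:
  obtains p l where
    "\<And>P. P \<in> reps \<Longrightarrow> active P t s \<Longrightarrow> 0 \<le> l P \<and> slice P t = closed_segment (p P) (p P + l P *\<^sub>R lvec P)"
proof -
  have "\<exists>p l. P \<in> reps \<and> active P t s \<longrightarrow> 0 \<le> l \<and> slice P t = closed_segment p (p + l *\<^sub>R lvec P)" for P
  proof (cases "P \<in> reps \<and> active P t s")
    case True
    obtain p l where "0 \<le> l" "slice P t = closed_segment p (p + l *\<^sub>R lvec P)"
      by (rule active_slice_segment[OF reps_cells2 conjunct2[OF True]]) (use True in \<open>simp_all add: that\<close>)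
    then show ?thesis by blast
  qed blast
  then have "\<exists>p l. \<forall>P. P \<in> reps \<and> active P t s \<longrightarrow> 0 \<le> l P \<and> slice P t = closed_segment (p P) (p P + l P *\<^sub>R lvec P)"
    by metis
  then show thesis using that by blast
qed

text \<open>From here on a fibre is just a finite weighted family of segments, which can be compared
  with any other such family.\<close>

lemma fibre_segment_family:
  obtains A :: "((real ^ 'g) \<times> real) set set" and c p v l where "finite A" "\<And>P. P \<in> A \<Longrightarrow> primitive_vec (v P)" "\<And>P. P \<in> A \<Longrightarrow> 0 \<le> l P"
    "\<And>x. fibre_fun t s x = (\<Sum>P\<in>A. c P * int (card {\<gamma>\<in>\<Gamma>. x - \<gamma> \<in> closed_segment (p P) (p P + l P *\<^sub>R v P)}))"
    "fibre_value t s = (\<Sum>P\<in>A. of_int (c P) * (K (v P) (p P) - K (v P) (p P + l P *\<^sub>R v P)))"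
proof -
  obtain p l where pl: "\<And>P. P \<in> reps \<Longrightarrow> active P t s \<Longrightarrow>
      0 \<le> l P \<and> slice P t = closed_segment (p P) (p P + l P *\<^sub>R lvec P)"
    by (rule fibre_segments) (rule that)
  show thesis
  proof (rule that[of "{P. P \<in> reps \<and> active P t s}" lvec l wm p])
    show "finite {P. P \<in> reps \<and> active P t s}" using reps(1) by simp
    show "primitive_vec (lvec P)" if "P \<in> {P. P \<in> reps \<and> active P t s}" for P
      using that lvec(1) reps_cells2 by simp
    show "0 \<le> l P" if "P \<in> {P. P \<in> reps \<and> active P t s}" for P using that pl by simp
    show "fibre_fun t s x = (\<Sum>P\<in>{P. P \<in> reps \<and> active P t s}.
        wm P * int (card {\<gamma>\<in>\<Gamma>. x - \<gamma> \<in> closed_segment (p P) (p P + l P *\<^sub>R lvec P)}))" for x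
      unfolding fibre_fun_def by (rule sum.cong) (use pl in auto)
    show "fibre_value t s = (\<Sum>P\<in>{P. P \<in> reps \<and> active P t s}.
        of_int (wm P) * (K (lvec P) (p P) - K (lvec P) (p P + l P *\<^sub>R lvec P)))"
      unfolding fibre_value_def
    proof (rule sum.cong[OF refl])
      fix P assume "P \<in> {P. P \<in> reps \<and> active P t s}"
      then have P: "P \<in> reps" "active P t s" by simp_all
      note h = pl[OF P]
      show "of_int (wm P) * segment_value (slice P t) =
        of_int (wm P) * (K (lvec P) (p P) - K (lvec P) (p P + l P *\<^sub>R lvec P))"
        using h segment_value_eq[OF lvec(1)[OF reps_cells2[OF P(1)]], of "l P" "p P"] by simp
    qed
  qed
qed

end

text \<open>The segments of both fibres and of the given cycle form one family, with signs that make
  its weight function vanish off a thin set. \<open>segment_weights_vanish\<close> then equates the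
  value of the cycle with a difference of two fibre values, which lies in \<open>M\<close>.\<close>

lemma (in torus_family) cycle_invariant:
  fixes p v :: "'i \<Rightarrow> real ^ 'g"
  assumes f: "is_fibre S 1 W s\<^sub>1 f\<^sub>1" "s\<^sub>1 \<in> points S" "is_fibre S 1 W s\<^sub>2 f\<^sub>2" "s\<^sub>2 \<in> points S"
    and I: "finite I" "\<And>i. i \<in> I \<Longrightarrow> primitive_vec (v i)" "\<And>i. i \<in> I \<Longrightarrow> 0 \<le> l i"
    and eq: "cycle_eq \<Gamma> 1 (\<lambda>x. f\<^sub>1 x - f\<^sub>2 x)
      (\<lambda>x. \<Sum>i\<in>I. w i * int (card {\<gamma>\<in>\<Gamma>. x - \<gamma> \<in> closed_segment (p i) (p i + l i *\<^sub>R v i)}))"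
  shows "(\<Sum>i\<in>I. of_int (w i) * (K (v i) (p i) - K (v i) (p i + l i *\<^sub>R v i))) \<in> M"
proof -
  obtain e t \<sigma> where e: "e \<in> edges S" "edge_admissible e t \<sigma>" "f\<^sub>1 = edge_fibre e t \<sigma>"
    by (rule fibre_is_edge_fibre[OF f(1,2)]) (rule that)
  obtain e' t' \<sigma>' where e': "e' \<in> edges S" "edge_admissible e' t' \<sigma>'" "f\<^sub>2 = edge_fibre e' t' \<sigma>'"
    by (rule fibre_is_edge_fibre[OF f(3,4)]) (rule that)
  let ?seg = "\<lambda>p v l x. int (card {\<gamma>\<in>\<Gamma>. x - \<gamma> \<in> closed_segment p (p + l *\<^sub>R v)})"
  obtain A :: "((real ^ 'g) \<times> real) set set" and p1 v1 l1 w1 where A: "finite A" "\<And>P. P \<in> A \<Longrightarrow> primitive_vec (v1 P)" "\<And>P. P \<in> A \<Longrightarrow> 0 \<le> l1 P"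
    "\<And>x. edge_fibre e t \<sigma> x = (\<Sum>P\<in>A. w1 P * ?seg (p1 P) (v1 P) (l1 P) x)"
    "edge_value e t \<sigma> = (\<Sum>P\<in>A. of_int (w1 P) * (K (v1 P) (p1 P) - K (v1 P) (p1 P + l1 P *\<^sub>R v1 P)))"
    by (rule edge_complex.fibre_segment_family[OF edge_complex_edge[OF e(1)], of t \<sigma>]) (rule that; assumption)
  obtain B :: "((real ^ 'g) \<times> real) set set" and p2 v2 l2 w2 where B: "finite B" "\<And>P. P \<in> B \<Longrightarrow> primitive_vec (v2 P)" "\<And>P. P \<in> B \<Longrightarrow> 0 \<le> l2 P"
    "\<And>x. edge_fibre e' t' \<sigma>' x = (\<Sum>P\<in>B. w2 P * ?seg (p2 P) (v2 P) (l2 P) x)"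
    "edge_value e' t' \<sigma>' = (\<Sum>P\<in>B. of_int (w2 P) * (K (v2 P) (p2 P) - K (v2 P) (p2 P + l2 P *\<^sub>R v2 P)))"
    by (rule edge_complex.fibre_segment_family[OF edge_complex_edge[OF e'(1)], of t' \<sigma>']) (rule that; assumption)
  obtain N where N: "finite N" "\<And>Q. Q \<in> N \<Longrightarrow> aff_dim Q < 1"
    "\<And>x. (\<And>Q \<gamma>. Q \<in> N \<Longrightarrow> \<gamma> \<in> \<Gamma> \<Longrightarrow> x \<notin> (+) \<gamma> ` Q) \<Longrightarrow> f\<^sub>1 x - f\<^sub>2 x = (\<Sum>i\<in>I. w i * ?seg (p i) (v i) (l i) x)"
    using eq unfolding cycle_eq_def by auto
  \<comment> \<open>Polytopes of dimension less than 1 are points or empty, so the exceptional set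
    consists of the translates of finitely many points.\<close>
  define E where "E = {z. {z} \<in> N}"
  have "E \<subseteq> the_elem ` N" unfolding E_def by (auto intro: image_eqI[of _ _ "{_}"])
  then have finE: "finite E" using N(1) finite_surj by blast
  define w' where "w' = case_sum (case_sum w1 (\<lambda>P. - w2 P)) (\<lambda>i. - w i)"
  define p' where "p' = case_sum (case_sum p1 p2) p"
  define v' where "v' = case_sum (case_sum v1 v2) v"
  define l' where "l' = case_sum (case_sum l1 l2) l"
  have "(\<Sum>i\<in>(A <+> B) <+> I. of_int (w' i) * (K (v' i) (p' i) - K (v' i) (p' i + l' i *\<^sub>R v' i))) = 0"
  proof (rule segment_weights_vanish[OF _ _ _ finE])
    show "finite ((A <+> B) <+> I)" using A(1) B(1) I(1) by simp
    show "primitive_vec (v' i)" "0 \<le> l' i" if "i \<in> (A <+> B) <+> I" for i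
      using that A(2,3) B(2,3) I(2,3) by (auto simp: v'_def l'_def)
    fix x assume x: "\<And>e. e \<in> E \<Longrightarrow> x - e \<notin> \<Gamma>"
    have "f\<^sub>1 x - f\<^sub>2 x = (\<Sum>i\<in>I. w i * ?seg (p i) (v i) (l i) x)"
    proof (rule N(3))
      fix Q \<gamma> assume Q: "Q \<in> N" "\<gamma> \<in> \<Gamma>"
      show "x \<notin> (+) \<gamma> ` Q"
      proof
        assume "x \<in> (+) \<gamma> ` Q"
        then obtain z where z: "z \<in> Q" "x = \<gamma> + z" by blast
        have "Q \<noteq> {}" using z(1) by blast
        then have "aff_dim Q \<noteq> -1" by (simp add: aff_dim_empty)
        then have "aff_dim Q = 0" using N(2)[OF Q(1)] aff_dim_geq[of Q] by linarith
        from aff_dim_eq_0[THEN iffD1, OF this] obtain a where a: "Q = {a}" by (elim exE)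
        then have "Q = {z}" using z(1) by simp
        then have "z \<in> E" using Q(1) by (simp add: E_def)
        then show False using x[of z] z(2) Q(2) by simp
      qed
    qed
    then show "(\<Sum>i\<in>(A <+> B) <+> I. w' i * ?seg (p' i) (v' i) (l' i) x) = 0"
      unfolding e(3) e'(3) A(4) B(4) using A(1) B(1) I(1)
      by (simp add: sum.Plus w'_def p'_def v'_def l'_def sum_negf)
  qed
  then have "(\<Sum>i\<in>I. of_int (w i) * (K (v i) (p i) - K (v i) (p i + l i *\<^sub>R v i))) = edge_value e t \<sigma> - edge_value e' t' \<sigma>'"
    unfolding A(5) B(5) using A(1) B(1) I(1)
    by (simp add: sum.Plus w'_def p'_def v'_def l'_def sum_negf)
  then show ?thesis using edge_values_agree[OF e(1,2) e'(1,2)] by simp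
qed

section \<open>The complete graph on four vertices\<close>

lemma edges_K4: "edges (K4 l) = {(0, 1), (0, 2), (0, 3), (1, 2), (1, 3), (2, 3)}"
proof -
  have "i < j \<and> j < 4 \<longleftrightarrow> (i, j) \<in> {(0, 1), (0, 2), (0, 3), (1, 2), (1, 3), (2::nat, 3::nat)}" for i j :: nat
    by auto
  then show ?thesis by (auto simp: K4_def)
qed

lemma verts_K4: "verts (K4 l) = {0, 1, 2, 3}"
  by (auto simp: K4_def)

lemma ends_K4: "tail (K4 l) e = fst e" "head (K4 l) e = snd e" "source (K4 l) (e, b) = (if b then snd e else fst e)"
    "target (K4 l) (e, b) = (if b then fst e else snd e)"
  by (simp_all add: K4_def source_def target_def)

lemma len_K4: "len (K4 l) e = ereal (K4_len l e)"
  by (simp add: K4_def)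

lemma mem_half_edges_K4: "h \<in> half_edges (K4 l) v \<longleftrightarrow>
    fst h \<in> {(0, 1), (0, 2), (0, 3), (1, 2), (1, 3), (2, 3)} \<and> (if snd h then snd (fst h) else fst (fst h)) = v"
  by (cases h) (simp add: half_edges_def ends_K4 edges_K4)

lemma half_edges_K4:
  "half_edges (K4 l) 0 = {((0, 1), False), ((0, 2), False), ((0, 3), False)}"
  "half_edges (K4 l) 1 = {((0, 1), True), ((1, 2), False), ((1, 3), False)}"
  "half_edges (K4 l) 2 = {((0, 2), True), ((1, 2), True), ((2, 3), False)}"
  "half_edges (K4 l) 3 = {((0, 3), True), ((1, 3), True), ((2, 3), True)}"
proof -
  show "half_edges (K4 l) 0 = {((0, 1), False), ((0, 2), False), ((0, 3), False)}"
    by (rule set_eqI, unfold mem_half_edges_K4, case_tac x, case_tac b, auto)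
  show "half_edges (K4 l) 1 = {((0, 1), True), ((1, 2), False), ((1, 3), False)}"
    by (rule set_eqI, unfold mem_half_edges_K4, case_tac x, case_tac b, auto)
  show "half_edges (K4 l) 2 = {((0, 2), True), ((1, 2), True), ((2, 3), False)}"
    by (rule set_eqI, unfold mem_half_edges_K4, case_tac x, case_tac b, auto)
  show "half_edges (K4 l) 3 = {((0, 3), True), ((1, 3), True), ((2, 3), True)}"
    by (rule set_eqI, unfold mem_half_edges_K4, case_tac x, case_tac b, auto)
qed

text \<open>The equations at the vertices 1, 2 and 3 express the edges at vertex 0 through the other
  three, and they imply the equation at 0.\<close>

lemma integral_forms_K4:
  "c \<in> integral_forms (K4 l) \<longleftrightarrow> (\<forall>e. e \<notin> edges (K4 l) \<longrightarrow> c e = 0) \<and>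
    c (0, 1) = c (1, 2) + c (1, 3) \<and> c (0, 2) = c (2, 3) - c (1, 2) \<and> c (0, 3) = - c (1, 3) - c (2, 3)"
proof -
  have "c \<in> integral_forms (K4 l) \<longleftrightarrow> (\<forall>e. e \<notin> edges (K4 l) \<longrightarrow> c e = 0) \<and>
    c (0, 1) + c (0, 2) + c (0, 3) = 0 \<and> - c (0, 1) + c (1, 2) + c (1, 3) = 0 \<and>
    - c (0, 2) - c (1, 2) + c (2, 3) = 0 \<and> - c (0, 3) - c (1, 3) - c (2, 3) = 0"
    unfolding integral_forms_def mem_Collect_eq verts_K4
    by (simp add: half_edges_K4 half_edges_K4(2)[unfolded One_nat_def] algebra_simps)
  also have "\<dots> \<longleftrightarrow> (\<forall>e. e \<notin> edges (K4 l) \<longrightarrow> c e = 0) \<and>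
    c (0, 1) = c (1, 2) + c (1, 3) \<and> c (0, 2) = c (2, 3) - c (1, 2) \<and> c (0, 3) = - c (1, 3) - c (2, 3)"
    by (rule conj_cong[OF refl], rule iffI) (elim conjE, intro conjI; linarith)+
  finally show ?thesis .
qed

text \<open>The fundamental cycles of the spanning tree given by the star of the vertex \<open>0\<close>.\<close>

definition cotree_form :: "3 \<Rightarrow> nat \<times> nat \<Rightarrow> int" where
  "cotree_form j e =
     (if e = (0, 1) then of_bool (j = 1) + of_bool (j = 2)
      else if e = (0, 2) then of_bool (j = 3) - of_bool (j = 1)
      else if e = (0, 3) then - of_bool (j = 2) - of_bool (j = 3)
      else if e = (1, 2) then of_bool (j = 1) else if e = (1, 3) then of_bool (j = 2)
      else if e = (2, 3) then of_bool (j = 3) else 0)"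

lemma cotree_form_mem: "cotree_form j \<in> integral_forms (K4 l)"
  unfolding integral_forms_K4 edges_K4 by (auto simp: cotree_form_def)

text \<open>Every fundamental cycle is an integral combination of the basis \<omega>, and its
  coefficients turn the coordinates of a functional into its values on the fundamental cycles. All
  computations can then be done in these coordinates, whatever \<omega> is.\<close>

lemma cotree_coordinates:
  fixes \<omega> :: "3 \<Rightarrow> nat \<times> nat \<Rightarrow> int"
  assumes "forms_basis (K4 l) \<omega>"
  obtains C :: "real ^ 3 \<Rightarrow> real ^ 3" where "linear C" "\<And>x. x \<in> int_vectors \<Longrightarrow> C x \<in> int_vectors"
    "\<And>e j. C (edge_vec \<omega> e) $ j = of_int (cotree_form j e)"
proof -
  have "\<exists>c :: 3 \<Rightarrow> int. \<forall>e. cotree_form j e = (\<Sum>i\<in>UNIV. c i * \<omega> i e)" for j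
    using assms cotree_form_mem unfolding forms_basis_def by blast
  then obtain c :: "3 \<Rightarrow> 3 \<Rightarrow> int" where c: "\<And>j e. cotree_form j e = (\<Sum>i\<in>UNIV. c j i * \<omega> i e)" by metis
  define C where "C x = (\<chi> j. \<Sum>i\<in>UNIV. of_int (c j i) * x $ i)" for x :: "real ^ 3"
  show thesis
  proof (rule that[of C])
    show "linear C"
      by (rule linearI) (simp_all add: C_def vec_eq_iff algebra_simps sum.distrib sum_distrib_left)
    show "C x \<in> int_vectors" if "x \<in> int_vectors" for x
      using that by (auto simp: C_def int_vectors_def intro!: Ints_sum Ints_mult)
    show "C (edge_vec \<omega> e) $ j = of_int (cotree_form j e)" for e j
      by (simp add: C_def edge_vec_def c)
  qed
qed

section \<open>Minors of the period matrix and generic lengths\<close>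

definition triple :: "real ^ 3 \<Rightarrow> real ^ 3 \<Rightarrow> real ^ 3 \<Rightarrow> real" where
  "triple x y z = x $ 1 * (y $ 2 * z $ 3 - y $ 3 * z $ 2) + x $ 2 * (y $ 3 * z $ 1 - y $ 1 * z $ 3)
     + x $ 3 * (y $ 1 * z $ 2 - y $ 2 * z $ 1)"

text \<open>The rows of the period matrix in the basis of fundamental cycles: an entry is the total
  length of the edges common to two cycles, counted with sign.\<close>

definition period_vec :: "real ^ 6 \<Rightarrow> 3 \<Rightarrow> real ^ 3" where
  "period_vec l j =
     (if j = 1 then vector [l $ 4 + l $ 1 + l $ 2, l $ 1, - l $ 2]
      else if j = 2 then vector [l $ 1, l $ 5 + l $ 1 + l $ 3, l $ 3]
      else vector [- l $ 2, l $ 3, l $ 6 + l $ 2 + l $ 3])"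

lemma period_vec_simps:
  "period_vec l 1 = vector [l $ 4 + l $ 1 + l $ 2, l $ 1, - l $ 2]"
  "period_vec l 2 = vector [l $ 1, l $ 5 + l $ 1 + l $ 3, l $ 3]"
  "period_vec l 3 = vector [- l $ 2, l $ 3, l $ 6 + l $ 2 + l $ 3]"
  by (simp_all add: period_vec_def)

text \<open>Pairing an integral vector with the cross product of two rows gives an integer
  combination of their 2 \<times> 2 minors.\<close>

definition minor_group :: "real ^ 6 \<Rightarrow> real set" where
  "minor_group l = {triple (period_vec l 1) (period_vec l 2) u + triple (period_vec l 1) (period_vec l 3) v
     + triple (period_vec l 2) (period_vec l 3) w |u v w. u \<in> int_vectors \<and> v \<in> int_vectors \<and> w \<in> int_vectors}"

lemma triple_linear:
  "triple (x + y) u v = triple x u v + triple y u v" "triple (c *\<^sub>R x) u v = c * triple x u v"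
  "triple u (x + y) v = triple u x v + triple u y v" "triple u (c *\<^sub>R x) v = c * triple u x v"
  "triple u v (x + y) = triple u v x + triple u v y" "triple u v (c *\<^sub>R x) = c * triple u v x"
  "triple u v (x - y) = triple u v x - triple u v y"
  by (simp_all add: triple_def algebra_simps)

lemma triple_swap: "triple x y z = - triple y x z" "triple x y z = - triple x z y"
  by (simp_all add: triple_def algebra_simps)

lemma add_subgroup_minor_group: "add_subgroup (minor_group l)"
  unfolding add_subgroup_def
proof (intro conjI ballI)
  note Z = add_subgroupD[OF add_subgroup_int_vectors]
  have "triple x y 0 = 0" for x y by (simp add: triple_def)
  then have "0 = triple (period_vec l 1) (period_vec l 2) 0 + triple (period_vec l 1) (period_vec l 3) 0
      + triple (period_vec l 2) (period_vec l 3) 0" by simp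
  then show "0 \<in> minor_group l" unfolding minor_group_def using Z(1) by blast
  fix x y assume "x \<in> minor_group l" "y \<in> minor_group l"
  then obtain u v w u' v' w' where h: "u \<in> int_vectors" "v \<in> int_vectors" "w \<in> int_vectors"
    "u' \<in> int_vectors" "v' \<in> int_vectors" "w' \<in> int_vectors"
    "x = triple (period_vec l 1) (period_vec l 2) u + triple (period_vec l 1) (period_vec l 3) v + triple (period_vec l 2) (period_vec l 3) w"
    "y = triple (period_vec l 1) (period_vec l 2) u' + triple (period_vec l 1) (period_vec l 3) v' + triple (period_vec l 2) (period_vec l 3) w'"
    unfolding minor_group_def by blast
  have "x - y = triple (period_vec l 1) (period_vec l 2) (u - u') + triple (period_vec l 1) (period_vec l 3) (v - v')
      + triple (period_vec l 2) (period_vec l 3) (w - w')"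
    by (simp add: h(7,8) triple_linear)
  then show "x - y \<in> minor_group l" unfolding minor_group_def using Z(2) h(1-6) by blast
qed

lemma triple_periods_mem:
  assumes v: "v \<in> int_vectors"
  shows "triple (\<Sum>i\<in>UNIV. of_int (m i) *\<^sub>R period_vec l i) (\<Sum>i\<in>UNIV. of_int (n i) *\<^sub>R period_vec l i) v \<in> minor_group l"
proof -
  have "triple (\<Sum>i\<in>UNIV. of_int (m i) *\<^sub>R period_vec l i) (\<Sum>i\<in>UNIV. of_int (n i) *\<^sub>R period_vec l i) v =
      triple (period_vec l 1) (period_vec l 2) (of_int (m 1 * n 2 - m 2 * n 1) *\<^sub>R v)
      + triple (period_vec l 1) (period_vec l 3) (of_int (m 1 * n 3 - m 3 * n 1) *\<^sub>R v)
      + triple (period_vec l 2) (period_vec l 3) (of_int (m 2 * n 3 - m 3 * n 2) *\<^sub>R v)"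
    by (simp add: sum_3 triple_def algebra_simps)
  then show ?thesis unfolding minor_group_def using int_vectors_of_int_scale[OF v] by blast
qed

text \<open>Each choice of nine integers turns the equation between 2 \<tau> and a combination of
  minors into a polynomial condition on the lengths. There are countably many choices, and none of
  the polynomials is zero.\<close>

lemma generic_minor_group:
  "generic_lengths (\<lambda>l. 2 * (l $ 1 * l $ 2 + l $ 1 * l $ 3 + l $ 2 * l $ 3) \<notin> minor_group l)"
proof -
  \<comment> \<open>A list of nine integers holds the coordinates of three integral vectors,
    starting at the positions 0, 3 and 6; there are countably many lists of integers.\<close>
  define V :: "int list \<Rightarrow> nat \<Rightarrow> real ^ 3" where
    "V ns k = vector [of_int (ns ! k), of_int (ns ! (k + 1)), of_int (ns ! (k + 2))]" for ns k
  define p :: "int list \<Rightarrow> real ^ 6 \<Rightarrow> real" where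
    "p ns l = 2 * (l $ 1 * l $ 2 + l $ 1 * l $ 3 + l $ 2 * l $ 3) -
       (triple (period_vec l 1) (period_vec l 2) (V ns 0) + triple (period_vec l 1) (period_vec l 3) (V ns 3)
       + triple (period_vec l 2) (period_vec l 3) (V ns 6))" for ns l
  have poly: "real_polynomial_function (p ns)" for ns
    unfolding p_def triple_def period_vec_simps V_def vector_3
    by (rule real_polynomial_function_diff real_polynomial_function_minus real_polynomial_function.intros(3,4,2)
      real_polynomial_function.intros(1)[OF bounded_linear_vec_nth])+
  have nz: "p ns \<noteq> (\<lambda>_. 0)" for ns
  proof
    assume 0: "p ns = (\<lambda>_. 0)"
    \<comment> \<open>At \<open>x 1 2\<close> the polynomial is 2 minus an alternating sum of the
      nine integers. At the other six points \<tau> is 0: \<open>x 4 5\<close>, \<open>x 4 6\<close>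
      and \<open>x 5 6\<close> kill one integer each, and the last three points, which belong to
      pairs of opposite edges, match the remaining integers in pairs so that the alternating sum is
      0.\<close>
    define x :: "6 \<Rightarrow> 6 \<Rightarrow> real ^ 6" where "x i j = axis i 1 + axis j 1" for i j
    have "p ns (x 1 2) = 0" "p ns (x 4 5) = 0" "p ns (x 4 6) = 0" "p ns (x 5 6) = 0"
      "p ns (x 4 3) = 0" "p ns (x 5 2) = 0" "p ns (x 6 1) = 0"
      using 0 by simp_all
    then show False
      unfolding p_def triple_def period_vec_simps V_def vector_3 x_def by (simp add: axis_def)
  qed
  show ?thesis
    unfolding generic_lengths_def
  proof (intro exI[of _ "range p"] conjI ballI allI impI)
    show "countable (range p)" by simp
    fix q assume "q \<in> range p"
    then show "real_polynomial_function q" "q \<noteq> (\<lambda>_. 0)" using poly nz by auto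
  next
    fix l :: "real ^ 6" assume l: "(\<forall>i. 0 < l $ i) \<and> (\<forall>q\<in>range p. q l \<noteq> 0)"
    show "2 * (l $ 1 * l $ 2 + l $ 1 * l $ 3 + l $ 2 * l $ 3) \<notin> minor_group l"
    proof
      assume "2 * (l $ 1 * l $ 2 + l $ 1 * l $ 3 + l $ 2 * l $ 3) \<in> minor_group l"
      then obtain u v w where h: "u \<in> int_vectors" "v \<in> int_vectors" "w \<in> int_vectors"
        "2 * (l $ 1 * l $ 2 + l $ 1 * l $ 3 + l $ 2 * l $ 3) = triple (period_vec l 1) (period_vec l 2) u
          + triple (period_vec l 1) (period_vec l 3) v + triple (period_vec l 2) (period_vec l 3) w"
        unfolding minor_group_def by blast
      have "\<exists>a b c. u = vector [of_int a, of_int b, of_int c]" if "u \<in> int_vectors" for u :: "real ^ 3"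
      proof -
        have "u $ 1 \<in> \<int>" "u $ 2 \<in> \<int>" "u $ 3 \<in> \<int>" using that by (auto simp: int_vectors_def)
        then obtain a b c where "u $ 1 = of_int a" "u $ 2 = of_int b" "u $ 3 = of_int c" by (metis Ints_cases)
        then show ?thesis by (intro exI[of _ a] exI[of _ b] exI[of _ c]) (simp add: vec_eq_iff forall_3 vector_3)
      qed
      then obtain a1 b1 c1 a2 b2 c2 a3 b3 c3 where "u = vector [of_int a1, of_int b1, of_int c1]"
        "v = vector [of_int a2, of_int b2, of_int c2]" "w = vector [of_int a3, of_int b3, of_int c3]"
        using h(1-3) by metis
      then have "u = V [a1, b1, c1, a2, b2, c2, a3, b3, c3] 0" "v = V [a1, b1, c1, a2, b2, c2, a3, b3, c3] 3"
        "w = V [a1, b1, c1, a2, b2, c2, a3, b3, c3] 6"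
        by (simp_all add: V_def eval_nat_numeral)
      then have "p [a1, b1, c1, a2, b2, c2, a3, b3, c3] l = 0" using h(4) by (simp add: p_def)
      then show False using l by blast
    qed
  qed
qed

section \<open>The Abel--Jacobi image of the complete graph\<close>

lemma walk_append: "walk G u hs v \<Longrightarrow> walk G v hs' w \<Longrightarrow> walk G u (hs @ hs') w"
  by (induction hs arbitrary: u) auto

lemma walk_integral_append: "walk_integral G \<omega> (hs @ hs') = walk_integral G \<omega> hs + walk_integral G \<omega> hs'"
  by (simp add: walk_integral_def)

locale K4_curve =
  fixes l :: "real ^ 6" and \<omega> :: "3 \<Rightarrow> nat \<times> nat \<Rightarrow> int" and C :: "real ^ 3 \<Rightarrow> real ^ 3"
  assumes pos: "\<And>i. 0 < l $ i"
    and lin: "linear C"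
    and C_int: "\<And>x. x \<in> int_vectors \<Longrightarrow> C x \<in> int_vectors"
    and C_edge: "\<And>e j. C (edge_vec \<omega> e) $ j = of_int (cotree_form j e)"
begin

lemmas C_linear = linear_add[OF lin] linear_diff[OF lin] linear_scale[OF lin] linear_neg[OF lin] linear_0[OF lin]

abbreviation I :: "nat \<times> nat \<Rightarrow> real ^ 3" where
  "I e \<equiv> K4_len l e *\<^sub>R edge_vec \<omega> e"

lemma edge_integral_K4: "edge_integral (K4 l) \<omega> e = I e"
  by (simp add: edge_integral_def len_K4)

abbreviation \<Gamma> :: "(real ^ 3) set" where
  "\<Gamma> \<equiv> period_lattice (K4 l) \<omega>"

text \<open>Integrals over the triangles 0-1-2, 0-1-3 and 0-2-3; edges are oriented towards the
  larger vertex, hence the minus sign on the way back to 0.\<close>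

definition loop :: "3 \<Rightarrow> real ^ 3" where
  "loop j = (if j = 1 then I (0, 1) - I (0, 2) + I (1, 2) else if j = 2 then I (0, 1) - I (0, 3) + I (1, 3)
     else I (0, 2) - I (0, 3) + I (2, 3))"

lemma loop_simps:
  "loop 1 = I (0, 1) - I (0, 2) + I (1, 2)" "loop 2 = I (0, 1) - I (0, 3) + I (1, 3)"
  "loop 3 = I (0, 2) - I (0, 3) + I (2, 3)"
  by (simp_all add: loop_def)

lemma K4_len_simps:
  "K4_len l (0, 1) = l $ 1" "K4_len l (0, 2) = l $ 2" "K4_len l (0, 3) = l $ 3"
  "K4_len l (1, 2) = l $ 4" "K4_len l (1, 3) = l $ 5" "K4_len l (2, 3) = l $ 6"
  by (simp_all add: K4_len_def)

lemma K4_len_pos: "0 < K4_len l e"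
  using pos by (simp add: K4_len_def)

lemma C_edges:
  "C (edge_vec \<omega> (0, 1)) = vector [1, 1, 0]" "C (edge_vec \<omega> (0, 2)) = vector [-1, 0, 1]"
  "C (edge_vec \<omega> (0, 3)) = vector [0, -1, -1]" "C (edge_vec \<omega> (1, 2)) = vector [1, 0, 0]"
  "C (edge_vec \<omega> (1, 3)) = vector [0, 1, 0]" "C (edge_vec \<omega> (2, 3)) = vector [0, 0, 1]"
  by (simp_all add: vec_eq_iff forall_3 vector_3 C_edge cotree_form_def)

lemma C_loop: "C (loop j) = period_vec l j"
proof -
  have "C (loop 1) = period_vec l 1" "C (loop 2) = period_vec l 2" "C (loop 3) = period_vec l 3"
    unfolding loop_simps period_vec_simps C_linear C_edges K4_len_simps
    by (simp_all add: vec_eq_iff forall_3 vector_3)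
  moreover have "j = 1 \<or> j = 2 \<or> j = 3" using exhaust_3 by blast
  ultimately show ?thesis by metis
qed

text \<open>A cycle is determined by its values on the three edges that avoid vertex 0, and these
  values are arbitrary.\<close>

lemma period_lattice_K4: "\<Gamma> = range (\<lambda>n. \<Sum>j\<in>UNIV. of_int (n j) *\<^sub>R loop j)"
proof (intro equalityI subsetI)
  fix x assume "x \<in> \<Gamma>"
  then obtain c where c: "c \<in> integral_forms (K4 l)" "x = (\<Sum>e\<in>edges (K4 l). of_int (c e) *\<^sub>R I e)"
    by (auto simp: period_lattice_def edge_integral_K4)
  define n where "n j = (if j = 1 then c (1, 2) else if j = 2 then c (1, 3) else c (2, 3))" for j :: 3
  have ns: "n 1 = c (1, 2)" "n 2 = c (1, 3)" "n 3 = c (2, 3)" by (simp_all add: n_def)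
  have f: "c (0, 1) = c (1, 2) + c (1, 3)" "c (0, 2) = c (2, 3) - c (1, 2)" "c (0, 3) = - c (1, 3) - c (2, 3)"
    using c(1) integral_forms_K4 by blast+
  have "x = of_int (c (0, 1)) *\<^sub>R I (0, 1) + of_int (c (0, 2)) *\<^sub>R I (0, 2) + of_int (c (0, 3)) *\<^sub>R I (0, 3)
      + of_int (c (1, 2)) *\<^sub>R I (1, 2) + of_int (c (1, 3)) *\<^sub>R I (1, 3) + of_int (c (2, 3)) *\<^sub>R I (2, 3)"
    unfolding c(2) edges_K4 by (simp add: algebra_simps)
  also have "\<dots> = (\<Sum>j\<in>UNIV. of_int (n j) *\<^sub>R loop j)"
    unfolding sum_3 ns loop_simps f by (simp add: algebra_simps)
  finally show "x \<in> range (\<lambda>n. \<Sum>j\<in>UNIV. of_int (n j) *\<^sub>R loop j)" by (intro range_eqI[of _ _ n])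
next
  fix x assume "x \<in> range (\<lambda>n. \<Sum>j\<in>UNIV. of_int (n j) *\<^sub>R loop j)"
  then obtain n :: "3 \<Rightarrow> int" where x: "x = (\<Sum>j\<in>UNIV. of_int (n j) *\<^sub>R loop j)" by blast
  define c where "c e = (\<Sum>j\<in>UNIV. n j * cotree_form j e)" for e
  have c: "c (0, 1) = n 1 + n 2" "c (0, 2) = n 3 - n 1" "c (0, 3) = - n 2 - n 3"
    "c (1, 2) = n 1" "c (1, 3) = n 2" "c (2, 3) = n 3"
    unfolding c_def unfolding sum_3 by (simp_all add: cotree_form_def)
  have "c e = 0" if "e \<notin> edges (K4 l)" for e
    using that unfolding c_def by (intro sum.neutral) (auto simp: cotree_form_def edges_K4)
  then have "c \<in> integral_forms (K4 l)" unfolding integral_forms_K4 c by simp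
  moreover have "x = (\<Sum>e\<in>edges (K4 l). of_int (c e) *\<^sub>R I e)"
  proof -
    have "x = of_int (c (0, 1)) *\<^sub>R I (0, 1) + of_int (c (0, 2)) *\<^sub>R I (0, 2) + of_int (c (0, 3)) *\<^sub>R I (0, 3)
      + of_int (c (1, 2)) *\<^sub>R I (1, 2) + of_int (c (1, 3)) *\<^sub>R I (1, 3) + of_int (c (2, 3)) *\<^sub>R I (2, 3)"
      unfolding x sum_3 loop_simps c by (simp add: algebra_simps)
    also have "\<dots> = (\<Sum>e\<in>edges (K4 l). of_int (c e) *\<^sub>R I e)" unfolding edges_K4 by (simp add: algebra_simps)
    finally show ?thesis .
  qed
  ultimately show "x \<in> \<Gamma>" by (auto simp: period_lattice_def edge_integral_K4)
qed

lemma add_subgroup_period_lattice: "add_subgroup \<Gamma>"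
  unfolding add_subgroup_def period_lattice_K4
proof (intro conjI ballI)
  show "0 \<in> range (\<lambda>n. \<Sum>j\<in>UNIV. of_int (n j) *\<^sub>R loop j)" by (rule range_eqI[of _ _ "\<lambda>_. 0"]) simp
  fix x y assume "x \<in> range (\<lambda>n. \<Sum>j\<in>UNIV. of_int (n j) *\<^sub>R loop j)" "y \<in> range (\<lambda>n. \<Sum>j\<in>UNIV. of_int (n j) *\<^sub>R loop j)"
  then obtain m n where "x = (\<Sum>j\<in>UNIV. of_int (m j) *\<^sub>R loop j)" "y = (\<Sum>j\<in>UNIV. of_int (n j) *\<^sub>R loop j)" by blast
  then have "x - y = (\<Sum>j\<in>UNIV. of_int (m j - n j) *\<^sub>R loop j)" by (simp add: sum_subtractf scaleR_diff_left)
  then show "x - y \<in> range (\<lambda>n. \<Sum>j\<in>UNIV. of_int (n j) *\<^sub>R loop j)"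
    by (intro range_eqI[of _ _ "\<lambda>j. m j - n j"])
qed

lemma loop_mem: "loop j \<in> \<Gamma>"
proof -
  have "\<forall>j. loop j = (\<Sum>i\<in>UNIV. of_int (of_bool (i = j)) *\<^sub>R loop i)" unfolding sum_3 forall_3 by simp
  then have "loop j = (\<Sum>i\<in>UNIV. of_int (of_bool (i = j)) *\<^sub>R loop i)" by (rule spec)
  then show ?thesis unfolding period_lattice_K4 by (intro range_eqI[of _ _ "\<lambda>i. of_bool (i = j)"])
qed

lemma C_period: "C (\<Sum>j\<in>UNIV. of_int (n j) *\<^sub>R loop j) = (\<Sum>j\<in>UNIV. of_int (n j) *\<^sub>R period_vec l j)"
  by (simp add: linear_sum[OF lin] linear_scale[OF lin] C_loop)

text \<open>Pairing a period with its coefficient vector y gives the sum over the edges of the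
  length times the square of the value of the cycle there. The edges avoiding vertex 0 alone
  contribute at least \<mu> times the squared norm of y, so bounded periods have bounded
  coefficients.\<close>

lemma discrete_period_lattice:
  assumes "bounded B"
  shows "finite (\<Gamma> \<inter> B)"
proof -
  have "bounded (C ` B)" using assms lin by (intro bounded_linear_image linear_conv_bounded_linear[THEN iffD1])
  then obtain b where b: "\<And>x. x \<in> B \<Longrightarrow> norm (C x) \<le> b" unfolding bounded_iff by blast
  define \<mu> where "\<mu> = min (l $ 4) (min (l $ 5) (l $ 6))"
  have \<mu>: "0 < \<mu>" "\<mu> \<le> l $ 4" "\<mu> \<le> l $ 5" "\<mu> \<le> l $ 6" using pos by (auto simp: \<mu>_def)
  define N where "N = \<lceil>b / \<mu>\<rceil>"
  define F where "F = {n :: 3 \<Rightarrow> int. \<forall>j. n j \<in> {- N..N}}"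
  have "F = Pi\<^sub>E UNIV (\<lambda>_. {- N..N})" by (auto simp: F_def PiE_def)
  then have "finite F" by (simp add: finite_PiE)
  moreover have "\<Gamma> \<inter> B \<subseteq> (\<lambda>n. \<Sum>j\<in>UNIV. of_int (n j) *\<^sub>R loop j) ` F"
  proof
    fix x assume x: "x \<in> \<Gamma> \<inter> B"
    then obtain n where n: "x = (\<Sum>j\<in>UNIV. of_int (n j) *\<^sub>R loop j)" by (auto simp: period_lattice_K4)
    have Cx: "C x = (\<Sum>j\<in>UNIV. of_int (n j) *\<^sub>R period_vec l j)" unfolding n C_period ..
    define y :: "real ^ 3" where "y = (\<chi> j. of_int (n j))"
    have "\<mu> * (norm y)\<^sup>2 = \<mu> * (y $ 1)\<^sup>2 + \<mu> * (y $ 2)\<^sup>2 + \<mu> * (y $ 3)\<^sup>2"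
      unfolding power2_norm_eq_inner inner_vec_def sum_3 by (simp add: power2_eq_square algebra_simps)
    also have "\<dots> \<le> l $ 4 * (y $ 1)\<^sup>2 + l $ 5 * (y $ 2)\<^sup>2 + l $ 6 * (y $ 3)\<^sup>2"
      using \<mu> by (intro add_mono mult_right_mono) auto
    also have "\<dots> \<le> \<dots> + (l $ 1 * (y $ 1 + y $ 2)\<^sup>2 + l $ 2 * (y $ 3 - y $ 1)\<^sup>2 + l $ 3 * (y $ 2 + y $ 3)\<^sup>2)"
      using pos[THEN less_imp_le] by simp
    also have "\<dots> = y \<bullet> C x"
      unfolding Cx sum_3 period_vec_simps inner_vec_def
      by (simp add: y_def vector_3 power2_eq_square algebra_simps)
    also have "\<dots> \<le> norm y * norm (C x)" by (rule norm_cauchy_schwarz)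
    also have "\<dots> \<le> norm y * b" using b x by (intro mult_left_mono) auto
    finally have "norm y * (\<mu> * norm y) \<le> norm y * b" by (simp add: power2_eq_square mult_ac)
    moreover have "0 \<le> b" using b x norm_ge_zero order_trans by blast
    ultimately have "\<mu> * norm y \<le> b" by (cases "norm y = 0") (auto simp: mult_le_cancel_left)
    then have ny: "norm y \<le> b / \<mu>" using \<mu>(1) by (simp add: field_simps)
    have "n j \<in> {- N..N}" for j
    proof -
      have "\<bar>real_of_int (n j)\<bar> \<le> norm y" using component_le_norm_cart[of y j] by (simp add: y_def)
      then have "\<bar>real_of_int (n j)\<bar> \<le> of_int N" using ny unfolding N_def by linarith
      then have "\<bar>n j\<bar> \<le> N" by linarith
      then show ?thesis by auto
    qed
    then show "x \<in> (\<lambda>n. \<Sum>j\<in>UNIV. of_int (n j) *\<^sub>R loop j) ` F" using n by (auto simp: F_def)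
  qed
  ultimately show ?thesis using finite_surj by blast
qed

section \<open>The value of the Abel-Jacobi image\<close>

abbreviation \<Omega> :: "real ^ 3 \<Rightarrow> real ^ 3 \<Rightarrow> real ^ 3 \<Rightarrow> real" where
  "\<Omega> x y v \<equiv> triple (C x) (C y) (C v)"

definition class_rep :: "(real ^ 3 \<Rightarrow> real ^ 3) \<Rightarrow> bool" where
  "class_rep \<rho> \<longleftrightarrow> (\<forall>\<gamma>\<in>\<Gamma>. \<forall>x. \<rho> (x + \<gamma>) = \<rho> x) \<and> (\<forall>x. \<rho> x - x \<in> \<Gamma>)"

lemma period_mem: "x \<in> \<Gamma> \<Longrightarrow> y \<in> \<Gamma> \<Longrightarrow> v \<in> int_vectors \<Longrightarrow> \<Omega> x y v \<in> minor_group l"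
  using triple_periods_mem[OF C_int] C_period unfolding period_lattice_K4 by fastforce

lemma torus: "class_rep \<rho> \<Longrightarrow> tropical_torus \<Gamma> \<Omega> (minor_group l) \<rho>"
proof
  show "add_subgroup \<Gamma>" by (rule add_subgroup_period_lattice)
  show "finite (\<Gamma> \<inter> B)" if "bounded B" for B by (rule discrete_period_lattice[OF that])
  show "\<Omega> (x + y) u v = \<Omega> x u v + \<Omega> y u v" for x y u v by (simp add: C_linear triple_linear)
  show "\<Omega> (c *\<^sub>R x) u v = c * \<Omega> x u v" for c x u v by (simp add: C_linear triple_linear)
  show "\<Omega> x y z = - \<Omega> y x z" "\<Omega> x y z = - \<Omega> x z y" for x y z by (rule triple_swap)+
  show "add_subgroup (minor_group l)" by (rule add_subgroup_minor_group)
  show "\<Omega> \<gamma> \<gamma>' v \<in> minor_group l" if "\<gamma> \<in> \<Gamma>" "\<gamma>' \<in> \<Gamma>" "v \<in> int_vectors" for \<gamma> \<gamma>' v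
    by (rule period_mem[OF that])
qed (auto simp: class_rep_def)

lemma class_rep_exists: obtains \<rho> where "class_rep \<rho>"
proof -
  note Z = add_subgroupD[OF add_subgroup_period_lattice]
  define \<rho> where "\<rho> x = (SOME y. y - x \<in> \<Gamma>)" for x
  have "class_rep \<rho>"
    unfolding class_rep_def
  proof (intro conjI ballI allI)
    fix \<gamma> x assume g: "\<gamma> \<in> \<Gamma>"
    have "y - (x + \<gamma>) \<in> \<Gamma> \<longleftrightarrow> y - x \<in> \<Gamma>" for y
      using Z(4)[OF _ g, of "y - (x + \<gamma>)"] Z(2)[OF _ g, of "y - x"] by (auto simp: algebra_simps)
    then show "\<rho> (x + \<gamma>) = \<rho> x" by (simp add: \<rho>_def)
  next
    fix x show "\<rho> x - x \<in> \<Gamma>" unfolding \<rho>_def by (rule someI[of _ x]) (use Z(1) in simp)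
  qed
  then show thesis by (rule that)
qed

text \<open>The value of the reflected cycle with respect to \<rho> is, up to sign, that of the
  cycle itself with respect to the reflected choice.\<close>

lemma class_rep_reflect: "class_rep \<rho> \<Longrightarrow> class_rep (\<lambda>x. - \<rho> (- x))"
  unfolding class_rep_def
proof (intro conjI ballI allI; elim conjE)
  note Z = add_subgroupD[OF add_subgroup_period_lattice]
  fix \<gamma> x assume "\<gamma> \<in> \<Gamma>" "\<forall>\<gamma>\<in>\<Gamma>. \<forall>x. \<rho> (x + \<gamma>) = \<rho> x"
  then have "\<rho> (- x + (- \<gamma>)) = \<rho> (- x)" using Z(3) by blast
  then show "- \<rho> (- (x + \<gamma>)) = - \<rho> (- x)" by simp
next
  note Z = add_subgroupD[OF add_subgroup_period_lattice]
  fix x assume "\<forall>x. \<rho> x - x \<in> \<Gamma>"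
  then have "- (\<rho> (- x) - (- x)) \<in> \<Gamma>" using Z(3) by blast
  then show "- \<rho> (- x) - x \<in> \<Gamma>" by simp
qed

text \<open>Lifts of the vertices along the star of vertex 0: with them the star edges close up
  exactly, and each other edge up to one loop.\<close>

definition \<xi> :: "nat \<Rightarrow> real ^ 3" where
  "\<xi> i = (if i = 0 then 0 else I (0, i))"

lemma edge_lift_mem:
  assumes "e \<in> edges (K4 l)"
  shows "\<xi> (fst e) + I e - \<xi> (snd e) \<in> \<Gamma>"
  using assms loop_mem[of 1] loop_mem[of 2] loop_mem[of 3] add_subgroupD(1)[OF add_subgroup_period_lattice]
  unfolding loop_simps by (auto simp: edges_K4 \<xi>_def algebra_simps)

lemma edge_vec_mem: "edge_vec \<omega> e \<in> int_vectors"
  by (auto simp: edge_vec_def int_vectors_def)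

text \<open>One lift of every edge is used, based at z; \<open>K_diff\<close> compares each summand
  with the corresponding difference of values of \<open>K\<close>.\<close>

definition image_value :: "(real ^ 3 \<Rightarrow> real ^ 3) \<Rightarrow> real ^ 3 \<Rightarrow> real" where
  "image_value \<rho> z = (\<Sum>e\<in>edges (K4 l).
     \<Omega> (\<rho> (z + \<xi> (fst e)) - \<rho> (z + \<xi> (fst e) + I e)) (z + \<xi> (fst e)) (edge_vec \<omega> e))"

text \<open>Write \<rho> as the identity plus a period g i at each lifted vertex. All terms with z
  cancel, because the outgoing directions at a vertex sum to 0, and the star edges have no other
  terms. Each remaining edge gives the product of the lengths of the star edges to its two ends, and
  what contains g combines to values on g and a loop.\<close>

lemma image_value:
  assumes \<rho>: "class_rep \<rho>"
  shows "image_value \<rho> z - (l $ 1 * l $ 2 + l $ 1 * l $ 3 + l $ 2 * l $ 3) \<in> minor_group l"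
proof -
  note Z = add_subgroupD[OF add_subgroup_minor_group[of l]]
  define g where "g i = \<rho> (z + \<xi> i) - (z + \<xi> i)" for i
  have g: "g i \<in> \<Gamma>" for i using \<rho> by (simp add: g_def class_rep_def)
  have \<rho>_tail: "\<rho> (z + \<xi> i) = z + \<xi> i + g i" for i by (simp add: g_def)
  have \<rho>_head: "\<rho> (z + \<xi> (fst e) + I e) = z + \<xi> (snd e) + g (snd e)" if "e \<in> edges (K4 l)" for e
  proof -
    have "\<rho> (z + \<xi> (snd e) + (\<xi> (fst e) + I e - \<xi> (snd e))) = \<rho> (z + \<xi> (snd e))"
      using \<rho> edge_lift_mem[OF that] by (simp only: class_rep_def)
    then show ?thesis by (simp add: g_def add.assoc)
  qed
  have "image_value \<rho> z = (\<Sum>e\<in>edges (K4 l).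
     \<Omega> (z + \<xi> (fst e) + g (fst e) - (z + \<xi> (snd e) + g (snd e))) (z + \<xi> (fst e)) (edge_vec \<omega> e))"
    unfolding image_value_def by (rule sum.cong) (simp_all only: \<rho>_head, simp only: \<rho>_tail)
  also have "\<dots> = (l $ 1 * l $ 2 + l $ 1 * l $ 3 + l $ 2 * l $ 3)
    - (\<Omega> (g 2) (loop 1) (edge_vec \<omega> (1, 2)) + \<Omega> (g 3) (loop 2) (edge_vec \<omega> (1, 3)) + \<Omega> (g 3) (loop 3) (edge_vec \<omega> (2, 3)))"
    unfolding edges_K4
    by (simp add: \<xi>_def C_linear C_loop C_edges K4_len_simps period_vec_simps triple_def vector_3 algebra_simps
        del: One_nat_def)
  finally have "image_value \<rho> z - (l $ 1 * l $ 2 + l $ 1 * l $ 3 + l $ 2 * l $ 3) =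
    - (\<Omega> (g 2) (loop 1) (edge_vec \<omega> (1, 2)) + \<Omega> (g 3) (loop 2) (edge_vec \<omega> (1, 3)) + \<Omega> (g 3) (loop 3) (edge_vec \<omega> (2, 3)))"
    by simp
  also have "\<dots> \<in> minor_group l" by (intro Z(3,4) period_mem g loop_mem edge_vec_mem)
  finally show ?thesis .
qed

section \<open>Walks, lifts of the vertices and the six segments of the image\<close>

definition walk_ints :: "nat \<Rightarrow> nat \<Rightarrow> (real ^ 3) set" where
  "walk_ints u v = {walk_integral (K4 l) \<omega> hs |hs. walk (K4 l) u hs v}"

lemma walk_intsI: "walk (K4 l) u hs v \<Longrightarrow> walk_integral (K4 l) \<omega> hs \<in> walk_ints u v"
  unfolding walk_ints_def by blast

lemma walk_ints_add:
  assumes "x \<in> walk_ints u v" "y \<in> walk_ints v w"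
  shows "x + y \<in> walk_ints u w"
proof -
  obtain hs hs' where "walk (K4 l) u hs v" "x = walk_integral (K4 l) \<omega> hs"
    "walk (K4 l) v hs' w" "y = walk_integral (K4 l) \<omega> hs'"
    using assms by (auto simp: walk_ints_def)
  then show ?thesis using walk_intsI[OF walk_append, of u hs v hs' w] by (simp add: walk_integral_append)
qed

lemma walk_ints_edge:
  assumes "e \<in> edges (K4 l)"
  shows "I e \<in> walk_ints (fst e) (snd e)" "- I e \<in> walk_ints (snd e) (fst e)"
proof -
  have w: "walk (K4 l) (fst e) [(e, False)] (snd e)" "walk (K4 l) (snd e) [(e, True)] (fst e)"
    using assms by (simp_all add: ends_K4)
  have "walk_integral (K4 l) \<omega> [(e, False)] = I e" "walk_integral (K4 l) \<omega> [(e, True)] = - I e"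
    by (simp_all add: walk_integral_def edge_integral_K4)
  then show "I e \<in> walk_ints (fst e) (snd e)" "- I e \<in> walk_ints (snd e) (fst e)"
    using walk_intsI[OF w(1)] walk_intsI[OF w(2)] by simp_all
qed

lemma walk_ints_zero: "0 \<in> walk_ints u u"
  using walk_intsI[of u "[]" u] by (simp add: walk_integral_def)

text \<open>Lifts are defined by walks, periods by 1-cycles. Each loop and its negative are
  integrals over a closed walk around a triangle, and closed walks at vertex 0 can be
  concatenated.\<close>

lemma period_lattice_walks: "\<gamma> \<in> \<Gamma> \<Longrightarrow> \<gamma> \<in> walk_ints 0 0"
proof -
  have e: "I (0, i) \<in> walk_ints 0 i" "- I (0, i) \<in> walk_ints i 0" if "i \<in> {1, 2, 3}" for i
    using walk_ints_edge[of "(0, i)"] that by (auto simp: edges_K4)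
  have f: "I (i, j) \<in> walk_ints i j" "- I (i, j) \<in> walk_ints j i" if "(i, j) \<in> {(1, 2), (1, 3), (2, 3)}" for i j
    using walk_ints_edge[of "(i, j)"] that by (auto simp: edges_K4)
  have tri: "I (0, i) - I (0, j) + I (i, j) \<in> walk_ints 0 0" "- (I (0, i) - I (0, j) + I (i, j)) \<in> walk_ints 0 0"
    if ij: "(i, j) \<in> {(1, 2), (1, 3), (2, 3)}" for i j
  proof -
    have r: "i \<in> {1, 2, 3}" "j \<in> {1, 2, 3}" using ij by auto
    show "I (0, i) - I (0, j) + I (i, j) \<in> walk_ints 0 0"
      using walk_ints_add[OF walk_ints_add[OF e(1)[OF r(1)] f(1)[OF ij]] e(2)[OF r(2)]] by (simp add: algebra_simps)
    show "- (I (0, i) - I (0, j) + I (i, j)) \<in> walk_ints 0 0"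
      using walk_ints_add[OF walk_ints_add[OF e(1)[OF r(2)] f(2)[OF ij]] e(2)[OF r(1)]] by (simp add: algebra_simps)
  qed
  have loops: "loop j \<in> walk_ints 0 0" "- loop j \<in> walk_ints 0 0" for j
    unfolding loop_def using tri[of 1 2] tri[of 1 3] tri[of 2 3] by simp_all
  have multiple: "of_int n *\<^sub>R loop j \<in> walk_ints 0 0" for n j
  proof (induction n rule: int_induct[where k = 0])
    case base
    then show ?case using walk_ints_zero by simp
  next
    case (step1 i)
    then show ?case using walk_ints_add[OF _ loops(1)] by (simp add: scaleR_add_left)
  next
    case (step2 i)
    then show ?case using walk_ints_add[OF _ loops(2), of "of_int i *\<^sub>R loop j"] by (simp add: scaleR_diff_left)
  qed
  assume "\<gamma> \<in> \<Gamma>"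
  then obtain n where "\<gamma> = (\<Sum>j\<in>UNIV. of_int (n j) *\<^sub>R loop j)" by (auto simp: period_lattice_K4)
  then have \<gamma>: "\<gamma> = of_int (n 1) *\<^sub>R loop 1 + of_int (n 2) *\<^sub>R loop 2 + of_int (n 3) *\<^sub>R loop 3"
    unfolding sum_3 .
  show ?thesis unfolding \<gamma> by (intro walk_ints_add[where v = 0] multiple)
qed

text \<open>Along a walk the deviation from \<xi> stays a period. Conversely, one can return to
  vertex 0 along the star, run through a closed walk with the given period, and leave along the star
  again.\<close>

lemma walk_ints_eq:
  assumes "u \<in> verts (K4 l)" "v \<in> verts (K4 l)"
  shows "walk_ints u v = {\<xi> v - \<xi> u + \<gamma> |\<gamma>. \<gamma> \<in> \<Gamma>}"
proof (intro equalityI subsetI)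
  note Z = add_subgroupD[OF add_subgroup_period_lattice]
  fix x assume "x \<in> walk_ints u v"
  then obtain hs where hs: "x = walk_integral (K4 l) \<omega> hs" "walk (K4 l) u hs v" by (auto simp: walk_ints_def)
  have "walk_integral (K4 l) \<omega> hs - (\<xi> v - \<xi> u) \<in> \<Gamma>" using hs(2)
  proof (induction hs arbitrary: u)
    case Nil
    then show ?case using Z(1) by (simp add: walk_integral_def)
  next
    case (Cons h hs)
    obtain e b where h: "h = (e, b)" by (cases h)
    have e: "e \<in> edges (K4 l)" and src: "(if b then snd e else fst e) = u"
      and w: "walk (K4 l) (if b then fst e else snd e) hs v"
      using Cons.prems by (simp_all add: h ends_K4)
    have 1: "walk_integral (K4 l) \<omega> hs - (\<xi> v - \<xi> (if b then fst e else snd e)) \<in> \<Gamma>" by (rule Cons.IH[OF w])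
    note 2 = edge_lift_mem[OF e]
    have int: "walk_integral (K4 l) \<omega> (h # hs) = (if b then - I e else I e) + walk_integral (K4 l) \<omega> hs"
      by (simp add: walk_integral_def h edge_integral_K4)
    show ?case
    proof (cases b)
      case True
      then show ?thesis using Z(2)[OF 1 2] src unfolding int by (simp add: algebra_simps)
    next
      case False
      then show ?thesis using Z(4)[OF 1 2] src unfolding int by (simp add: algebra_simps)
    qed
  qed
  then have "x - (\<xi> v - \<xi> u) \<in> \<Gamma>" by (simp add: hs(1))
  moreover have "x = \<xi> v - \<xi> u + (x - (\<xi> v - \<xi> u))" by simp
  ultimately show "x \<in> {\<xi> v - \<xi> u + \<gamma> |\<gamma>. \<gamma> \<in> \<Gamma>}" by blast
next
  fix x assume "x \<in> {\<xi> v - \<xi> u + \<gamma> |\<gamma>. \<gamma> \<in> \<Gamma>}"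
  then obtain \<gamma> where x: "x = - \<xi> u + \<gamma> + \<xi> v" "\<gamma> \<in> \<Gamma>" by auto
  have star: "\<xi> i \<in> walk_ints 0 i" "- \<xi> i \<in> walk_ints i 0" if "i \<in> verts (K4 l)" for i
    using walk_ints_edge[of "(0, i)"] walk_ints_zero[of 0] that by (auto simp: edges_K4 verts_K4 \<xi>_def)
  show "x \<in> walk_ints u v"
    unfolding x(1)
    by (rule walk_ints_add[OF walk_ints_add[OF star(2)[OF assms(1)] period_lattice_walks[OF x(2)]] star(1)[OF assms(2)]])
qed

text \<open>The base point enters only through the common translation z.\<close>

lemma vertex_lifts_K4:
  assumes "p\<^sub>0 \<in> points (K4 l)"
  obtains z where "\<And>v. v \<in> verts (K4 l) \<Longrightarrow> vertex_lifts (K4 l) \<omega> p\<^sub>0 v = {z + \<xi> v + \<gamma> |\<gamma>. \<gamma> \<in> \<Gamma>}"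
proof (cases p\<^sub>0)
  case (VPoint u)
  then have u: "u \<in> verts (K4 l)" using assms by (auto simp: points_def)
  show thesis
  proof (rule that[of "- \<xi> u"])
    fix v assume v: "v \<in> verts (K4 l)"
    have "vertex_lifts (K4 l) \<omega> p\<^sub>0 v = walk_ints u v" by (simp add: VPoint walk_ints_def)
    then show "vertex_lifts (K4 l) \<omega> p\<^sub>0 v = {- \<xi> u + \<xi> v + \<gamma> |\<gamma>. \<gamma> \<in> \<Gamma>}"
      unfolding walk_ints_eq[OF u v] by simp
  qed
next
  case (EPoint e t)
  then have "e \<in> edges (K4 l)" using assms by (auto simp: points_def)
  then have u: "fst e \<in> verts (K4 l)" by (auto simp: edges_K4 verts_K4)
  show thesis
  proof (rule that[of "- \<xi> (fst e) - t *\<^sub>R edge_vec \<omega> e"])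
    fix v assume v: "v \<in> verts (K4 l)"
    have "vertex_lifts (K4 l) \<omega> p\<^sub>0 v = (\<lambda>x. x - t *\<^sub>R edge_vec \<omega> e) ` walk_ints (fst e) v"
      by (auto simp: EPoint walk_ints_def ends_K4)
    also have "\<dots> = {- \<xi> (fst e) - t *\<^sub>R edge_vec \<omega> e + \<xi> v + \<gamma> |\<gamma>. \<gamma> \<in> \<Gamma>}"
      unfolding walk_ints_eq[OF u v] by (force simp: algebra_simps)
    finally show "vertex_lifts (K4 l) \<omega> p\<^sub>0 v = {- \<xi> (fst e) - t *\<^sub>R edge_vec \<omega> e + \<xi> v + \<gamma> |\<gamma>. \<gamma> \<in> \<Gamma>}" .
  qed
qed

text \<open>Some fundamental cycle runs through e exactly once, so one coordinate of the image under
  the integral map C is 1 or -1.\<close>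

lemma edge_vec_primitive:
  assumes "e \<in> edges (K4 l)"
  shows "primitive_vec (edge_vec \<omega> e)"
proof -
  have "\<exists>j\<in>{1, 2, 3}. cotree_form j e = 1 \<or> cotree_form j e = -1"
    using assms by (auto simp: edges_K4 cotree_form_def)
  then obtain j where j: "cotree_form j e = 1 \<or> cotree_form j e = -1" by blast
  show ?thesis
    unfolding primitive_vec_def
  proof (intro conjI allI impI)
    show "edge_vec \<omega> e \<in> int_vectors" by (rule edge_vec_mem)
    show "edge_vec \<omega> e \<noteq> 0"
    proof
      assume "edge_vec \<omega> e = 0"
      then have "C (edge_vec \<omega> e) $ j = 0" by (simp add: C_linear)
      then show False using j by (auto simp: C_edge)
    qed
    fix c assume "c *\<^sub>R edge_vec \<omega> e \<in> int_vectors"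
    then have "C (c *\<^sub>R edge_vec \<omega> e) $ j \<in> \<int>" using C_int by (simp add: int_vectors_def)
    then show "c \<in> \<int>" using j by (auto simp: C_linear C_edge)
  qed
qed

text \<open>Cells are sets, so two edges with the same segment would count only once in the image.
  In the coordinates given by C the six edge integrals are seen to differ, even up to sign.\<close>

lemma edge_segments_distinct:
  assumes e: "e \<in> edges (K4 l)" "e' \<in> edges (K4 l)" and eq: "I e' = I e \<or> I e' = - I e"
  shows "e = e'"
proof -
  have "C (I e') = C (I e) \<or> C (I e') = - C (I e)" using eq by (metis linear_neg[OF lin])
  then show ?thesis
    using e pos[of 1] pos[of 2] pos[of 3] pos[of 4] pos[of 5] pos[of 6] unfolding edges_K4
    by (auto simp: C_linear C_edges K4_len_simps vec_eq_iff forall_3 vector_3 simp del: One_nat_def)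
qed

text \<open>The six segments represent the orbits of the 1-cells without repetition, and all weights
  are 1; so the weight at x is the number of translates of these segments through x.\<close>

lemma image_weight_fun:
  assumes z: "\<And>v. v \<in> verts (K4 l) \<Longrightarrow> vertex_lifts (K4 l) \<omega> p\<^sub>0 v = {z + \<xi> v + \<gamma> |\<gamma>. \<gamma> \<in> \<Gamma>}"
  shows "weight_fun 1 (abel_jacobi_cycle (K4 l) \<omega> p\<^sub>0) x =
    (\<Sum>e\<in>edges (K4 l). int (card {\<gamma>\<in>\<Gamma>. x - \<gamma> \<in> closed_segment (z + \<xi> (fst e)) (z + \<xi> (fst e) + I e)}))"
proof -
  note Z = add_subgroupD[OF add_subgroup_period_lattice]
  let ?Z = "abel_jacobi_cycle (K4 l) \<omega> p\<^sub>0"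
  define seg where "seg e = closed_segment (z + \<xi> (fst e)) (z + \<xi> (fst e) + I e)" for e
  define X where "X = {(+) \<gamma> ` seg e |e \<gamma>. e \<in> edges (K4 l) \<and> \<gamma> \<in> \<Gamma>}"
  have shift: "(+) \<gamma> ` seg e = closed_segment (z + \<xi> (fst e) + \<gamma>) (z + \<xi> (fst e) + \<gamma> + I e)" for \<gamma> e
    unfolding seg_def closed_segment_translation[symmetric] by (simp add: add_ac)
  have dim: "aff_dim (closed_segment y (y + I e)) = 1" if "e \<in> edges (K4 l)" for y e
  proof -
    have "edge_vec \<omega> e \<noteq> 0" using edge_vec_primitive[OF that] by (simp add: primitive_vec_def)
    then have "y \<noteq> y + I e" using K4_len_pos[of e] by simp
    then show ?thesis unfolding segment_convex_hull aff_dim_convex_hull aff_dim_2 by (rule if_not_P)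
  qed
  have tail_vert: "fst e \<in> verts (K4 l)" if "e \<in> edges (K4 l)" for e using that by (auto simp: edges_K4 verts_K4)
  have cells: "cells ?Z = {{y} |y v. v \<in> verts (K4 l) \<and> y \<in> vertex_lifts (K4 l) \<omega> p\<^sub>0 v} \<union>
      {closed_segment y (y + I e) |y e. e \<in> edges (K4 l) \<and> y \<in> vertex_lifts (K4 l) \<omega> p\<^sub>0 (fst e)}"
    by (simp add: abel_jacobi_cycle_def edge_integral_K4 ends_K4)
  have X_iff: "P \<in> cells ?Z \<and> aff_dim P = 1 \<longleftrightarrow> P \<in> X" for P
  proof
    assume P: "P \<in> cells ?Z \<and> aff_dim P = 1"
    then have "P \<noteq> {y}" for y by auto
    then obtain y e where y: "e \<in> edges (K4 l)" "y \<in> vertex_lifts (K4 l) \<omega> p\<^sub>0 (fst e)" "P = closed_segment y (y + I e)"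
      using P unfolding cells by blast
    then obtain \<gamma> where "\<gamma> \<in> \<Gamma>" "y = z + \<xi> (fst e) + \<gamma>" using z[OF tail_vert[OF y(1)]] by blast
    then have "P = (+) \<gamma> ` seg e" unfolding shift y(3) by simp
    then show "P \<in> X" unfolding X_def using y(1) \<open>\<gamma> \<in> \<Gamma>\<close> by blast
  next
    assume "P \<in> X"
    then obtain e \<gamma> where P: "P = (+) \<gamma> ` seg e" "e \<in> edges (K4 l)" "\<gamma> \<in> \<Gamma>" unfolding X_def by blast
    have "z + \<xi> (fst e) + \<gamma> \<in> vertex_lifts (K4 l) \<omega> p\<^sub>0 (fst e)" using z[OF tail_vert[OF P(2)]] P(3) by blast
    then have "P \<in> cells ?Z" unfolding cells P(1) shift using P(2) by blast
    moreover have "aff_dim P = 1" unfolding P(1) shift by (rule dim[OF P(2)])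
    ultimately show "P \<in> cells ?Z \<and> aff_dim P = 1" ..
  qed
  \<comment> \<open>Equal segments have the same ends up to order, so their edge integrals agree up
    to sign.\<close>
  have same: "e = e'" if e: "e \<in> edges (K4 l)" "e' \<in> edges (K4 l)" and eq: "(+) \<gamma> ` seg e = (+) \<gamma>' ` seg e'" for e e' \<gamma> \<gamma>'
  proof (rule edge_segments_distinct[OF e])
    define a where "a = z + \<xi> (fst e) + \<gamma>"
    define b where "b = z + \<xi> (fst e') + \<gamma>'"
    have "{a, a + I e} = {b, b + I e'}" using eq unfolding shift closed_segment_eq a_def b_def .
    then have "(a = b \<and> a + I e = b + I e') \<or> (a = b + I e' \<and> a + I e = b)" by (auto simp: doubleton_eq_iff)
    then show "I e' = I e \<or> I e' = - I e"
    proof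
      assume "a = b \<and> a + I e = b + I e'"
      then have "b + I e' = b + I e" by (elim conjE) (simp only:)
      then have "I e' = I e" by (rule add_left_imp_eq)
      then show ?thesis ..
    next
      assume h: "a = b + I e' \<and> a + I e = b"
      have "b + (I e' + I e) = b + I e' + I e" by (rule add.assoc[symmetric])
      also have "\<dots> = b + 0" using h by (elim conjE) (simp only: add_0_right)
      finally have "I e' + I e = 0" by (rule add_left_imp_eq)
      then have "I e' = - I e" unfolding eq_neg_iff_add_eq_0 .
      then show ?thesis ..
    qed
  qed
  have seg0: "seg e = (+) 0 ` seg e" for e by simp
  have tr: "transversal (translates \<Gamma>) X (seg ` edges (K4 l))"
    unfolding transversal_def
  proof (intro conjI ballI)
    show "seg ` edges (K4 l) \<subseteq> X" unfolding X_def using seg0 Z(1) by blast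
    fix P assume "P \<in> X"
    then obtain e \<gamma> where P: "P = (+) \<gamma> ` seg e" "e \<in> edges (K4 l)" "\<gamma> \<in> \<Gamma>" unfolding X_def by blast
    show "\<exists>!r. r \<in> seg ` edges (K4 l) \<and> translates \<Gamma> P r"
    proof (rule ex1I[of _ "seg e"])
      have "seg e = (+) (- \<gamma>) ` P" unfolding P(1) translate_uminus ..
      then have "translates \<Gamma> P (seg e)" unfolding translates_def using Z(3)[OF P(3)] by (rule rev_bexI[rotated])
      then show "seg e \<in> seg ` edges (K4 l) \<and> translates \<Gamma> P (seg e)" using P(2) by simp
      fix r assume r: "r \<in> seg ` edges (K4 l) \<and> translates \<Gamma> P r"
      then obtain e' where e': "e' \<in> edges (K4 l)" "r = seg e'" by blast
      have "\<exists>\<gamma>'\<in>\<Gamma>. r = (+) \<gamma>' ` P" using r unfolding translates_def by (elim conjE)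
      then obtain \<gamma>' where "r = (+) \<gamma>' ` P" by (elim bexE)
      then have "(+) 0 ` seg e' = (+) (\<gamma>' + \<gamma>) ` seg e" using e'(2) unfolding P(1) translate_translate by simp
      from same[OF e'(1) P(2) this] show "r = seg e" using e'(2) by simp
    qed
  qed
  have inj: "inj_on seg (edges (K4 l))"
  proof (rule inj_onI)
    fix e e' assume "e \<in> edges (K4 l)" "e' \<in> edges (K4 l)" "seg e = seg e'"
    then show "e = e'" using same[of e e' 0 0] by simp
  qed
  have bd: "bounded P \<and> P \<noteq> {}" if "P \<in> X" for P using that unfolding X_def shift by (auto simp: bounded_closed_segment)
  have mem: "x \<in> (+) \<gamma> ` P \<longleftrightarrow> x - \<gamma> \<in> P" for \<gamma> P by (force intro: image_eqI[of _ _ "x - \<gamma>"])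
  obtain \<rho> where \<rho>: "class_rep \<rho>" by (rule class_rep_exists)
  interpret tropical_torus \<Gamma> \<Omega> "minor_group l" \<rho> by (rule torus[OF \<rho>])
  have "weight_fun 1 ?Z x = (\<Sum>P | P \<in> X \<and> x \<in> P. 1)"
    unfolding weight_fun_def X_iff[symmetric]
    by (rule sum.cong) (auto simp: abel_jacobi_cycle_def)
  also have "\<dots> = (\<Sum>P\<in>seg ` edges (K4 l). 1 * int (card {\<gamma>\<in>\<Gamma>. x \<in> (+) \<gamma> ` P}))"
  proof (rule sum_orbits[OF add_subgroup_period_lattice _ tr])
    show "finite (seg ` edges (K4 l))" by (simp add: edges_K4)
    show "(+) \<gamma> ` P \<in> X" if P: "P \<in> X" "\<gamma> \<in> \<Gamma>" for P \<gamma>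
    proof -
      obtain e \<gamma>' where e: "P = (+) \<gamma>' ` seg e" "e \<in> edges (K4 l)" "\<gamma>' \<in> \<Gamma>" using P(1) unfolding X_def by blast
      have "(+) \<gamma> ` P = (+) (\<gamma> + \<gamma>') ` seg e" unfolding e(1) translate_translate ..
      then show ?thesis unfolding X_def using e(2) Z(4)[OF P(2) e(3)] by blast
    qed
    show "\<gamma> = 0" if "P \<in> X" "\<gamma> \<in> \<Gamma>" "(+) \<gamma> ` P = P" for P \<gamma>
      by (rule bounded_translate_fixed[of P]) (use bd[OF that(1)] that(3) in auto)
    show "finite {\<gamma>\<in>\<Gamma>. x \<in> (+) \<gamma> ` P}" if "P \<in> seg ` edges (K4 l)" for P
      unfolding mem by (rule finite_translates) (use that seg_def in \<open>auto simp: bounded_closed_segment\<close>)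
  qed simp
  also have "\<dots> = (\<Sum>e\<in>edges (K4 l). int (card {\<gamma>\<in>\<Gamma>. x - \<gamma> \<in> seg e}))"
    by (simp add: sum.reindex[OF inj] mem)
  finally show ?thesis unfolding seg_def .
qed

end

lemma weight_fun_neg_cycle: "weight_fun k (neg_cycle Z) x = weight_fun k Z (- x)"
proof -
  have inj: "inj_on ((`) uminus) A" for A :: "'a set set"
    by (rule inj_on_inverseI[of _ "(`) uminus"]) (simp add: image_image)
  have dim: "aff_dim (uminus ` P) = aff_dim P" for P :: "'a set"
    by (rule aff_dim_injective_linear_image) (auto intro: linearI simp: inj_on_def)
  have mem: "x \<in> uminus ` P \<longleftrightarrow> - x \<in> P" for P by force
  have "{Q \<in> cells (neg_cycle Z). aff_dim Q = int k \<and> x \<in> Q} =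
      (`) uminus ` {P \<in> cells Z. aff_dim P = int k \<and> - x \<in> P}"
    by (auto simp: neg_cycle_def dim mem)
  then have "weight_fun k (neg_cycle Z) x =
      (\<Sum>Q\<in>(`) uminus ` {P \<in> cells Z. aff_dim P = int k \<and> - x \<in> P}. weight (neg_cycle Z) Q)"
    by (simp add: weight_fun_def)
  also have "\<dots> = weight_fun k Z (- x)"
    by (simp add: sum.reindex[OF inj] weight_fun_def neg_cycle_def image_image)
  finally show ?thesis .
qed

text \<open>The image minus its reflection is a family of twelve segments, and its value would have
  to lie in the group of minors. Up to that group this value is the sum of
  \<open>image_value\<close> for \<rho> and for the reflected choice, and each of them is congruent
  to \<tau>.\<close>

lemma (in K4_curve) not_algebraically_equivalent:
  assumes generic: "2 * (l $ 1 * l $ 2 + l $ 1 * l $ 3 + l $ 2 * l $ 3) \<notin> minor_group l"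
    and p\<^sub>0: "p\<^sub>0 \<in> points (K4 l)"
  shows "\<not> algebraically_equivalent \<Gamma> 1 (abel_jacobi_cycle (K4 l) \<omega> p\<^sub>0) (neg_cycle (abel_jacobi_cycle (K4 l) \<omega> p\<^sub>0))"
proof
  let ?Z = "abel_jacobi_cycle (K4 l) \<omega> p\<^sub>0"
  let ?E = "edges (K4 l)"
  assume "algebraically_equivalent \<Gamma> 1 ?Z (neg_cycle ?Z)"
  then obtain S :: "(nat, nat) mgraph" and s\<^sub>1 s\<^sub>2 W f\<^sub>1 f\<^sub>2 where
    S: "metric_graph S" "algebraic_cycle \<Gamma> S 2 W" and
    f: "is_fibre S 1 W s\<^sub>1 f\<^sub>1" "s\<^sub>1 \<in> points S" "is_fibre S 1 W s\<^sub>2 f\<^sub>2" "s\<^sub>2 \<in> points S" and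
    eq: "cycle_eq \<Gamma> 1 (\<lambda>x. f\<^sub>1 x - f\<^sub>2 x) (\<lambda>x. weight_fun 1 ?Z x - weight_fun 1 (neg_cycle ?Z) x)"
    unfolding algebraically_equivalent_def one_add_one by blast
  obtain z where z: "\<And>v. v \<in> verts (K4 l) \<Longrightarrow> vertex_lifts (K4 l) \<omega> p\<^sub>0 v = {z + \<xi> v + \<gamma> |\<gamma>. \<gamma> \<in> \<Gamma>}"
    by (rule vertex_lifts_K4[OF p\<^sub>0]) (rule that)
  obtain \<rho> where \<rho>: "class_rep \<rho>" by (rule class_rep_exists)
  interpret torus_family \<Gamma> \<Omega> "minor_group l" \<rho> S W
    using torus[OF \<rho>] S by (simp add: torus_family_def torus_family_axioms_def)
  define p where "p e = z + \<xi> (fst e)" for e :: "nat \<times> nat"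
  let ?v = "edge_vec \<omega>"
  let ?l = "K4_len l"
  have finE: "finite ?E" by (simp add: edges_K4)
  have neg: "{\<gamma>\<in>\<Gamma>. - x - \<gamma> \<in> closed_segment a b} = uminus ` {\<gamma>\<in>\<Gamma>. x - \<gamma> \<in> closed_segment (- a) (- b)}" for x a b
  proof -
    have "- x - \<gamma> \<in> closed_segment a b \<longleftrightarrow> x - (- \<gamma>) \<in> closed_segment (- a) (- b)" for \<gamma>
    proof -
      have "closed_segment (- a) (- b) = uminus ` closed_segment a b"
        by (rule closed_segment_linear_image) (auto intro: linearI)
      moreover have "x - (- \<gamma>) = - (- x - \<gamma>)" by simp
      ultimately show ?thesis by (simp only: inj_image_mem_iff[OF inj_uminus])
    qed
    note iff = this
    show ?thesis
    proof (intro equalityI subsetI)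
      fix \<gamma> assume "\<gamma> \<in> {\<gamma>\<in>\<Gamma>. - x - \<gamma> \<in> closed_segment a b}"
      then have "- \<gamma> \<in> {\<gamma>\<in>\<Gamma>. x - \<gamma> \<in> closed_segment (- a) (- b)}"
        using add_subgroupD(3)[OF \<Gamma>] iff by simp
      then show "\<gamma> \<in> uminus ` {\<gamma>\<in>\<Gamma>. x - \<gamma> \<in> closed_segment (- a) (- b)}"
        by (rule rev_image_eqI) simp
    next
      fix \<gamma> assume "\<gamma> \<in> uminus ` {\<gamma>\<in>\<Gamma>. x - \<gamma> \<in> closed_segment (- a) (- b)}"
      then obtain \<delta> where "\<delta> \<in> \<Gamma>" "x - \<delta> \<in> closed_segment (- a) (- b)" "\<gamma> = - \<delta>" by blast
      then show "\<gamma> \<in> {\<gamma>\<in>\<Gamma>. - x - \<gamma> \<in> closed_segment a b}"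
        using add_subgroupD(3)[OF \<Gamma>] iff[of "- \<delta>"] by simp
    qed
  qed
  define p' where "p' = case_sum p (\<lambda>e. - p e)"
  define v' where "v' = case_sum ?v (\<lambda>e. - ?v e)"
  define l' where "l' = case_sum ?l ?l"
  define w' :: "_ + _ \<Rightarrow> int" where "w' = case_sum (\<lambda>e::nat \<times> nat. 1) (\<lambda>e::nat \<times> nat. - 1)"
  have card_neg: "card {\<gamma>\<in>\<Gamma>. - x - \<gamma> \<in> closed_segment (p e) (p e + I e)} =
      card {\<gamma>\<in>\<Gamma>. x - \<gamma> \<in> closed_segment (- p e) (- p e + ?l e *\<^sub>R - ?v e)}" for x and e :: "nat \<times> nat"
    unfolding neg by (subst card_image) (auto simp: inj_on_def)
  have image: "weight_fun 1 ?Z x = (\<Sum>e\<in>?E. int (card {\<gamma>\<in>\<Gamma>. x - \<gamma> \<in> closed_segment (p e) (p e + I e)}))" for x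
    unfolding p_def by (rule image_weight_fun) (rule z)
  have weights: "weight_fun 1 ?Z x - weight_fun 1 (neg_cycle ?Z) x =
      (\<Sum>i\<in>?E <+> ?E. w' i * int (card {\<gamma>\<in>\<Gamma>. x - \<gamma> \<in> closed_segment (p' i) (p' i + l' i *\<^sub>R v' i)}))" for x
    unfolding weight_fun_neg_cycle image card_neg
    by (simp add: sum.Plus finE w'_def p'_def v'_def l'_def sum_negf)
  have "(\<Sum>i\<in>?E <+> ?E. of_int (w' i) * (K (v' i) (p' i) - K (v' i) (p' i + l' i *\<^sub>R v' i))) \<in> minor_group l"
  proof (rule cycle_invariant[OF f])
    show "finite (?E <+> ?E)" using finE by simp
    show "primitive_vec (v' i)" "0 \<le> l' i" if "i \<in> ?E <+> ?E" for i
      using that edge_vec_primitive K4_len_pos[THEN less_imp_le] by (auto simp: v'_def l'_def)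
  qed (use eq in \<open>simp only: weights\<close>)
  then have 1: "(\<Sum>e\<in>?E. (K (?v e) (p e) - K (?v e) (p e + I e))
      - (K (- ?v e) (- p e) - K (- ?v e) (- p e + ?l e *\<^sub>R - ?v e))) \<in> minor_group l"
    by (simp add: sum.Plus finE w'_def p'_def v'_def l'_def sum_negf sum_subtractf sum.distrib algebra_simps)
  have 2: "(\<Sum>e\<in>?E. (K (?v e) (p e) - K (?v e) (p e + I e) - \<Omega> (\<rho> (p e) - \<rho> (p e + I e)) (p e) (?v e))
      - (K (- ?v e) (- p e) - K (- ?v e) (- p e + ?l e *\<^sub>R - ?v e)
        - \<Omega> (\<rho> (- p e) - \<rho> (- p e + ?l e *\<^sub>R - ?v e)) (- p e) (- ?v e))) \<in> minor_group l"
    using add_subgroupD(3)[OF add_subgroup_int_vectors]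
    by (intro add_subgroup_sum[OF M] add_subgroupD(2)[OF M] K_diff edge_vec_mem) (auto intro: edge_vec_mem)
  \<comment> \<open>Reflection negates all three arguments of \<Omega>, so subtracting the reflected
    terms amounts to adding those of the reflected choice.\<close>
  have "image_value \<rho> z + image_value (\<lambda>x. - \<rho> (- x)) z =
      (\<Sum>e\<in>?E. \<Omega> (\<rho> (p e) - \<rho> (p e + I e)) (p e) (?v e)
        - \<Omega> (\<rho> (- p e) - \<rho> (- p e + ?l e *\<^sub>R - ?v e)) (- p e) (- ?v e))"
    unfolding image_value_def p_def[symmetric] sum.distrib[symmetric]
  proof (rule sum.cong[OF refl])
    fix e
    have "- (p e + I e) = - p e + ?l e *\<^sub>R - ?v e" by simp
    then have "- \<rho> (- p e) - - \<rho> (- (p e + I e)) = - (\<rho> (- p e) - \<rho> (- p e + ?l e *\<^sub>R - ?v e))" by simp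
    then show "\<Omega> (\<rho> (p e) - \<rho> (p e + I e)) (p e) (?v e)
        + \<Omega> (- \<rho> (- p e) - - \<rho> (- (p e + I e))) (p e) (?v e) =
      \<Omega> (\<rho> (p e) - \<rho> (p e + I e)) (p e) (?v e)
        - \<Omega> (\<rho> (- p e) - \<rho> (- p e + ?l e *\<^sub>R - ?v e)) (- p e) (- ?v e)"
      by (simp only: \<Omega>_minus)
  qed
  also have "\<dots> \<in> minor_group l"
    using add_subgroupD(2)[OF M 1 2] by (simp add: sum_subtractf[symmetric] algebra_simps)
  finally have 3: "image_value \<rho> z + image_value (\<lambda>x. - \<rho> (- x)) z \<in> minor_group l" .
  have 4: "(image_value \<rho> z - (l $ 1 * l $ 2 + l $ 1 * l $ 3 + l $ 2 * l $ 3))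
    + (image_value (\<lambda>x. - \<rho> (- x)) z - (l $ 1 * l $ 2 + l $ 1 * l $ 3 + l $ 2 * l $ 3)) \<in> minor_group l"
    by (intro add_subgroupD(4)[OF M] image_value \<rho> class_rep_reflect)
  have "2 * (l $ 1 * l $ 2 + l $ 1 * l $ 3 + l $ 2 * l $ 3) \<in> minor_group l"
    using add_subgroupD(2)[OF M 3 4] by (simp add: algebra_simps)
  then show False using generic by simp
qed

theorem theorem3:
  shows "generic_lengths (\<lambda>l :: real ^ 6.
    \<forall>(\<omega> :: 3 \<Rightarrow> nat \<times> nat \<Rightarrow> int) p\<^sub>0.
      forms_basis (K4 l) \<omega> \<and> p\<^sub>0 \<in> points (K4 l) \<longrightarrow>
      \<not> algebraically_equivalent (period_lattice (K4 l) \<omega>) 1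
          (abel_jacobi_cycle (K4 l) \<omega> p\<^sub>0)
          (neg_cycle (abel_jacobi_cycle (K4 l) \<omega> p\<^sub>0)))"
proof -
  obtain \<P> where \<P>: "countable \<P>" "\<forall>p\<in>\<P>. real_polynomial_function p \<and> p \<noteq> (\<lambda>_. 0)"
    "\<forall>l::real ^ 6. (\<forall>i. 0 < l $ i) \<and> (\<forall>p\<in>\<P>. p l \<noteq> 0) \<longrightarrow>
      2 * (l $ 1 * l $ 2 + l $ 1 * l $ 3 + l $ 2 * l $ 3) \<notin> minor_group l"
    using generic_minor_group unfolding generic_lengths_def by blast
  show ?thesis
    unfolding generic_lengths_def
  proof (intro exI[of _ \<P>] conjI \<P>(1,2) allI impI)
    fix l :: "real ^ 6" and \<omega> :: "3 \<Rightarrow> nat \<times> nat \<Rightarrow> int" and p\<^sub>0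
    assume l: "(\<forall>i. 0 < l $ i) \<and> (\<forall>p\<in>\<P>. p l \<noteq> 0)" and \<omega>: "forms_basis (K4 l) \<omega> \<and> p\<^sub>0 \<in> points (K4 l)"
    obtain C where "linear C" "\<And>x. x \<in> int_vectors \<Longrightarrow> C x \<in> int_vectors"
      "\<And>e j. C (edge_vec \<omega> e) $ j = of_int (cotree_form j e)"
      by (rule cotree_coordinates[OF conjunct1[OF \<omega>]]) (rule that)
    then interpret K4_curve l \<omega> C using l by (auto simp: K4_curve_def)
    show "\<not> algebraically_equivalent (period_lattice (K4 l) \<omega>) 1
        (abel_jacobi_cycle (K4 l) \<omega> p\<^sub>0) (neg_cycle (abel_jacobi_cycle (K4 l) \<omega> p\<^sub>0))"
      using not_algebraically_equivalent \<P>(3) l \<omega> by blast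
  qed
qed

end
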